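(* Assume that $\downarrow$-loveliness is first-order. Let $\langle M,P(M)\rangle$ be a lovely pair and let $\bar a\subset M$ be P-independent. Let $f:P(M)^n\to M^{\mathrm{eq}}$ be $T^d$-definable with parameters $\bar a$ (i.e. definable by an $\mathcal L^2$-formula over $\bar a$). Then there exists $g:M^n\to M^{\mathrm{eq}}$ which is $T$-definable with parameters $\bar a$ (i.e. definable in the $\mathcal L$-structure $M$ over $\bar a$), such that $f=g\restriction P(M)^n$.
   Context: $T$ is a complete first-order theory in a language $\mathcal L$ and $\mathfrak C$ is a monster model of $T$; "small" means of cardinality smaller than the monstrosity of $\mathfrak C$ (its degree of saturation and strong homogeneity); tuples have small length. Juxtaposition denotes union, and tuples are identified with their sets of entries. An independence relation on $\mathfrak C$ is a ternary relation $A\downarrow_C B$ on small subsets of $\mathfrak C$ such that for all small $A,B,C,D$: (Invariance) $A\downarrow_B C\Rightarrow\sigma(A)\downarrow_{\sigma(B)}\sigma(C)$ for $\sigma\in\mathrm{Aut}(\mathfrak C)$; (Normality) $A\downarrow_C B\Rightarrow AC\downarrow_C B$; (Symmetry) $A\downarrow_B C\Rightarrow C\downarrow_B A$; (Transitivity) if $B\subseteq C\subseteq D$, then $A\downarrow_B D$ iff $A\downarrow_B C$ and $A\downarrow_C D$; (Finite character) $A\downarrow_B C$ iff $A_0\downarrow_B C$ for all finite $A_0\subseteq A$; (Extension) there is $A'\equiv_B A$ with $A'\downarrow_B C$; (Local character) there is a small cardinal $\lambda$ depending only on $\downarrow$ such that for all small $A,C$ there is $C_0\subseteq C$ with $|C_0|<\lambda+|A|^+$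 and $A\downarrow_{C_0}C$. For arbitrary $A,B,C\subseteq\mathfrak C$, $A\downarrow_B C$ means: for all small $A'\subseteq A$, $B'\subseteq B$, $C'\subseteq C$ there is a small $B''$ with $B'\subseteq B''\subseteq B$ and $A'\downarrow_{B''}C'$. Fix an independence relation $\downarrow$ on $\mathfrak C$. $\kappa_0$ is the least regular cardinal $\mu$ such that for every finite tuple $\bar a$ and small set $B$ there is $B_0\subseteq B$ with $|B_0|<\mu$ and $\bar a\downarrow_{B_0}B$. $\mathcal L^2=\mathcal L\cup\{P\}$ with $P$ a new unary predicate; $T^2$ is the theory of all expansions of $T$ to $\mathcal L^2$. A superscript 1 (resp. 2) on a model-theoretic notion refers to $\mathcal L$ (resp. $\mathcal L^2$). Models of $T$ are elementary substructures of $\mathfrak C$; a model of $T^2$ is written $M_P=\langle M,P(M)\rangle$, and $P(A)=P(M)\cap A$ for $A\subseteq M$. For a complete type $q$ over $A\supseteq B$, $q\downarrow_B A$ means $c\downarrow_B A$ for a realization $c$ of $q$ in $\mathfrak C$. Fix a small cardinal $\kappa>\max(\kappa_0,|T|)$; a set or tuple is very small if its cardinality is $<\kappa$. $M_P\models T^2$ is a ($\downarrow$-)lovely pair if: (1) $M$ is a small model of $T$; (2) (Density property) for every very small $A\subset M$ and $q\in S^1_1(A)$ with $q\downarrow_{P(A)}A$, $q$ is realized in $P(M)$; (3) (Extension property) for every very small $A\subset M$ and $q\in S^1_1(A)$ there is $b\in M$ realizing $q$ with $b\downarrow_A P(M)$. $T^d$ is the $\mathcal L^2$-theory of $\downarrow$-lovely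 pairs. "Loveliness is first-order" means that every sufficiently saturated model of $T^d$ is a lovely pair. A set (or tuple) $A\subseteq M$ is P-independent if $A\downarrow_{P(A)}P(M)$. $M^{\mathrm{eq}}$ is formed with respect to the $\mathcal L$-structure $M$. *)

theory Defs
  imports Main
begin

unbundle cardinal_syntax

subsection \<open>First-order logic with parameters\<close>

record ('f, 'r) lang =
  funs :: "'f set"
  rels :: "'r set"
  fun_ar :: "'f \<Rightarrow> nat"
  rel_ar :: "'r \<Rightarrow> nat"

record ('a, 'f, 'r) struct =
  univ :: "'a set"
  fun_int :: "'f \<Rightarrow> 'a list \<Rightarrow> 'a"
  rel_int :: "'r \<Rightarrow> 'a list \<Rightarrow> bool"

datatype 'f trm = Var nat | App 'f "'f trm list"

datatype ('f, 'r) fm =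
    Falsum
  | Equ "'f trm" "'f trm"
  | Atom 'r "'f trm list"
  | Imp "('f, 'r) fm" "('f, 'r) fm"
  | All nat "('f, 'r) fm"

abbreviation Neg :: "('f, 'r) fm \<Rightarrow> ('f, 'r) fm" where
  "Neg \<phi> \<equiv> Imp \<phi> Falsum"

primrec wf_trm :: "('f, 'r) lang \<Rightarrow> 'f trm \<Rightarrow> bool" where
  "wf_trm L (Var x) = True"
| "wf_trm L (App g ts) = (g \<in> funs L \<and> length ts = fun_ar L g \<and> list_all (wf_trm L) ts)"

primrec wf_fm :: "('f, 'r) lang \<Rightarrow> ('f, 'r) fm \<Rightarrow> bool" where
  "wf_fm L Falsum = True"
| "wf_fm L (Equ s t) = (wf_trm L s \<and> wf_trm L t)"
| "wf_fm L (Atom R ts) = (R \<in> rels L \<and> length ts = rel_ar L R \<and> list_all (wf_trm L) ts)"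
| "wf_fm L (Imp \<phi> \<psi>) = (wf_fm L \<phi> \<and> wf_fm L \<psi>)"
| "wf_fm L (All x \<phi>) = wf_fm L \<phi>"

primrec vars :: "'f trm \<Rightarrow> nat set" where
  "vars (Var x) = {x}"
| "vars (App g ts) = \<Union> (set (map vars ts))"

primrec fv :: "('f, 'r) fm \<Rightarrow> nat set" where
  "fv Falsum = {}"
| "fv (Equ s t) = vars s \<union> vars t"
| "fv (Atom R ts) = \<Union> (set (map vars ts))"
| "fv (Imp \<phi> \<psi>) = fv \<phi> \<union> fv \<psi>"
| "fv (All x \<phi>) = fv \<phi> - {x}"

primrec val :: "('a, 'f, 'r) struct \<Rightarrow> (nat \<Rightarrow> 'a) \<Rightarrow> 'f trm \<Rightarrow> 'a" where
  "val S e (Var x) = e x"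
| "val S e (App g ts) = fun_int S g (map (val S e) ts)"

primrec sat :: "('a, 'f, 'r) struct \<Rightarrow> (nat \<Rightarrow> 'a) \<Rightarrow> ('f, 'r) fm \<Rightarrow> bool" where
  "sat S e Falsum = False"
| "sat S e (Equ s t) = (val S e s = val S e t)"
| "sat S e (Atom R ts) = rel_int S R (map (val S e) ts)"
| "sat S e (Imp \<phi> \<psi>) = (sat S e \<phi> \<longrightarrow> sat S e \<psi>)"
| "sat S e (All x \<phi>) = (\<forall>a\<in>univ S. sat S (e(x := a)) \<phi>)"

definition sentences :: "('f, 'r) lang \<Rightarrow> ('f, 'r) fm set" where
  "sentences L = {\<phi>. wf_fm L \<phi> \<and> fv \<phi> = {}}"

definition tuples :: "nat \<Rightarrow> 'a set \<Rightarrow> 'a list set" where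
  "tuples n X = {xs. length xs = n \<and> set xs \<subseteq> X}"

definition is_struct :: "('f, 'r) lang \<Rightarrow> ('a, 'f, 'r) struct \<Rightarrow> bool" where
  "is_struct L S \<longleftrightarrow>
     univ S \<noteq> {} \<and> (\<forall>g\<in>funs L. \<forall>xs\<in>tuples (fun_ar L g) (univ S). fun_int S g xs \<in> univ S)"

definition models :: "('a, 'f, 'r) struct \<Rightarrow> ('f, 'r) fm set \<Rightarrow> bool" where
  "models S \<Gamma> \<longleftrightarrow> (\<forall>\<phi>\<in>\<Gamma>. \<forall>e. range e \<subseteq> univ S \<longrightarrow> sat S e \<phi>)"

text \<open>
  Theories are taken to be deductively closed, so a complete theory contains exactly one of
  each sentence and its negation, and \<open>|T|\<close> is the cardinality of the language plus
  \<open>\<aleph>\<^sub>0\<close>.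
\<close>

definition complete_theory :: "('f, 'r) lang \<Rightarrow> ('f, 'r) fm set \<Rightarrow> bool" where
  "complete_theory L T \<longleftrightarrow>
     T \<subseteq> sentences L \<and> (\<forall>\<phi>\<in>sentences L. \<phi> \<in> T \<longleftrightarrow> Neg \<phi> \<notin> T)"

text \<open>
  \<open>Inr a\<close> is a constant symbol naming \<open>a\<close>.  The expansion interprets all of them; only the
  language restricts which parameters may occur.
\<close>

definition lang_params :: "('f, 'r) lang \<Rightarrow> 'a set \<Rightarrow> ('f + 'a, 'r) lang" where
  "lang_params L A =
     \<lparr>funs = Inl ` funs L \<union> Inr ` A, rels = rels L,
      fun_ar = case_sum (fun_ar L) (\<lambda>a. 0), rel_ar = rel_ar L\<rparr>"

definition struct_params :: "('a, 'f, 'r) struct \<Rightarrow> ('a, 'f + 'a, 'r) struct" where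
  "struct_params S =
     \<lparr>univ = univ S, fun_int = case_sum (fun_int S) (\<lambda>a xs. a), rel_int = rel_int S\<rparr>"

text \<open>Complete 1-types over \<open>A\<close> in the single free variable \<open>Var 0\<close>.\<close>

definition types1 :: "('f, 'r) lang \<Rightarrow> ('a, 'f, 'r) struct \<Rightarrow> 'a set \<Rightarrow> ('f + 'a, 'r) fm set set"
  where
  "types1 L S A =
     {q. q \<subseteq> {\<phi>. wf_fm (lang_params L A) \<phi> \<and> fv \<phi> \<subseteq> {0}} \<and>
         (\<forall>\<phi>. wf_fm (lang_params L A) \<phi> \<and> fv \<phi> \<subseteq> {0} \<longrightarrow> \<phi> \<in> q \<or> Neg \<phi> \<in> q) \<and>
         (\<forall>q0\<subseteq>q. finite q0 \<longrightarrow> (\<exists>c\<in>univ S. \<forall>\<phi>\<in>q0. sat (struct_params S) (\<lambda>_. c) \<phi>))}"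

definition realizes :: "('a, 'f, 'r) struct \<Rightarrow> 'a \<Rightarrow> ('f + 'a, 'r) fm set \<Rightarrow> bool" where
  "realizes S c q \<longleftrightarrow> (\<forall>\<phi>\<in>q. sat (struct_params S) (\<lambda>_. c) \<phi>)"

definition saturated :: "('f, 'r) lang \<Rightarrow> ('a, 'f, 'r) struct \<Rightarrow> 'k rel \<Rightarrow> bool" where
  "saturated L S \<theta> \<longleftrightarrow>
     (\<forall>A\<subseteq>univ S. |A| <o \<theta> \<longrightarrow> (\<forall>q\<in>types1 L S A. \<exists>c\<in>univ S. realizes S c q))"

definition automorphism :: "('f, 'r) lang \<Rightarrow> ('a, 'f, 'r) struct \<Rightarrow> ('a \<Rightarrow> 'a) \<Rightarrow> bool" where
  "automorphism L S \<sigma> \<longleftrightarrow>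
     bij_betw \<sigma> (univ S) (univ S) \<and>
     (\<forall>g\<in>funs L. \<forall>xs\<in>tuples (fun_ar L g) (univ S).
        \<sigma> (fun_int S g xs) = fun_int S g (map \<sigma> xs)) \<and>
     (\<forall>R\<in>rels L. \<forall>xs\<in>tuples (rel_ar L R) (univ S).
        rel_int S R (map \<sigma> xs) \<longleftrightarrow> rel_int S R xs)"

definition elementary_map ::
  "('f, 'r) lang \<Rightarrow> ('a, 'f, 'r) struct \<Rightarrow> 'a set \<Rightarrow> ('a \<Rightarrow> 'a) \<Rightarrow> bool" where
  "elementary_map L S D h \<longleftrightarrow>
     h ` D \<subseteq> univ S \<and>
     (\<forall>\<phi> e. wf_fm L \<phi> \<and> range e \<subseteq> D \<longrightarrow> (sat S e \<phi> \<longleftrightarrow> sat S (h \<circ> e) \<phi>))"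

definition strongly_homogeneous :: "('f, 'r) lang \<Rightarrow> ('a, 'f, 'r) struct \<Rightarrow> 'k rel \<Rightarrow> bool" where
  "strongly_homogeneous L S \<theta> \<longleftrightarrow>
     (\<forall>D h. D \<subseteq> univ S \<and> |D| <o \<theta> \<and> elementary_map L S D h \<longrightarrow>
        (\<exists>\<sigma>. automorphism L S \<sigma> \<and> (\<forall>x\<in>D. \<sigma> x = h x)))"

definition monster_model ::
  "('f, 'r) lang \<Rightarrow> ('f, 'r) fm set \<Rightarrow> 'k rel \<Rightarrow> ('a, 'f, 'r) struct \<Rightarrow> bool" where
  "monster_model L T \<mu> \<CC> \<longleftrightarrow>
     is_struct L \<CC> \<and> models \<CC> T \<and> Card_order \<mu> \<and>
     saturated L \<CC> \<mu> \<and> strongly_homogeneous L \<CC> \<mu>"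

text \<open>\<open>equiv_over L S B A A'\<close> is \<open>A' \<equiv>\<^sub>B A\<close>, for some enumerations of \<open>A\<close> and \<open>A'\<close>.\<close>

definition equiv_over ::
  "('f, 'r) lang \<Rightarrow> ('a, 'f, 'r) struct \<Rightarrow> 'a set \<Rightarrow> 'a set \<Rightarrow> 'a set \<Rightarrow> bool" where
  "equiv_over L S B A A' \<longleftrightarrow>
     (\<exists>h. elementary_map L S (A \<union> B) h \<and> h ` A = A' \<and> (\<forall>b\<in>B. h b = b))"

definition small :: "'k rel \<Rightarrow> ('a, 'f, 'r) struct \<Rightarrow> 'a set \<Rightarrow> bool" where
  "small \<mu> \<CC> A \<longleftrightarrow> A \<subseteq> univ \<CC> \<and> |A| <o \<mu>"


subsection \<open>Independence relations\<close>

text \<open>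
  \<open>indep A B C\<close> stands for \<open>A\<close> being independent from \<open>C\<close> over \<open>B\<close>: the middle argument
  is the base.  Only its values on small sets are constrained or used.
\<close>

definition independence_relation ::
  "('f, 'r) lang \<Rightarrow> 'k rel \<Rightarrow> ('a, 'f, 'r) struct \<Rightarrow> ('a set \<Rightarrow> 'a set \<Rightarrow> 'a set \<Rightarrow> bool) \<Rightarrow> bool"
  where
  "independence_relation L \<mu> \<CC> indep \<longleftrightarrow>
     \<comment> \<open>invariance\<close>
     (\<forall>A B C \<sigma>. small \<mu> \<CC> A \<and> small \<mu> \<CC> B \<and> small \<mu> \<CC> C \<and> automorphism L \<CC> \<sigma> \<and> indep A B C
        \<longrightarrow> indep (\<sigma> ` A) (\<sigma> ` B) (\<sigma> ` C)) \<and>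
     \<comment> \<open>normality\<close>
     (\<forall>A B C. small \<mu> \<CC> A \<and> small \<mu> \<CC> B \<and> small \<mu> \<CC> C \<and> indep A C B
        \<longrightarrow> indep (A \<union> C) C B) \<and>
     \<comment> \<open>symmetry\<close>
     (\<forall>A B C. small \<mu> \<CC> A \<and> small \<mu> \<CC> B \<and> small \<mu> \<CC> C \<and> indep A B C
        \<longrightarrow> indep C B A) \<and>
     \<comment> \<open>transitivity\<close>
     (\<forall>A B C D. small \<mu> \<CC> A \<and> small \<mu> \<CC> D \<and> B \<subseteq> C \<and> C \<subseteq> D
        \<longrightarrow> (indep A B D \<longleftrightarrow> indep A B C \<and> indep A C D)) \<and>
     \<comment> \<open>finite character\<close>
     (\<forall>A B C. small \<mu> \<CC> A \<and> small \<mu> \<CC> B \<and> small \<mu> \<CC> C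
        \<longrightarrow> (indep A B C \<longleftrightarrow> (\<forall>A0\<subseteq>A. finite A0 \<longrightarrow> indep A0 B C))) \<and>
     \<comment> \<open>extension\<close>
     (\<forall>A B C. small \<mu> \<CC> A \<and> small \<mu> \<CC> B \<and> small \<mu> \<CC> C
        \<longrightarrow> (\<exists>A'. equiv_over L \<CC> B A A' \<and> indep A' B C)) \<and>
     \<comment> \<open>local character\<close>
     (\<exists>\<theta>::'k rel. Card_order \<theta> \<and> \<theta> <o \<mu> \<and>
        (\<forall>A C. small \<mu> \<CC> A \<and> small \<mu> \<CC> C
           \<longrightarrow> (\<exists>C0\<subseteq>C. |C0| <o \<theta> +c cardSuc |A| \<and> indep A C0 C)))"

definition kappa0_bound ::
  "'k rel \<Rightarrow> ('a, 'f, 'r) struct \<Rightarrow> ('a set \<Rightarrow> 'a set \<Rightarrow> 'a set \<Rightarrow> bool) \<Rightarrow> 'k rel \<Rightarrow> bool" where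
  "kappa0_bound \<mu> \<CC> indep \<nu> \<longleftrightarrow>
     Card_order \<nu> \<and> cinfinite \<nu> \<and> regularCard \<nu> \<and>
     (\<forall>a B. finite a \<and> a \<subseteq> univ \<CC> \<and> small \<mu> \<CC> B \<longrightarrow> (\<exists>B0\<subseteq>B. |B0| <o \<nu> \<and> indep a B0 B))"

definition is_kappa0 ::
  "'k rel \<Rightarrow> ('a, 'f, 'r) struct \<Rightarrow> ('a set \<Rightarrow> 'a set \<Rightarrow> 'a set \<Rightarrow> bool) \<Rightarrow> 'k rel \<Rightarrow> bool" where
  "is_kappa0 \<mu> \<CC> indep \<kappa>\<^sub>0 \<longleftrightarrow>
     kappa0_bound \<mu> \<CC> indep \<kappa>\<^sub>0 \<and> (\<forall>\<nu>. kappa0_bound \<mu> \<CC> indep \<nu> \<longrightarrow> \<kappa>\<^sub>0 \<le>o \<nu>)"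

text \<open>
  Independence of a complete type over \<open>A\<close> from \<open>A\<close> over \<open>B \<subseteq> A\<close>; by invariance the choice of
  the realization does not matter.
\<close>

definition type_indep ::
  "('a, 'f, 'r) struct \<Rightarrow> ('a set \<Rightarrow> 'a set \<Rightarrow> 'a set \<Rightarrow> bool) \<Rightarrow>
   ('f + 'a, 'r) fm set \<Rightarrow> 'a set \<Rightarrow> 'a set \<Rightarrow> bool" where
  "type_indep \<CC> indep q B A \<longleftrightarrow> (\<exists>c\<in>univ \<CC>. realizes \<CC> c q \<and> indep {c} B A)"


subsection \<open>Lovely pairs\<close>

definition substruct :: "('a, 'f, 'r) struct \<Rightarrow> 'a set \<Rightarrow> ('a, 'f, 'r) struct" where
  "substruct \<CC> M = \<CC>\<lparr>univ := M\<rparr>"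

definition elementary_substruct ::
  "('f, 'r) lang \<Rightarrow> ('a, 'f, 'r) struct \<Rightarrow> 'a set \<Rightarrow> bool" where
  "elementary_substruct L \<CC> M \<longleftrightarrow>
     M \<subseteq> univ \<CC> \<and> is_struct L (substruct \<CC> M) \<and>
     (\<forall>\<phi> e. wf_fm L \<phi> \<and> range e \<subseteq> M \<longrightarrow> (sat (substruct \<CC> M) e \<phi> \<longleftrightarrow> sat \<CC> e \<phi>))"

text \<open>In the language of pairs, \<open>None\<close> is the new unary predicate.\<close>

definition lang2 :: "('f, 'r) lang \<Rightarrow> ('f, 'r option) lang" where
  "lang2 L =
     \<lparr>funs = funs L, rels = insert None (Some ` rels L),
      fun_ar = fun_ar L, rel_ar = case_option 1 (rel_ar L)\<rparr>"

definition pair_struct ::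
  "('a, 'f, 'r) struct \<Rightarrow> 'a set \<Rightarrow> 'a set \<Rightarrow> ('a, 'f, 'r option) struct" where
  "pair_struct \<CC> M P =
     \<lparr>univ = M, fun_int = fun_int \<CC>,
      rel_int = case_option (\<lambda>xs. set xs \<subseteq> P) (rel_int \<CC>)\<rparr>"

definition lovely_pair ::
  "('f, 'r) lang \<Rightarrow> 'k rel \<Rightarrow> ('a, 'f, 'r) struct \<Rightarrow> ('a set \<Rightarrow> 'a set \<Rightarrow> 'a set \<Rightarrow> bool) \<Rightarrow>
   'k rel \<Rightarrow> 'a set \<Rightarrow> 'a set \<Rightarrow> bool" where
  "lovely_pair L \<mu> \<CC> indep \<kappa> M P \<longleftrightarrow>
     small \<mu> \<CC> M \<and> elementary_substruct L \<CC> M \<and> P \<subseteq> M \<and>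
     (\<forall>A\<subseteq>M. |A| <o \<kappa> \<longrightarrow> (\<forall>q\<in>types1 L \<CC> A.
        type_indep \<CC> indep q (P \<inter> A) A \<longrightarrow> (\<exists>b\<in>P. realizes \<CC> b q))) \<and>
     (\<forall>A\<subseteq>M. |A| <o \<kappa> \<longrightarrow> (\<forall>q\<in>types1 L \<CC> A.
        \<exists>b\<in>M. realizes \<CC> b q \<and> indep {b} A P))"

definition Td ::
  "('f, 'r) lang \<Rightarrow> 'k rel \<Rightarrow> ('a, 'f, 'r) struct \<Rightarrow> ('a set \<Rightarrow> 'a set \<Rightarrow> 'a set \<Rightarrow> bool) \<Rightarrow>
   'k rel \<Rightarrow> ('f, 'r option) fm set" where
  "Td L \<mu> \<CC> indep \<kappa> =
     {\<phi>\<in>sentences (lang2 L).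
        \<forall>M P. lovely_pair L \<mu> \<CC> indep \<kappa> M P \<longrightarrow> models (pair_struct \<CC> M P) {\<phi>}}"

text \<open>
  ``Sufficiently saturated'' means \<open>\<theta>\<close>-saturated for some fixed \<open>\<theta>\<close>.  The monstrosity \<open>\<mu>\<close> is
  by convention large compared to every cardinal under consideration; here this is the demand
  \<open>2\<^sup>\<theta> < \<mu>\<close>, which guarantees that \<open>\<theta>\<close>-saturated models exist among the small ones, so that the
  condition is not vacuous.  When \<open>\<mu>\<close> is a strong limit, it says nothing more than that \<open>\<theta>\<close> is
  small.  Replacing \<open>\<theta>\<close> by a larger cardinal only weakens the last clause, so \<open>\<kappa> \<le> \<theta>\<close> is
  harmless.
\<close>

definition loveliness_first_order ::
  "('f, 'r) lang \<Rightarrow> 'k rel \<Rightarrow> ('a, 'f, 'r) struct \<Rightarrow> ('a set \<Rightarrow> 'a set \<Rightarrow> 'a set \<Rightarrow> bool) \<Rightarrow>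
   'k rel \<Rightarrow> bool" where
  "loveliness_first_order L \<mu> \<CC> indep \<kappa> \<longleftrightarrow>
     (\<exists>\<theta>::'k rel. Card_order \<theta> \<and> \<kappa> \<le>o \<theta> \<and> ctwo ^c \<theta> <o \<mu> \<and>
        (\<forall>M P. small \<mu> \<CC> M \<and> elementary_substruct L \<CC> M \<and> P \<subseteq> M \<and>
           models (pair_struct \<CC> M P) (Td L \<mu> \<CC> indep \<kappa>) \<and>
           saturated (lang2 L) (pair_struct \<CC> M P) \<theta> \<longrightarrow> lovely_pair L \<mu> \<CC> indep \<kappa> M P))"

definition P_independent ::
  "('a set \<Rightarrow> 'a set \<Rightarrow> 'a set \<Rightarrow> bool) \<Rightarrow> 'a set \<Rightarrow> 'a set \<Rightarrow> bool" where
  "P_independent indep P A \<longleftrightarrow> indep A (P \<inter> A) P"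


subsection \<open>Imaginaries and definable maps\<close>

text \<open>
  A sort \<open>(k, \<epsilon>)\<close> is given by a parameter-free formula \<open>\<epsilon>\<close> in the variables \<open>0, \<dots>, 2k - 1\<close>
  defining an equivalence relation on \<open>k\<close>-tuples.  An element of the imaginary expansion is an
  equivalence class tagged with its sort.
\<close>

type_synonym ('f, 'r) sort = "nat \<times> ('f, 'r) fm"
type_synonym ('a, 'f, 'r) imag = "('f, 'r) sort \<times> 'a list set"

definition sort_rel :: "('a, 'f, 'r) struct \<Rightarrow> ('f, 'r) sort \<Rightarrow> ('a list \<times> 'a list) set" where
  "sort_rel M s =
     {(u, v). u \<in> tuples (fst s) (univ M) \<and> v \<in> tuples (fst s) (univ M) \<and>
              sat M (nth (u @ v)) (snd s)}"

definition sorts :: "('f, 'r) lang \<Rightarrow> ('a, 'f, 'r) struct \<Rightarrow> ('f, 'r) sort set" where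
  "sorts L M =
     {s. wf_fm L (snd s) \<and> fv (snd s) \<subseteq> {..<2 * fst s} \<and>
         equiv (tuples (fst s) (univ M)) (sort_rel M s)}"

definition Meq :: "('f, 'r) lang \<Rightarrow> ('a, 'f, 'r) struct \<Rightarrow> ('a, 'f, 'r) imag set" where
  "Meq L M = {(s, c). s \<in> sorts L M \<and> c \<in> tuples (fst s) (univ M) // sort_rel M s}"

text \<open>
  \<open>definable_map L M L' M' A n D f\<close>: the map \<open>f\<close> from the set \<open>D\<close> of \<open>n\<close>-tuples to \<open>M\<^sup>e\<^sup>q\<close>
  (formed in the \<open>L\<close>-structure \<open>M\<close>) is defined by an \<open>L'\<close>-formula over \<open>A\<close>, evaluated in the
  \<open>L'\<close>-structure \<open>M'\<close> with the same universe.  As the value variable of such a formula has a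
  sort, all values lie in one sort \<open>s\<close>, and the formula is written on representatives, as
  \<open>\<phi>(x, y)\<close> with \<open>x\<close> the first \<open>n\<close> variables and \<open>y\<close> the next \<open>fst s\<close>.
\<close>

definition definable_map ::
  "('f, 'r) lang \<Rightarrow> ('a, 'f, 'r) struct \<Rightarrow> ('f, 's) lang \<Rightarrow> ('a, 'f, 's) struct \<Rightarrow>
   'a set \<Rightarrow> nat \<Rightarrow> 'a list set \<Rightarrow> ('a list \<Rightarrow> ('a, 'f, 'r) imag) \<Rightarrow> bool" where
  "definable_map L M L' M' A n D f \<longleftrightarrow>
     (\<forall>x\<in>D. f x \<in> Meq L M) \<and>
     (\<exists>s\<in>sorts L M. \<exists>\<phi>.
        wf_fm (lang_params L' A) \<phi> \<and> fv \<phi> \<subseteq> {..<n + fst s} \<and>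
        (\<forall>x\<in>D. fst (f x) = s \<and>
           (\<forall>y\<in>tuples (fst s) (univ M).
              y \<in> snd (f x) \<longleftrightarrow> sat (struct_params M') (nth (x @ y)) \<phi>)))"

end

theory Submission
  imports Defs
begin

text \<open>
  Between lovely pairs, a partial elementary map with P-independent domain and range that
  respects the predicate is elementary for the language of pairs (back and forth). Hence, over
  a P-independent set, the type of a tuple from \<open>P\<close> determines its type in the language of
  pairs. If the value of \<open>f\<close> at such a tuple \<open>c\<close> is the class of \<open>d\<close>, choose a small \<open>C\<close> in \<open>P\<close>
  over which \<open>d\<close> is independent from \<open>P\<close>; conjugates of \<open>d\<close> over \<open>a c C\<close> have the type of
  \<open>d\<close> in the language of pairs, so they are equivalent to \<open>d\<close>, and moving \<open>C\<close> independently
  inside \<open>P\<close> removes the dependence on \<open>C\<close>. So the graph of \<open>f\<close> is a union of \<open>\<L>\<close>-types in any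
  lovely pair. Loveliness being first-order, a saturated model of \<open>T\<^sup>d\<close> is lovely, and there
  compactness turns this into an \<open>\<L>\<close>-definition. The parameters are carried over to the
  saturated model by the back and forth and not by an elementary extension, because
  P-independence need not survive the latter.
\<close>

subsection \<open>Formulas, substitution and partial elementary maps\<close>

text \<open>Two questions of size shape the proof. Density and extension speak about very small
  sets, but the parameter set is merely contained in \<open>M\<close>. Only finitely many parameters
  occur in the defining formula, and local character inside \<open>P \<inter> A\<close> gives a base
  \<open>C\<close> of size below \<kappa> over which they are independent from \<open>P\<close>. The
  whole argument therefore runs over \<open>C\<close> and this finite tuple. Second, the saturated
  model must be a small elementary substructure of \<CC> carrying a predicate. It is made from
  formal constants, indexed by a type in countably many variables together with its parameters,
  which are at most \<theta> earlier constants. Such constants are well-founded trees, there are at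
  most 2^\<theta> of them (hence the demand 2^\<theta> < \<mu>), and every \<theta>-sequence of
  constants already occurs as an index, so all types over \<theta> elements are treated without a
  chain of models. Types in many variables are used because the final compactness step must realize
  two whole tuples at once: equal \<L>-types over the parameters, but different truth values of the
  formula.\<close>

lemma val_cong: "(\<And>x. x \<in> vars t \<Longrightarrow> e x = e' x) \<Longrightarrow> val S e t = val S e' t"
proof (induction t)
  case (App g ts)
  then have "map (val S e) ts = map (val S e') ts" by auto
  then show ?case by (simp only: val.simps)
qed auto

lemma sat_cong: "(\<And>x. x \<in> fv \<phi> \<Longrightarrow> e x = e' x) \<Longrightarrow> sat S e \<phi> = sat S e' \<phi>"
proof (induction \<phi> arbitrary: e e')
  case (Equ s t)
  then have "val S e s = val S e' s" "val S e t = val S e' t" by (auto intro!: val_cong)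
  then show ?case by simp
next
  case (Atom R ts)
  then have "map (val S e) ts = map (val S e') ts" by (auto intro!: val_cong)
  then show ?case by (simp only: sat.simps)
next
  case (Imp \<phi> \<psi>)
  have "sat S e \<phi> = sat S e' \<phi>" by (rule Imp.IH) (use Imp.prems in auto)
  moreover have "sat S e \<psi> = sat S e' \<psi>" by (rule Imp.IH) (use Imp.prems in auto)
  ultimately show ?case by simp
next
  case (All x \<phi>)
  have "sat S (e(x := a)) \<phi> = sat S (e'(x := a)) \<phi>" for a
    by (rule All.IH) (use All.prems in auto)
  then show ?case by simp
qed simp

lemma finite_vars [simp]: "finite (vars t)"
  by (induction t) auto

lemma finite_fv [simp]: "finite (fv \<phi>)"
  by (induction \<phi>) auto

lemma finite_set_trm [simp]: "finite (set_trm t)"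
  by (induction t) auto

lemma finite_set1_fm [simp]: "finite (set1_fm \<phi>)"
  by (induction \<phi>) auto

lemma wf_trm_set_trm: "wf_trm L t \<Longrightarrow> set_trm t \<subseteq> funs L"
  by (induction t) (auto simp: list_all_iff)

lemma wf_fm_set1_fm: "wf_fm L \<phi> \<Longrightarrow> set1_fm \<phi> \<subseteq> funs L"
  by (induction \<phi>) (auto simp: list_all_iff dest: wf_trm_set_trm)

section \<open>Simultaneous substitution, renaming, and passage between parameters and
  variables\<close>

text \<open>Function symbols are replaced through \<open>F\<close>, variables through
  \<open>r\<close>. One operation thereby covers renaming of variables, insertion of constants for
  elements, and the conversion of constants back into variables.\<close>

primrec subst_trm :: "('f \<Rightarrow> 'g trm list \<Rightarrow> 'g trm) \<Rightarrow> (nat \<Rightarrow> 'g trm) \<Rightarrow> 'f trm \<Rightarrow> 'g trm" where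
  "subst_trm F r (Var x) = r x"
| "subst_trm F r (App g ts) = F g (map (subst_trm F r) ts)"

text \<open>
  Bound variables are shifted by \<open>m\<close>; there is no capture as long as the terms substituted
  for free variables only use variables below \<open>m\<close>.
\<close>

primrec subst_fm :: "nat \<Rightarrow> ('f \<Rightarrow> 'g trm list \<Rightarrow> 'g trm) \<Rightarrow> ('f, 'r) fm \<Rightarrow> (nat \<Rightarrow> 'g trm) \<Rightarrow> ('g, 'r) fm"
  where
  "subst_fm m F Falsum r = Falsum"
| "subst_fm m F (Equ s t) r = Equ (subst_trm F r s) (subst_trm F r t)"
| "subst_fm m F (Atom R ts) r = Atom R (map (subst_trm F r) ts)"
| "subst_fm m F (Imp \<phi> \<psi>) r = Imp (subst_fm m F \<phi> r) (subst_fm m F \<psi> r)"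
| "subst_fm m F (All x \<phi>) r = All (x + m) (subst_fm m F \<phi> (r(x := Var (x + m))))"

lemma val_subst_trm:
  assumes "\<And>g ts. g \<in> set_trm t \<Longrightarrow> val S' e (F g ts) = fun_int S g (map (val S' e) ts)"
  shows "val S' e (subst_trm F r t) = val S (\<lambda>y. val S' e (r y)) t"
  using assms
proof (induction t)
  case (App g ts)
  then have "map (\<lambda>t. val S' e (subst_trm F r t)) ts = map (val S (\<lambda>y. val S' e (r y))) ts"
    by auto
  then show ?case using App.prems[of g] by (simp add: comp_def del: map_eq_conv)
qed simp

text \<open>\<open>F\<close> may itself produce variables below \<open>m\<close> (when a constant
  becomes a variable). Shifted bound variables are at least \<open>m\<close>, so passing under a
  quantifier leaves their values alone; hence the condition on all \<open>e'\<close> that agree with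
  \<open>e\<close> below \<open>m\<close>. Allowing \<open>r y\<close> to contain the shift of
  \<open>y\<close> itself is what makes the induction go through for
  \<open>r(x := Var (x + m))\<close>.\<close>

lemma sat_subst_fm:
  assumes "univ S' = univ S" and "rel_int S' = rel_int S"
    and "\<And>g ts e'. g \<in> set1_fm \<phi> \<Longrightarrow> (\<And>i. i < m \<Longrightarrow> e' i = e i) \<Longrightarrow>
           val S' e' (F g ts) = fun_int S g (map (val S' e') ts)"
    and "\<And>y x. y \<in> fv \<phi> \<Longrightarrow> x + m \<in> vars (r y) \<Longrightarrow> x = y"
  shows "sat S' e (subst_fm m F \<phi> r) \<longleftrightarrow> sat S (\<lambda>y. val S' e (r y)) \<phi>"
  using assms(3,4)
proof (induction \<phi> arbitrary: e r)
  case (Equ s t)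
  have "val S' e (subst_trm F r s) = val S (\<lambda>y. val S' e (r y)) s"
    by (rule val_subst_trm) (use Equ(1)[of _ e] in auto)
  moreover have "val S' e (subst_trm F r t) = val S (\<lambda>y. val S' e (r y)) t"
    by (rule val_subst_trm) (use Equ(1)[of _ e] in auto)
  ultimately show ?case by simp
next
  case (Atom R ts)
  have "val S' e (subst_trm F r t) = val S (\<lambda>y. val S' e (r y)) t" if "t \<in> set ts" for t
    by (rule val_subst_trm) (use that Atom(1)[of _ e] in auto)
  then have "map (val S' e) (map (subst_trm F r) ts) = map (val S (\<lambda>y. val S' e (r y))) ts"
    by simp
  then show ?case using assms(2) by (simp only: sat.simps subst_fm.simps)
next
  case (Imp \<phi> \<psi>)
  have "sat S' e (subst_fm m F \<phi> r) \<longleftrightarrow> sat S (\<lambda>y. val S' e (r y)) \<phi>"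
    by (rule Imp.IH(1)) (use Imp.prems in auto)
  moreover have "sat S' e (subst_fm m F \<psi> r) \<longleftrightarrow> sat S (\<lambda>y. val S' e (r y)) \<psi>"
    by (rule Imp.IH(2)) (use Imp.prems in auto)
  ultimately show ?case by simp
next
  case (All x \<phi>)
  have "sat S' (e(x + m := a)) (subst_fm m F \<phi> (r(x := Var (x + m)))) \<longleftrightarrow>
        sat S ((\<lambda>y. val S' e (r y))(x := a)) \<phi>" for a
  proof -
    have "sat S' (e(x + m := a)) (subst_fm m F \<phi> (r(x := Var (x + m)))) \<longleftrightarrow>
          sat S (\<lambda>y. val S' (e(x + m := a)) ((r(x := Var (x + m))) y)) \<phi>"
      by (rule All.IH) (use All.prems in \<open>auto split: if_splits\<close>)
    also have "\<dots> \<longleftrightarrow> sat S ((\<lambda>y. val S' e (r y))(x := a)) \<phi>"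
    proof (rule sat_cong)
      fix y assume "y \<in> fv \<phi>"
      then show "val S' (e(x + m := a)) ((r(x := Var (x + m))) y) = ((\<lambda>y. val S' e (r y))(x := a)) y"
        using All.prems(2)[of y x] by (auto intro!: val_cong)
    qed
    finally show ?thesis .
  qed
  then show ?case using assms(1) by simp
qed simp

lemma wf_subst_trm:
  assumes "\<And>g ts. g \<in> funs L \<Longrightarrow> length ts = fun_ar L g \<Longrightarrow> list_all (wf_trm L') ts \<Longrightarrow> wf_trm L' (F g ts)"
    and "\<And>y. y \<in> vars t \<Longrightarrow> wf_trm L' (r y)" and "wf_trm L t"
  shows "wf_trm L' (subst_trm F r t)"
  using assms(2,3)
proof (induction t)
  case (App g ts)
  have "wf_trm L' (subst_trm F r t)" if "t \<in> set ts" for t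
    using that App by (auto simp: list_all_iff)
  then show ?case using App by (auto simp: list_all_iff intro!: assms(1))
qed simp

lemma wf_subst_fm:
  assumes "\<And>g ts. g \<in> funs L \<Longrightarrow> length ts = fun_ar L g \<Longrightarrow> list_all (wf_trm L') ts \<Longrightarrow> wf_trm L' (F g ts)"
    and "rels L' = rels L" "rel_ar L' = rel_ar L"
    and "\<And>y. y \<in> fv \<phi> \<Longrightarrow> wf_trm L' (r y)" and "wf_fm L \<phi>"
  shows "wf_fm L' (subst_fm m F \<phi> r)"
  using assms(4,5)
proof (induction \<phi> arbitrary: r)
  case (Equ s t)
  then show ?case by (auto intro!: wf_subst_trm[of L L' F, OF assms(1)])
next
  case (Atom R ts)
  have "wf_trm L' (subst_trm F r t)" if "t \<in> set ts" for t
    by (rule wf_subst_trm[of L L' F, OF assms(1)]) (use that Atom in \<open>auto simp: list_all_iff\<close>)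
  then show ?case using Atom by (simp add: list_all_iff assms(2,3))
next
  case (Imp \<phi> \<psi>)
  have "wf_fm L' (subst_fm m F \<phi> r)" by (rule Imp.IH) (use Imp.prems in auto)
  moreover have "wf_fm L' (subst_fm m F \<psi> r)" by (rule Imp.IH) (use Imp.prems in auto)
  ultimately show ?case by simp
next
  case (All x \<phi>)
  have "wf_fm L' (subst_fm m F \<phi> (r(x := Var (x + m))))" by (rule All.IH) (use All.prems in auto)
  then show ?case by simp
qed simp

lemma vars_subst_trm:
  assumes "\<And>g ts. g \<in> set_trm t \<Longrightarrow> vars (F g ts) \<subseteq> V \<union> \<Union> (vars ` set ts)"
  shows "vars (subst_trm F r t) \<subseteq> V \<union> (\<Union>y\<in>vars t. vars (r y))"
  using assms
proof (induction t)
  case (App g ts)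
  have "vars (subst_trm F r t) \<subseteq> V \<union> (\<Union>y\<in>vars t. vars (r y))" if "t \<in> set ts" for t
    by (rule App.IH) (use that App.prems in auto)
  then show ?case using App.prems[of g "map (subst_trm F r) ts"] by fastforce
qed simp

lemma fv_subst_fm:
  assumes "\<And>g ts. g \<in> set1_fm \<phi> \<Longrightarrow> vars (F g ts) \<subseteq> V \<union> \<Union> (vars ` set ts)"
  shows "fv (subst_fm m F \<phi> r) \<subseteq> V \<union> (\<Union>y\<in>fv \<phi>. vars (r y))"
  using assms
proof (induction \<phi> arbitrary: r)
  case (Equ s t)
  have "vars (subst_trm F r s) \<subseteq> V \<union> (\<Union>y\<in>vars s. vars (r y))"
    by (rule vars_subst_trm) (use Equ in auto)
  moreover have "vars (subst_trm F r t) \<subseteq> V \<union> (\<Union>y\<in>vars t. vars (r y))"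
    by (rule vars_subst_trm) (use Equ in auto)
  ultimately show ?case by auto
next
  case (Atom R ts)
  have "vars (subst_trm F r t) \<subseteq> V \<union> (\<Union>y\<in>vars t. vars (r y))" if "t \<in> set ts" for t
    by (rule vars_subst_trm) (use that Atom in auto)
  then show ?case by fastforce
next
  case (Imp \<phi> \<psi>)
  have "fv (subst_fm m F \<phi> r) \<subseteq> V \<union> (\<Union>y\<in>fv \<phi>. vars (r y))"
    by (rule Imp.IH(1)) (use Imp.prems in auto)
  moreover have "fv (subst_fm m F \<psi> r) \<subseteq> V \<union> (\<Union>y\<in>fv \<psi>. vars (r y))"
    by (rule Imp.IH(2)) (use Imp.prems in auto)
  ultimately show ?case by auto
next
  case (All x \<phi>)
  have "fv (subst_fm m F \<phi> (r(x := Var (x + m)))) \<subseteq> V \<union> (\<Union>y\<in>fv \<phi>. vars ((r(x := Var (x + m))) y))"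
    by (rule All.IH) (use All.prems in auto)
  then show ?case by (auto split: if_splits)
qed simp

lemma finite_nat_bound_ex:
  fixes r :: "nat \<Rightarrow> nat"
  assumes "finite X" obtains m where "\<And>x. x \<in> X \<Longrightarrow> r x < m"
proof
  fix x assume "x \<in> X"
  then show "r x < Suc (Max (r ` X))" using assms by (simp add: less_Suc_eq_le)
qed

text \<open>\<open>r\<close> need not be injective, so variables can be identified, and a single
  \<open>\<phi>'\<close> serves all structures at once.\<close>

lemma ex_renaming:
  assumes "wf_fm L \<phi>"
  obtains \<phi>' where "wf_fm L \<phi>'" "fv \<phi>' \<subseteq> r ` fv \<phi>"
    "\<And>(S :: ('a, 'f, 'r) struct) e. sat S e \<phi>' = sat S (e \<circ> r) \<phi>"
proof -
  obtain m where m: "\<And>x. x \<in> fv \<phi> \<Longrightarrow> r x < m" using finite_nat_bound_ex[of "fv \<phi>" r] by auto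
  show ?thesis
  proof (rule that[of "subst_fm m App \<phi> (\<lambda>y. Var (r y))"])
    show "wf_fm L (subst_fm m App \<phi> (\<lambda>y. Var (r y)))"
      by (rule wf_subst_fm[OF _ _ _ _ assms]) auto
    show "fv (subst_fm m App \<phi> (\<lambda>y. Var (r y))) \<subseteq> r ` fv \<phi>"
      using fv_subst_fm[of \<phi> App "{}" m "\<lambda>y. Var (r y)"] by auto
    fix S :: "('a, 'f, 'r) struct" and e
    have "sat S e (subst_fm m App \<phi> (\<lambda>y. Var (r y))) \<longleftrightarrow> sat S (\<lambda>y. val S e (Var (r y))) \<phi>"
      by (rule sat_subst_fm) (auto simp: comp_def dest!: m)
    then show "sat S e (subst_fm m App \<phi> (\<lambda>y. Var (r y))) = sat S (e \<circ> r) \<phi>"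
      by (simp add: comp_def)
  qed
qed

text \<open>Serves to turn a formula with an assignment into a formula with parameters: variables
  outside \<open>B\<close> become constants for their values, those in \<open>B\<close> stay free
  under new names.\<close>

lemma ex_instance:
  fixes e :: "nat \<Rightarrow> 'a" and L :: "('f, 'r) lang"
  assumes "wf_fm L \<phi>" and "\<And>i. i \<in> fv \<phi> \<Longrightarrow> i \<notin> B \<Longrightarrow> e i \<in> A"
  obtains \<phi>' where "wf_fm (lang_params L A) \<phi>'" "fv \<phi>' \<subseteq> r ` (fv \<phi> \<inter> B)"
    "\<And>S g. sat (struct_params S) g \<phi>' = sat S (\<lambda>i. if i \<in> B then g (r i) else e i) \<phi>"
proof -
  obtain m where m: "\<And>x. x \<in> fv \<phi> \<Longrightarrow> r x < m" using finite_nat_bound_ex[of "fv \<phi>" r] by auto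
  define t :: "nat \<Rightarrow> ('f + 'a) trm" where "t = (\<lambda>y. if y \<in> B then Var (r y) else App (Inr (e y)) [])"
  define F where "F = (\<lambda>g. App (Inl g :: 'f + 'a))"
  show ?thesis
  proof (rule that[of "subst_fm m F \<phi> t"])
    show "wf_fm (lang_params L A) (subst_fm m F \<phi> t)"
      by (rule wf_subst_fm[OF _ _ _ _ assms(1)]) (use assms(2) in \<open>auto simp: t_def F_def lang_params_def\<close>)
    show "fv (subst_fm m F \<phi> t) \<subseteq> r ` (fv \<phi> \<inter> B)"
      using fv_subst_fm[of \<phi> F "{}" m t] by (auto simp: t_def F_def split: if_splits)
    fix S :: "('a, 'f, 'r) struct" and g
    have "sat (struct_params S) g (subst_fm m F \<phi> t) \<longleftrightarrow> sat S (\<lambda>y. val (struct_params S) g (t y)) \<phi>"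
      by (rule sat_subst_fm) (auto simp: t_def F_def struct_params_def split: if_splits dest!: m)
    also have "(\<lambda>y. val (struct_params S) g (t y)) = (\<lambda>i. if i \<in> B then g (r i) else e i)"
      by (auto simp: t_def struct_params_def fun_eq_iff)
    finally show "sat (struct_params S) g (subst_fm m F \<phi> t) = sat S (\<lambda>i. if i \<in> B then g (r i) else e i) \<phi>" .
  qed
qed

text \<open>The inverse passage: a formula contains finitely many constants, and these become its
  first variables, while the old variables move up by the number of parameters.\<close>

lemma ex_deparametrized:
  fixes A :: "'a set" and L :: "('f, 'r) lang"
  assumes "wf_fm (lang_params L A) \<phi>"
  obtains \<phi>' as where "set as \<subseteq> A" "wf_fm L \<phi>'"
    "fv \<phi>' \<subseteq> {..<length as} \<union> (\<lambda>y. y + length as) ` fv \<phi>"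
    "\<And>S e. sat (struct_params S) e \<phi> =
       sat S (\<lambda>i. if i < length as then as ! i else e (i - length as)) \<phi>'"
proof -
  have "finite {a. Inr a \<in> set1_fm \<phi>}"
    using finite_vimageI[OF finite_set1_fm[of \<phi>], of Inr] by (simp add: vimage_def)
  then obtain as where as: "set as = {a. Inr a \<in> set1_fm \<phi>}"
    using finite_list by blast
  define n where "n = length as"
  obtain m0 where m0: "\<And>x. x \<in> fv \<phi> \<Longrightarrow> x + n < m0"
    using finite_nat_bound_ex[of "fv \<phi>" "\<lambda>x. x + n"] by auto
  \<comment> \<open>Bound variables are shifted by at least \<open>n\<close>, so that none of them
    captures a variable standing for a parameter.\<close>
  define m where "m = m0 + n"
  have m: "\<And>x. x \<in> fv \<phi> \<Longrightarrow> x + n < m" "n \<le> m" using m0 by (auto simp: m_def dest!: m0)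
  define ix where "ix = (\<lambda>a. SOME i. i < n \<and> as ! i = a)"
  have ix: "ix a < n \<and> as ! (ix a) = a" if "a \<in> set as" for a
    unfolding ix_def by (rule someI_ex) (use that in \<open>auto simp: in_set_conv_nth n_def\<close>)
  define F :: "'f + 'a \<Rightarrow> 'f trm list \<Rightarrow> 'f trm"
    where "F = case_sum App (\<lambda>a ts. Var (ix a))"
  define t :: "nat \<Rightarrow> 'f trm" where "t = (\<lambda>y. Var (y + n))"
  show ?thesis
  proof (rule that[of as "subst_fm m F \<phi> t"])
    show "set as \<subseteq> A"
      using wf_fm_set1_fm[OF assms] by (auto simp: as lang_params_def)
    show "wf_fm L (subst_fm m F \<phi> t)"
      by (rule wf_subst_fm[OF _ _ _ _ assms]) (auto simp: t_def F_def lang_params_def)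
    have "fv (subst_fm m F \<phi> t) \<subseteq> {..<n} \<union> (\<Union>y\<in>fv \<phi>. vars (t y))"
    proof (rule fv_subst_fm)
      fix g and ts :: "'f trm list" assume g: "g \<in> set1_fm \<phi>"
      show "vars (F g ts) \<subseteq> {..<n} \<union> \<Union> (vars ` set ts)"
      proof (cases g)
        case (Inr a)
        then show ?thesis using g ix[of a] by (simp add: F_def as)
      qed (auto simp: F_def)
    qed
    then show "fv (subst_fm m F \<phi> t) \<subseteq> {..<length as} \<union> (\<lambda>y. y + length as) ` fv \<phi>"
      by (auto simp: t_def n_def)
    fix S :: "('a, 'f, 'r) struct" and e
    let ?e = "\<lambda>i. if i < length as then as ! i else e (i - length as)"
    have "sat S ?e (subst_fm m F \<phi> t) \<longleftrightarrow> sat (struct_params S) (\<lambda>y. val S ?e (t y)) \<phi>"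
    proof (rule sat_subst_fm)
      fix g ts and e' :: "nat \<Rightarrow> 'a" assume g: "g \<in> set1_fm \<phi>" and e': "\<And>i. i < m \<Longrightarrow> e' i = ?e i"
      show "val S e' (F g ts) = fun_int (struct_params S) g (map (val S e') ts)"
      proof (cases g)
        case (Inr a)
        then have "a \<in> set as" using g by (simp add: as)
        then show ?thesis using Inr ix[of a] e'[of "ix a"] m(2) by (simp add: F_def struct_params_def n_def)
      qed (simp add: F_def struct_params_def)
    next
      fix y x assume "y \<in> fv \<phi>" "x + m \<in> vars (t y)"
      then show "x = y" using m(1)[of y] by (simp add: t_def)
    qed (auto simp: struct_params_def)
    also have "(\<lambda>y. val S ?e (t y)) = e" by (auto simp: t_def n_def)
    finally show "sat (struct_params S) e \<phi> = sat S ?e (subst_fm m F \<phi> t)" by simp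
  qed
qed

section \<open>Derived connectives and the comparison of the two languages\<close>

definition Conj :: "('f, 'r) fm \<Rightarrow> ('f, 'r) fm \<Rightarrow> ('f, 'r) fm" where
  "Conj \<phi> \<psi> = Neg (Imp \<phi> (Neg \<psi>))"

definition Exists :: "nat \<Rightarrow> ('f, 'r) fm \<Rightarrow> ('f, 'r) fm" where
  "Exists x \<phi> = Neg (All x (Neg \<phi>))"

lemma Conj_simps [simp]:
  "sat S e (Conj \<phi> \<psi>) \<longleftrightarrow> sat S e \<phi> \<and> sat S e \<psi>"
  "wf_fm L (Conj \<phi> \<psi>) \<longleftrightarrow> wf_fm L \<phi> \<and> wf_fm L \<psi>"
  "fv (Conj \<phi> \<psi>) = fv \<phi> \<union> fv \<psi>"
  by (auto simp: Conj_def)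

lemma Exists_simps [simp]:
  "sat S e (Exists x \<phi>) \<longleftrightarrow> (\<exists>a\<in>univ S. sat S (e(x := a)) \<phi>)"
  "wf_fm L (Exists x \<phi>) \<longleftrightarrow> wf_fm L \<phi>"
  "fv (Exists x \<phi>) = fv \<phi> - {x}"
  by (auto simp: Exists_def)

lemma val_in_univ:
  assumes "is_struct L S" "wf_trm L t" "e ` vars t \<subseteq> univ S"
  shows "val S e t \<in> univ S"
  using assms(2,3)
proof (induction t)
  case (App g ts)
  have "val S e t \<in> univ S" if "t \<in> set ts" for t
    using App that by (fastforce simp: list_all_iff)
  then have "map (val S e) ts \<in> tuples (fun_ar L g) (univ S)"
    using App.prems by (auto simp: tuples_def)
  then show ?case using App.prems assms(1) by (simp add: is_struct_def)
qed simp

lemma val_substruct [simp]: "val (substruct S M) e t = val S e t"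
proof (induction t)
  case (App g ts)
  then have "map (val (substruct S M) e) ts = map (val S e) ts" by simp
  then show ?case by (simp add: substruct_def del: map_eq_conv)
qed simp

lemma val_pair_struct [simp]: "val (pair_struct S M P) e t = val S e t"
proof (induction t)
  case (App g ts)
  then have "map (val (pair_struct S M P) e) ts = map (val S e) ts" by simp
  then show ?case by (simp add: pair_struct_def del: map_eq_conv)
qed simp

lemma univ_simps [simp]:
  "univ (substruct S M) = M" "univ (pair_struct S M P) = M" "univ (struct_params S) = univ S"
  by (auto simp: substruct_def pair_struct_def struct_params_def)

lemma wf_trm_lang2 [simp]: "wf_trm (lang2 L) t = wf_trm L t"
  by (induction t) (auto simp: lang2_def list_all_iff)

lemma lang2_simps [simp]:
  "funs (lang2 L) = funs L" "rels (lang2 L) = insert None (Some ` rels L)"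
  "fun_ar (lang2 L) = fun_ar L" "rel_ar (lang2 L) = case_option 1 (rel_ar L)"
  by (simp_all add: lang2_def)

lemma wf_map_fm: "wf_fm (lang2 L) (map_fm id Some \<phi>) = wf_fm L \<phi>"
  by (induction \<phi>) (auto simp: list_all_iff trm.map_ident)

lemma sat_map_fm: "sat (pair_struct S M P) e (map_fm id Some \<phi>) = sat (substruct S M) e \<phi>"
proof (induction \<phi> arbitrary: e)
  case (Atom R ts)
  have "map (val (pair_struct S M P) e) (map (map_trm id) ts) = map (val (substruct S M) e) ts"
    by (simp add: trm.map_id)
  moreover have "rel_int (pair_struct S M P) (Some R) = rel_int (substruct S M) R"
    by (simp add: pair_struct_def substruct_def)
  ultimately show ?case by (simp only: fm.map sat.simps)
qed (auto simp: trm.map_id trm.map_ident)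

section \<open>Partial elementary maps as relations\<close>

text \<open>Assignments take pairs as values, so one \<open>e\<close> evaluates both sides, and only
  free variables are constrained. This form makes the empty relation, unions of chains and converses
  immediate, and no choice function is involved.\<close>

definition erel :: "('f, 'r) lang \<Rightarrow> ('a, 'f, 'r) struct \<Rightarrow> ('b, 'f, 'r) struct \<Rightarrow> ('a \<times> 'b) set \<Rightarrow> bool"
  where "erel L S S' G \<longleftrightarrow>
    (\<forall>\<phi> e. wf_fm L \<phi> \<longrightarrow> e ` fv \<phi> \<subseteq> G \<longrightarrow> (sat S (fst \<circ> e) \<phi> \<longleftrightarrow> sat S' (snd \<circ> e) \<phi>))"

lemma erelD: "erel L S S' G \<Longrightarrow> wf_fm L \<phi> \<Longrightarrow> e ` fv \<phi> \<subseteq> G \<Longrightarrow> sat S (fst \<circ> e) \<phi> \<longleftrightarrow> sat S' (snd \<circ> e) \<phi>"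
  by (simp add: erel_def)

lemma erel_mono: "erel L S S' G \<Longrightarrow> G' \<subseteq> G \<Longrightarrow> erel L S S' G'"
  by (auto simp: erel_def)

lemma erel_converse:
  assumes "erel L S S' G" shows "erel L S' S (G\<inverse>)"
  unfolding erel_def
proof (intro allI impI)
  fix \<phi> e assume "wf_fm L \<phi>" "e ` fv \<phi> \<subseteq> G\<inverse>"
  then have "sat S (fst \<circ> (prod.swap \<circ> e)) \<phi> \<longleftrightarrow> sat S' (snd \<circ> (prod.swap \<circ> e)) \<phi>"
    by (intro erelD[OF assms]) (auto simp: prod.swap_def)
  then show "sat S' (fst \<circ> e) \<phi> \<longleftrightarrow> sat S (snd \<circ> e) \<phi>"
    by (auto simp: comp_def)
qed

text \<open>Equality is a formula, so an elementary relation is automatically the graph of an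
  injective function.\<close>

lemma erel_eq_iff:
  assumes "erel L S S' G" "(a, b) \<in> G" "(a', b') \<in> G"
  shows "a = a' \<longleftrightarrow> b = b'"
proof -
  have "sat S (fst \<circ> (\<lambda>i. if i = 0 then (a, b) else (a', b'))) (Equ (Var 0) (Var 1)) \<longleftrightarrow>
        sat S' (snd \<circ> (\<lambda>i. if i = 0 then (a, b) else (a', b'))) (Equ (Var 0) (Var (1::nat)))"
    by (rule erelD[OF assms(1)]) (use assms(2,3) in auto)
  then show ?thesis by simp
qed

text \<open>A formula has finitely many free variables, so each instance is already decided in one
  member of the chain. This feeds Zorn's lemma.\<close>

lemma erel_Union_chain:
  assumes "\<C> \<noteq> {}" "subset.chain \<A> \<C>" "\<And>G. G \<in> \<C> \<Longrightarrow> erel L S S' G"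
  shows "erel L S S' (\<Union>\<C>)"
  unfolding erel_def
proof (intro allI impI)
  fix \<phi> e assume "wf_fm L \<phi>" "e ` fv \<phi> \<subseteq> \<Union>\<C>"
  then obtain G where "G \<in> \<C>" "e ` fv \<phi> \<subseteq> G"
    using finite_subset_Union_chain[OF _ _ assms(1,2), of "e ` fv \<phi>"] by auto
  then show "sat S (fst \<circ> e) \<phi> \<longleftrightarrow> sat S' (snd \<circ> e) \<phi>"
    using assms(3) \<open>wf_fm L \<phi>\<close> by (auto simp: erel_def)
qed

subsection \<open>Independence and lovely pairs\<close>

lemma sat_automorphism:
  assumes "automorphism L S \<sigma>" "is_struct L S" "wf_fm L \<phi>" "e ` fv \<phi> \<subseteq> univ S"
  shows "sat S (\<sigma> \<circ> e) \<phi> \<longleftrightarrow> sat S e \<phi>"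
proof -
  have bij: "bij_betw \<sigma> (univ S) (univ S)" using assms(1) by (simp add: automorphism_def)
  have val: "val S (\<sigma> \<circ> e) t = \<sigma> (val S e t)" if "wf_trm L t" "e ` vars t \<subseteq> univ S" for t e
    using that
  proof (induction t)
    case (App g ts)
    have "val S (\<sigma> \<circ> e) t = \<sigma> (val S e t)" if "t \<in> set ts" for t
      by (rule App.IH) (use App.prems that in \<open>auto simp: list_all_iff\<close>)
    then have "map (val S (\<sigma> \<circ> e)) ts = map \<sigma> (map (val S e) ts)" by simp
    moreover have "val S e t \<in> univ S" if "t \<in> set ts" for t
      using App.prems that by (intro val_in_univ[OF assms(2)]) (auto simp: list_all_iff)
    then have "map (val S e) ts \<in> tuples (fun_ar L g) (univ S)"
      using App.prems by (auto simp: tuples_def)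
    ultimately show ?case using assms(1) App.prems
      unfolding automorphism_def val.simps by (metis wf_trm.simps(2))
  qed simp
  show ?thesis using assms(3,4)
  proof (induction \<phi> arbitrary: e)
    case (Equ s t)
    then have "val S e s \<in> univ S" "val S e t \<in> univ S"
      by (auto intro!: val_in_univ[OF assms(2)])
    moreover have "val S (\<sigma> \<circ> e) s = \<sigma> (val S e s)" "val S (\<sigma> \<circ> e) t = \<sigma> (val S e t)"
      using Equ by (auto intro!: val)
    ultimately show ?case using bij unfolding sat.simps bij_betw_def by (metis inj_on_eq_iff)
  next
    case (Atom R ts)
    have "val S (\<sigma> \<circ> e) t = \<sigma> (val S e t)" if "t \<in> set ts" for t
      by (rule val) (use Atom that in \<open>auto simp: list_all_iff\<close>)
    then have "map (val S (\<sigma> \<circ> e)) ts = map \<sigma> (map (val S e) ts)" by simp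
    moreover have "val S e t \<in> univ S" if "t \<in> set ts" for t
      using Atom that by (intro val_in_univ[OF assms(2)]) (auto simp: list_all_iff)
    then have "map (val S e) ts \<in> tuples (rel_ar L R) (univ S)"
      using Atom by (auto simp: tuples_def)
    ultimately show ?case using assms(1) Atom(1)
      unfolding automorphism_def sat.simps wf_fm.simps by metis
  next
    case (Imp \<phi> \<psi>)
    then show ?case by (simp add: image_Un)
  next
    case (All x \<phi>)
    have *: "sat S ((\<sigma> \<circ> e)(x := \<sigma> a)) \<phi> \<longleftrightarrow> sat S (e(x := a)) \<phi>" if "a \<in> univ S" for a
    proof -
      have "(\<sigma> \<circ> e)(x := \<sigma> a) = \<sigma> \<circ> (e(x := a))" by auto
      moreover have "sat S (\<sigma> \<circ> e(x := a)) \<phi> \<longleftrightarrow> sat S (e(x := a)) \<phi>"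
        by (rule All.IH) (use All.prems that in auto)
      ultimately show ?thesis by simp
    qed
    have "sat S (\<sigma> \<circ> e) (All x \<phi>) \<longleftrightarrow> (\<forall>a\<in>\<sigma> ` univ S. sat S ((\<sigma> \<circ> e)(x := a)) \<phi>)"
      using bij by (simp add: bij_betw_def)
    also have "\<dots> \<longleftrightarrow> sat S e (All x \<phi>)" using * by simp
    finally show ?case .
  qed simp
qed

lemma erel_automorphism:
  assumes "automorphism L S \<sigma>" "is_struct L S" "X \<subseteq> univ S" "\<And>a b. (a, b) \<in> G \<Longrightarrow> a \<in> X \<and> b = \<sigma> a"
  shows "erel L S S G"
  unfolding erel_def
proof (intro allI impI)
  fix \<phi> e assume "wf_fm L \<phi>" and e: "e ` fv \<phi> \<subseteq> G"
  have *: "fst (e i) \<in> X \<and> snd (e i) = \<sigma> (fst (e i))" if "i \<in> fv \<phi>" for i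
    using e that assms(4)[of "fst (e i)" "snd (e i)"] by auto
  have "sat S (snd \<circ> e) \<phi> \<longleftrightarrow> sat S (\<sigma> \<circ> (fst \<circ> e)) \<phi>"
    by (rule sat_cong) (simp add: *)
  also have "\<dots> \<longleftrightarrow> sat S (fst \<circ> e) \<phi>"
    by (rule sat_automorphism[OF assms(1,2) \<open>wf_fm L \<phi>\<close>]) (use * assms(3) in auto)
  finally show "sat S (fst \<circ> e) \<phi> \<longleftrightarrow> sat S (snd \<circ> e) \<phi>" by simp
qed

lemma automorphism_id: "automorphism L S id"
  by (auto simp: automorphism_def)

lemma automorphism_comp:
  assumes "automorphism L S \<sigma>" "automorphism L S \<tau>" shows "automorphism L S (\<sigma> \<circ> \<tau>)"
proof -
  have "map \<tau> xs \<in> tuples n (univ S)" if "xs \<in> tuples n (univ S)" for xs n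
    using that assms(2) by (auto simp: tuples_def automorphism_def bij_betw_def)
  then show ?thesis using assms unfolding automorphism_def
    by (auto intro: bij_betw_trans simp flip: map_map)
qed

lemma automorphism_inv:
  assumes "automorphism L S \<sigma>" "is_struct L S"
  shows "automorphism L S (inv_into (univ S) \<sigma>)"
proof -
  let ?i = "inv_into (univ S) \<sigma>"
  have bij: "bij_betw \<sigma> (univ S) (univ S)" using assms(1) by (simp add: automorphism_def)
  have bij': "bij_betw ?i (univ S) (univ S)" using bij by (rule bij_betw_inv_into)
  have m: "map ?i xs \<in> tuples n (univ S)" "map \<sigma> (map ?i xs) = xs" if "xs \<in> tuples n (univ S)" for xs n
    using that bij_betw_inv_into_right[OF bij] bij'
    by (auto simp: tuples_def bij_betw_def subset_iff intro!: map_idI)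
  show ?thesis unfolding automorphism_def
  proof (intro conjI ballI bij')
    fix g xs assume g: "g \<in> funs L" "xs \<in> tuples (fun_ar L g) (univ S)"
    have "fun_int S g (map ?i xs) \<in> univ S" using assms(2) g m by (auto simp: is_struct_def)
    then have "?i (\<sigma> (fun_int S g (map ?i xs))) = fun_int S g (map ?i xs)"
      using bij by (simp add: bij_betw_inv_into_left)
    moreover have "\<sigma> (fun_int S g (map ?i xs)) = fun_int S g xs"
      using assms(1) g m[OF g(2)] by (simp add: automorphism_def del: map_map)
    ultimately show "?i (fun_int S g xs) = fun_int S g (map ?i xs)" by simp
  next
    fix R xs assume R: "R \<in> rels L" "xs \<in> tuples (rel_ar L R) (univ S)"
    have "rel_int S R (map \<sigma> (map ?i xs)) = rel_int S R (map ?i xs)"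
      using assms(1) R m[OF R(2)] unfolding automorphism_def by blast
    then show "rel_int S R (map ?i xs) = rel_int S R xs" using m[OF R(2)] by simp
  qed
qed

lemma finite_less_Cinfinite:
  assumes "finite X" "Cinfinite r" shows "|X| <o r"
proof -
  have "|X| <o natLeq" using assms(1) by (simp add: finite_iff_ordLess_natLeq)
  then show ?thesis using natLeq_ordLeq_cinfinite[OF assms(2)] by (rule ordLess_ordLeq_trans)
qed

locale monster =
  fixes L :: "('f, 'r) lang"
    and T :: "('f, 'r) fm set"
    and \<CC> :: "('a, 'f, 'r) struct"
    and indep :: "'a set \<Rightarrow> 'a set \<Rightarrow> 'a set \<Rightarrow> bool"
    and \<mu> \<kappa>\<^sub>0 \<kappa> :: "'k rel"
  assumes complete_theory: "complete_theory L T"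
    and monster: "monster_model L T \<mu> \<CC>"
    and indep_rel: "independence_relation L \<mu> \<CC> indep"
    and kappa0: "is_kappa0 \<mu> \<CC> indep \<kappa>\<^sub>0"
    and kappa: "Card_order \<kappa>" "\<kappa> <o \<mu>" "\<kappa>\<^sub>0 <o \<kappa>"
begin

abbreviation "U \<equiv> univ \<CC>"
abbreviation "Aut \<sigma> \<equiv> automorphism L \<CC> \<sigma>"
abbreviation "sm A \<equiv> small \<mu> \<CC> A"
abbreviation "vs A \<equiv> A \<subseteq> U \<and> |A| <o \<kappa>"
abbreviation "lp M P \<equiv> lovely_pair L \<mu> \<CC> indep \<kappa> M P"

lemma struct: "is_struct L \<CC>" using monster by (simp add: monster_model_def)

lemma Cinfinite_kappa0: "Cinfinite \<kappa>\<^sub>0" using kappa0 by (simp add: is_kappa0_def kappa0_bound_def)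
lemma Cinfinite_kappa: "Cinfinite \<kappa>"
  using Cinfinite_kappa0 kappa by (meson cinfinite_mono ordLess_imp_ordLeq)
lemma Cinfinite_mu: "Cinfinite \<mu>"
  using Cinfinite_kappa kappa monster by (meson cinfinite_mono ordLess_imp_ordLeq monster_model_def)

lemma finite_less_kappa: "finite X \<Longrightarrow> |X| <o \<kappa>"
  by (rule finite_less_Cinfinite[OF _ Cinfinite_kappa])

lemma vs_sm: "vs A \<Longrightarrow> sm A"
  using kappa by (auto simp: small_def intro: ordLess_transitive)

lemma sm_subset: "sm A \<Longrightarrow> B \<subseteq> A \<Longrightarrow> sm B"
  by (meson small_def card_of_mono1 ordLeq_ordLess_trans subset_trans)

lemma sm_Un: "sm A \<Longrightarrow> sm B \<Longrightarrow> sm (A \<union> B)"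
  using Cinfinite_mu by (auto simp: small_def intro: Un_Cinfinite_bound_strict)

lemma less_kappa_Un: "|A| <o \<kappa> \<Longrightarrow> |B| <o \<kappa> \<Longrightarrow> |A \<union> B| <o \<kappa>"
  using Cinfinite_kappa by (auto intro: Un_Cinfinite_bound_strict)

lemma less_kappa_subset: "|A| <o \<kappa> \<Longrightarrow> B \<subseteq> A \<Longrightarrow> |B| <o \<kappa>"
  by (meson card_of_mono1 ordLeq_ordLess_trans)

lemma less_kappa_image: "|A| <o \<kappa> \<Longrightarrow> |f ` A| <o \<kappa>"
  by (meson card_of_image ordLeq_ordLess_trans)

lemma Aut_U: "Aut \<sigma> \<Longrightarrow> \<sigma> ` U = U"
  by (simp add: automorphism_def bij_betw_def)

lemma Aut_in_U: "Aut \<sigma> \<Longrightarrow> x \<in> U \<Longrightarrow> \<sigma> x \<in> U"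
  using Aut_U by blast

lemma sm_image: "sm A \<Longrightarrow> Aut \<sigma> \<Longrightarrow> sm (\<sigma> ` A)"
  unfolding small_def using Aut_U by (metis card_of_image image_mono ordLeq_ordLess_trans)

lemma Aut_inverse:
  assumes "Aut \<sigma>" obtains \<tau> where "Aut \<tau>" "\<And>x. x \<in> U \<Longrightarrow> \<tau> (\<sigma> x) = x" "\<And>x. x \<in> U \<Longrightarrow> \<sigma> (\<tau> x) = x"
proof
  show "Aut (inv_into U \<sigma>)" using automorphism_inv[OF assms struct] .
  have "bij_betw \<sigma> U U" using assms by (simp add: automorphism_def)
  then show "\<And>x. x \<in> U \<Longrightarrow> inv_into U \<sigma> (\<sigma> x) = x" "\<And>x. x \<in> U \<Longrightarrow> \<sigma> (inv_into U \<sigma> x) = x"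
    by (auto simp: bij_betw_inv_into_left bij_betw_inv_into_right)
qed

section \<open>Calculus of the independence relation\<close>

lemma ind_inv: "indep A B C \<Longrightarrow> Aut \<sigma> \<Longrightarrow> sm A \<Longrightarrow> sm B \<Longrightarrow> sm C \<Longrightarrow> indep (\<sigma> ` A) (\<sigma> ` B) (\<sigma> ` C)"
  using indep_rel[unfolded independence_relation_def, THEN conjunct1, rule_format, of A B C \<sigma>] by simp

lemma ind_norm: "indep A B C \<Longrightarrow> sm A \<Longrightarrow> sm B \<Longrightarrow> sm C \<Longrightarrow> indep (A \<union> B) B C"
  using indep_rel[unfolded independence_relation_def, THEN conjunct2, THEN conjunct1, rule_format, of A C B] by simp

lemma ind_sym: "indep A B C \<Longrightarrow> sm A \<Longrightarrow> sm B \<Longrightarrow> sm C \<Longrightarrow> indep C B A"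
  using indep_rel[unfolded independence_relation_def, THEN conjunct2, THEN conjunct2, THEN conjunct1, rule_format, of A B C] by simp

lemma ind_trans:
  "B \<subseteq> C \<Longrightarrow> C \<subseteq> D \<Longrightarrow> sm A \<Longrightarrow> sm D \<Longrightarrow> indep A B D \<longleftrightarrow> indep A B C \<and> indep A C D"
  using indep_rel[unfolded independence_relation_def, THEN conjunct2, THEN conjunct2, THEN conjunct2, THEN conjunct1, rule_format, of A D B C] by simp

lemma ind_fin:
  "sm A \<Longrightarrow> sm B \<Longrightarrow> sm C \<Longrightarrow> indep A B C \<longleftrightarrow> (\<forall>A0\<subseteq>A. finite A0 \<longrightarrow> indep A0 B C)"
  using indep_rel[unfolded independence_relation_def, THEN conjunct2, THEN conjunct2, THEN conjunct2, THEN conjunct2, THEN conjunct1, THEN spec, THEN spec, THEN spec, of A B C] by simp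

lemma ind_ext: "sm A \<Longrightarrow> sm B \<Longrightarrow> sm C \<Longrightarrow> \<exists>A'. equiv_over L \<CC> B A A' \<and> indep A' B C"
  using indep_rel[unfolded independence_relation_def, THEN conjunct2, THEN conjunct2, THEN conjunct2, THEN conjunct2, THEN conjunct2, THEN conjunct1, rule_format, of A B C] by simp

lemma ind_mono_left:
  assumes "indep A B C" "A' \<subseteq> A" "sm A" "sm B" "sm C" shows "indep A' B C"
proof -
  have "sm A'" using sm_subset assms by blast
  have "indep A0 B C" if "A0 \<subseteq> A'" "finite A0" for A0
    using ind_fin[of A B C] that assms by (meson subset_trans)
  then show ?thesis using ind_fin[OF \<open>sm A'\<close> assms(4,5)] by blast
qed

lemma ind_mono_right:
  assumes "indep A B C" "C' \<subseteq> C" "sm A" "sm B" "sm C" shows "indep A B C'"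
proof -
  have "indep C B A" by (rule ind_sym[OF assms(1,3-5)])
  then have "indep C' B A" by (rule ind_mono_left) (use assms in auto)
  then show ?thesis by (rule ind_sym) (use assms sm_subset in blast)+
qed

lemma ind_base_Un:
  assumes "indep A B C" "sm A" "sm B" "sm C" shows "indep A B (B \<union> C)"
proof -
  have "indep (C \<union> B) B A" by (rule ind_norm[OF ind_sym[OF assms] assms(4,3,2)])
  then show ?thesis using ind_sym[OF _ sm_Un[OF assms(4,3)] assms(3,2)] by (simp add: Un_commute)
qed

text \<open>Normality and symmetry put the base into the right-hand side; then one half of
  transitivity enlarges the base inside it.\<close>

lemma ind_base_mono:
  assumes "indep A B C" "B \<subseteq> B'" "B' \<subseteq> B \<union> C" "sm A" "sm B" "sm C"
  shows "indep A B' C"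
proof -
  have BC: "sm (B \<union> C)" by (rule sm_Un[OF assms(5,6)])
  then have B': "sm B'" by (rule sm_subset[OF _ assms(3)])
  have "indep A B' (B \<union> C)"
    using ind_trans[OF assms(2,3,4) BC] ind_base_Un[OF assms(1,4-6)] by simp
  then show ?thesis by (rule ind_mono_right[OF _ _ assms(4) B' BC]) simp
qed

text \<open>This is the other half of transitivity, after both right-hand sides have absorbed their
  bases.\<close>

lemma ind_chain_right:
  assumes "indep D B X" "indep D (B \<union> X) Y" and sm: "sm X" "sm Y" "sm B" "sm D"
  shows "indep D B (X \<union> Y)"
proof -
  have BX: "sm (B \<union> X)" and BXY: "sm (B \<union> X \<union> Y)" using sm by (auto intro!: sm_Un)
  have "indep D B (B \<union> X)" by (rule ind_base_Un[OF assms(1) sm(4,3,1)])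
  moreover have "indep D (B \<union> X) (B \<union> X \<union> Y)" by (rule ind_base_Un[OF assms(2) sm(4) BX sm(2)])
  ultimately have "indep D B (B \<union> X \<union> Y)"
    using ind_trans[OF _ _ sm(4) BXY, of B "B \<union> X"] by auto
  then show ?thesis by (rule ind_mono_right[OF _ _ sm(4,3) BXY]) auto
qed

lemma ind_chain:
  assumes "indep X B D" "indep Y (B \<union> X) D" and sm: "sm X" "sm Y" "sm B" "sm D"
  shows "indep (X \<union> Y) B D"
proof -
  have "indep D B X" by (rule ind_sym[OF assms(1) sm(1,3,4)])
  moreover have "indep D (B \<union> X) Y" by (rule ind_sym[OF assms(2) sm(2) sm_Un[OF sm(3,1)] sm(4)])
  ultimately have "indep D B (X \<union> Y)" by (rule ind_chain_right[OF _ _ sm])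
  then show ?thesis by (rule ind_sym[OF _ sm(4,3) sm_Un[OF sm(1,2)]])
qed

lemma extends_to_Aut:
  assumes "erel L \<CC> \<CC> G" "G \<subseteq> U \<times> U" "|G| <o \<mu>"
  obtains \<sigma> where "Aut \<sigma>" "\<And>a b. (a, b) \<in> G \<Longrightarrow> \<sigma> a = b"
proof -
  define h where "h = (\<lambda>a. SOME b. (a, b) \<in> G)"
  have h: "(a, h a) \<in> G" if "a \<in> fst ` G" for a
    unfolding h_def using that by (auto intro: someI)
  have "elementary_map L \<CC> (fst ` G) h"
    unfolding elementary_map_def
  proof (intro conjI allI impI)
    show "h ` fst ` G \<subseteq> U" using h assms(2) by auto
    fix \<phi> and e :: "nat \<Rightarrow> 'a" assume e: "wf_fm L \<phi> \<and> range e \<subseteq> fst ` G"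
    then have "sat \<CC> (fst \<circ> (\<lambda>i. (e i, h (e i)))) \<phi> \<longleftrightarrow> sat \<CC> (snd \<circ> (\<lambda>i. (e i, h (e i)))) \<phi>"
      by (intro erelD[OF assms(1)]) (auto intro!: h)
    then show "sat \<CC> e \<phi> = sat \<CC> (h \<circ> e) \<phi>" by (simp add: comp_def)
  qed
  moreover have "|fst ` G| <o \<mu>" using assms(3) by (meson card_of_image ordLeq_ordLess_trans)
  moreover have "fst ` G \<subseteq> U" using assms(2) by auto
  ultimately obtain \<sigma> where "Aut \<sigma>" "\<forall>x\<in>fst ` G. \<sigma> x = h x"
    using monster unfolding monster_model_def strongly_homogeneous_def by blast
  then show ?thesis
    using that[of \<sigma>] h erel_eq_iff[OF assms(1)] by (metis fst_conv image_eqI)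
qed

text \<open>Strong homogeneity turns the conjugate given by the extension axiom into the image under
  an automorphism. Automorphisms are used throughout in place of equality of types.\<close>

lemma Aut_indep:
  assumes "sm A" "sm B" "sm C"
  obtains \<sigma> where "Aut \<sigma>" "\<And>b. b \<in> B \<Longrightarrow> \<sigma> b = b" "indep (\<sigma> ` A) B C"
proof -
  obtain A' h where h: "elementary_map L \<CC> (A \<union> B) h" "h ` A = A'" "\<forall>b\<in>B. h b = b" "indep A' B C"
    using ind_ext[OF assms] by (auto simp: equiv_over_def)
  moreover have "A \<union> B \<subseteq> U \<and> |A \<union> B| <o \<mu>" using sm_Un[OF assms(1,2)] by (simp add: small_def)
  ultimately obtain \<sigma> where \<sigma>: "Aut \<sigma>" "\<forall>x\<in>A \<union> B. \<sigma> x = h x"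
    using monster unfolding monster_model_def strongly_homogeneous_def by blast
  then have "\<sigma> ` A = A'" using h by auto
  then show ?thesis using that[of \<sigma>] \<sigma> h by auto
qed

lemma ind_Aut_iff:
  assumes "Aut \<sigma>" "sm A" "sm B" "sm C"
  shows "indep (\<sigma> ` A) (\<sigma> ` B) (\<sigma> ` C) \<longleftrightarrow> indep A B C"
proof
  assume *: "indep (\<sigma> ` A) (\<sigma> ` B) (\<sigma> ` C)"
  obtain \<tau> where \<tau>: "Aut \<tau>" "\<And>x. x \<in> U \<Longrightarrow> \<tau> (\<sigma> x) = x" using Aut_inverse[OF assms(1)] by metis
  have "\<tau> ` \<sigma> ` X = X" if "sm X" for X
    using that \<tau>(2) by (force simp: small_def image_image)
  then show "indep A B C"
    using ind_inv[OF * \<tau>(1)] sm_image[OF _ assms(1)] assms(2-4) by simp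
qed (use assms ind_inv in blast)

text \<open>Extension gives a conjugate of \<open>A\<close> over \<open>B\<close> independent from
  \<open>B\<close> over \<open>B\<close>, and invariance pulls this back to
  \<open>A\<close>.\<close>

lemma ind_self_base: assumes "sm A" "sm B" shows "indep A B B"
proof -
  obtain \<sigma> where \<sigma>: "Aut \<sigma>" "\<And>b. b \<in> B \<Longrightarrow> \<sigma> b = b" "indep (\<sigma> ` A) B B"
    using Aut_indep[OF assms assms(2)] by blast
  then have "\<sigma> ` B = B" by force
  then show ?thesis using ind_Aut_iff[OF \<sigma>(1) assms assms(2)] \<sigma>(3) by simp
qed

section \<open>Types over sets and conjugation by automorphisms\<close>

definition tp :: "'a set \<Rightarrow> 'a \<Rightarrow> ('f + 'a, 'r) fm set" where
  "tp A c = {\<phi>. wf_fm (lang_params L A) \<phi> \<and> fv \<phi> \<subseteq> {0} \<and> sat (struct_params \<CC>) (\<lambda>_. c) \<phi>}"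

lemma tp_types1: "c \<in> U \<Longrightarrow> tp A c \<in> types1 L \<CC> A"
  unfolding types1_def tp_def by auto

lemma realizes_tp_self: "realizes \<CC> c (tp A c)"
  by (simp add: realizes_def tp_def)

lemma realizes_tp_erel:
  assumes "realizes \<CC> b (tp A c)" shows "erel L \<CC> \<CC> (insert (c, b) (Id_on A))"
  unfolding erel_def
proof (intro allI impI)
  fix \<phi> e assume wf: "wf_fm L \<phi>" and e: "e ` fv \<phi> \<subseteq> insert (c, b) (Id_on A)"
  have imp: "sat \<CC> (snd \<circ> e) \<psi>"
    if wf: "wf_fm L \<psi>" and e: "e ` fv \<psi> \<subseteq> insert (c, b) (Id_on A)" and sat: "sat \<CC> (fst \<circ> e) \<psi>" for \<psi>
  proof -
    let ?B = "{i. e i = (c, b)}"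
    have A: "(fst \<circ> e) i \<in> A" "fst (e i) = snd (e i)" if "i \<in> fv \<psi>" "i \<notin> ?B" for i
      using e that by (auto simp: image_subset_iff Id_on_def)
    have "\<exists>\<psi>'. wf_fm (lang_params L A) \<psi>' \<and> fv \<psi>' \<subseteq> (\<lambda>_. 0) ` (fv \<psi> \<inter> ?B) \<and>
      (\<forall>g. sat (struct_params \<CC>) g \<psi>' = sat \<CC> (\<lambda>i. if i \<in> ?B then g 0 else (fst \<circ> e) i) \<psi>)"
      by (rule ex_instance[OF wf, of ?B "fst \<circ> e" A "\<lambda>_. 0"]) (use A(1) in blast)+
    then obtain \<psi>' where \<psi>': "wf_fm (lang_params L A) \<psi>'" "fv \<psi>' \<subseteq> (\<lambda>_. 0) ` (fv \<psi> \<inter> ?B)"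
      "\<And>g. sat (struct_params \<CC>) g \<psi>' = sat \<CC> (\<lambda>i. if i \<in> ?B then g 0 else (fst \<circ> e) i) \<psi>"
      by blast
    have "sat (struct_params \<CC>) (\<lambda>_. c) \<psi>'"
      unfolding \<psi>'(3) using sat by (subst sat_cong[where e' = "fst \<circ> e"]) auto
    then have "\<psi>' \<in> tp A c" using \<psi>'(1,2) by (auto simp: tp_def)
    then have "sat (struct_params \<CC>) (\<lambda>_. b) \<psi>'" using assms by (simp add: realizes_def)
    moreover have "sat (struct_params \<CC>) (\<lambda>_. b) \<psi>' = sat \<CC> (snd \<circ> e) \<psi>"
      unfolding \<psi>'(3) by (rule sat_cong) (use A in auto)
    ultimately show ?thesis by simp
  qed
  \<comment> \<open>A realization preserves truth in one direction only; applying this to the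
    negation gives the converse.\<close>
  from imp[of \<phi>] imp[of "Neg \<phi>"] wf e show "sat \<CC> (fst \<circ> e) \<phi> \<longleftrightarrow> sat \<CC> (snd \<circ> e) \<phi>" by auto
qed

lemma realizes_tp_Aut:
  assumes "realizes \<CC> b (tp A c)" "sm A" "c \<in> U" "b \<in> U"
  obtains \<sigma> where "Aut \<sigma>" "\<And>a. a \<in> A \<Longrightarrow> \<sigma> a = a" "\<sigma> c = b"
proof -
  let ?G = "insert (c, b) (Id_on A)"
  have "|Id_on A| \<le>o |A|"
    using card_of_image[of "\<lambda>x. (x, x)" A] by (simp add: Id_on_def UNION_singleton_eq_range)
  then have "|Id_on A| <o \<mu>" using assms(2) unfolding small_def using ordLeq_ordLess_trans by blast
  moreover have "|{(c, b)}| <o \<mu>"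
    by (rule finite_less_Cinfinite[OF _ Cinfinite_mu]) simp
  ultimately have "|?G| <o \<mu>" using Un_Cinfinite_bound_strict[of "{(c, b)}" \<mu> "Id_on A"] Cinfinite_mu by simp
  moreover have "?G \<subseteq> U \<times> U" using assms by (auto simp: small_def Id_on_def)
  ultimately obtain \<sigma> where "Aut \<sigma>" "\<And>a b. (a, b) \<in> ?G \<Longrightarrow> \<sigma> a = b"
    using extends_to_Aut[OF realizes_tp_erel[OF assms(1)]] by metis
  then show ?thesis using that[of \<sigma>] by auto
qed

section \<open>Density and extension in a lovely pair\<close>

lemma lpD:
  assumes "lp M P"
  shows "sm M" "M \<subseteq> U" "P \<subseteq> M" "sm P" "P \<subseteq> U" "elementary_substruct L \<CC> M"
proof -
  show *: "sm M" "P \<subseteq> M" "elementary_substruct L \<CC> M" using assms by (simp_all add: lovely_pair_def)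
  show "sm P" using sm_subset[OF *(1,2)] .
  show "M \<subseteq> U" "P \<subseteq> U" using * by (auto simp: small_def)
qed

lemma density_realized:
  "lp M P \<Longrightarrow> A \<subseteq> M \<Longrightarrow> |A| <o \<kappa> \<Longrightarrow> q \<in> types1 L \<CC> A \<Longrightarrow>
    type_indep \<CC> indep q (P \<inter> A) A \<Longrightarrow> \<exists>b\<in>P. realizes \<CC> b q"
  by (simp add: lovely_pair_def)

lemma extension_realized:
  "lp M P \<Longrightarrow> A \<subseteq> M \<Longrightarrow> |A| <o \<kappa> \<Longrightarrow> q \<in> types1 L \<CC> A \<Longrightarrow>
    \<exists>b\<in>M. realizes \<CC> b q \<and> indep {b} A P"
  by (simp add: lovely_pair_def)

lemma density:
  assumes "lp M P" "A \<subseteq> M" "|A| <o \<kappa>" "c \<in> U" "indep {c} (P \<inter> A) A"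
  obtains \<sigma> where "Aut \<sigma>" "\<And>a. a \<in> A \<Longrightarrow> \<sigma> a = a" "\<sigma> c \<in> P"
proof -
  have "type_indep \<CC> indep (tp A c) (P \<inter> A) A"
    using assms realizes_tp_self by (auto simp: type_indep_def)
  then obtain b where b: "b \<in> P" "realizes \<CC> b (tp A c)"
    using density_realized[OF assms(1-3) tp_types1[OF assms(4)]] by blast
  have "sm A" using assms lpD[OF assms(1)] by (intro vs_sm) auto
  moreover have "b \<in> U" using b(1) lpD[OF assms(1)] by auto
  ultimately obtain \<sigma> where "Aut \<sigma>" "\<And>a. a \<in> A \<Longrightarrow> \<sigma> a = a" "\<sigma> c = b"
    using realizes_tp_Aut[OF b(2) _ assms(4)] by blast
  then show ?thesis using that[of \<sigma>] b by simp
qed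

lemma extension1:
  assumes "lp M P" "A \<subseteq> M" "|A| <o \<kappa>" "c \<in> U"
  obtains \<sigma> where "Aut \<sigma>" "\<And>a. a \<in> A \<Longrightarrow> \<sigma> a = a" "\<sigma> c \<in> M" "indep {\<sigma> c} A P"
proof -
  obtain b where b: "b \<in> M" "realizes \<CC> b (tp A c)" "indep {b} A P"
    using extension_realized[OF assms(1-3) tp_types1[OF assms(4)]] by blast
  have "sm A" using assms lpD[OF assms(1)] by (intro vs_sm) auto
  moreover have "b \<in> U" using b(1) lpD[OF assms(1)] by auto
  ultimately obtain \<sigma> where "Aut \<sigma>" "\<And>a. a \<in> A \<Longrightarrow> \<sigma> a = a" "\<sigma> c = b"
    using realizes_tp_Aut[OF b(2) _ assms(4)] by blast
  then show ?thesis using that[of \<sigma>] b by simp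
qed

lemma finite_sm: "finite X \<Longrightarrow> X \<subseteq> U \<Longrightarrow> sm X"
  using finite_less_kappa vs_sm by blast

text \<open>The two independences combine to \<open>{c}\<close> being independent from
  \<open>(P \<inter> B) \<union> {c}\<close> over \<open>P \<inter> B\<close>. If \<open>c\<close>
  were outside \<open>P\<close>, this base would be the whole trace of \<open>P\<close> on
  \<open>(P \<inter> B) \<union> {c}\<close>, so density would realize in \<open>P\<close> a type
  that contains the formula saying to be equal to \<open>c\<close>.\<close>

lemma P_closed:
  assumes "lp M P" "B \<subseteq> M" "|B| <o \<kappa>" "c \<in> M" "indep {c} B {c}" "indep {c} (P \<inter> B) B"
  shows "c \<in> P"
proof (rule ccontr)
  assume "c \<notin> P"
  note M = lpD[OF assms(1)]
  have smB: "sm B" using assms M by (intro vs_sm) auto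
  then have smPB: "sm (P \<inter> B)" by (rule sm_subset) auto
  have smc: "sm {c}" using assms M by (intro finite_sm) auto
  have "P \<inter> B \<union> B = B" by auto
  then have "indep {c} (P \<inter> B) (B \<union> {c})"
    using assms(5,6) by (intro ind_chain_right smB smPB smc) auto
  then have "indep {c} (P \<inter> B) ((P \<inter> B) \<union> {c})"
    by (rule ind_mono_right[OF _ _ smc smPB sm_Un[OF smB smc]]) auto
  moreover have "P \<inter> ((P \<inter> B) \<union> {c}) = P \<inter> B" using \<open>c \<notin> P\<close> by auto
  moreover have "|(P \<inter> B) \<union> {c}| <o \<kappa>"
    by (intro less_kappa_Un finite_less_kappa less_kappa_subset[OF assms(3)]) auto
  moreover have "(P \<inter> B) \<union> {c} \<subseteq> M" "c \<in> U" using assms(2,4) M(2) by auto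
  ultimately obtain \<sigma> where "\<And>a. a \<in> (P \<inter> B) \<union> {c} \<Longrightarrow> \<sigma> a = a" "\<sigma> c \<in> P"
    using density[OF assms(1), of "(P \<inter> B) \<union> {c}" c] by metis
  then show False using \<open>c \<notin> P\<close> by auto
qed

text \<open>Elements are moved into \<open>M\<close> one at a time; each new automorphism fixes
  \<open>B\<close> and the earlier images, and \<open>ind_chain\<close> adds up the
  independences.\<close>

lemma extension:
  assumes "lp M P" "B \<subseteq> M" "|B| <o \<kappa>" "finite X" "X \<subseteq> U"
  obtains \<sigma> where "Aut \<sigma>" "\<And>a. a \<in> B \<Longrightarrow> \<sigma> a = a" "\<sigma> ` X \<subseteq> M" "indep (\<sigma> ` X) B P"
proof -
  note M = lpD[OF assms(1)]
  have smB: "sm B" using assms M vs_sm by auto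
  have "\<exists>\<sigma>. Aut \<sigma> \<and> (\<forall>a\<in>B. \<sigma> a = a) \<and> \<sigma> ` X \<subseteq> M \<and> indep (\<sigma> ` X) B P" using assms(4,5)
  proof (induction X rule: finite_induct)
    case empty
    have "indep B B P" by (rule ind_sym[OF ind_self_base[OF M(4) smB] M(4) smB smB])
    then have "indep {} B P" by (rule ind_mono_left[OF _ _ smB smB M(4)]) simp
    then show ?case using automorphism_id[of L \<CC>] by (intro exI[of _ id]) (auto simp: id_def)
  next
    case (insert x X)
    then obtain \<sigma> where \<sigma>: "Aut \<sigma>" "\<forall>a\<in>B. \<sigma> a = a" "\<sigma> ` X \<subseteq> M" "indep (\<sigma> ` X) B P" by auto
    have "|B \<union> \<sigma> ` X| <o \<kappa>" by (intro less_kappa_Un assms(3) finite_less_kappa) (use insert in auto)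
    moreover have "\<sigma> x \<in> U" using Aut_in_U[OF \<sigma>(1)] insert by auto
    moreover have "B \<union> \<sigma> ` X \<subseteq> M" using \<sigma> assms(2) by auto
    ultimately obtain \<pi> where \<pi>: "Aut \<pi>" "\<And>a. a \<in> B \<union> \<sigma> ` X \<Longrightarrow> \<pi> a = a" "\<pi> (\<sigma> x) \<in> M"
      "indep {\<pi> (\<sigma> x)} (B \<union> \<sigma> ` X) P"
      using extension1[OF assms(1), of "B \<union> \<sigma> ` X" "\<sigma> x"] by blast
    have "\<sigma> ` X \<subseteq> U" using \<sigma>(3) M by auto
    then have "indep (\<sigma> ` X \<union> {\<pi> (\<sigma> x)}) B P"
      by (intro ind_chain[OF \<sigma>(4) \<pi>(4)] finite_sm smB M(4)) (use \<pi>(3) M(2) insert(1) in auto)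
    moreover have "\<pi> ` \<sigma> ` X = (\<lambda>x. x) ` \<sigma> ` X" by (rule image_cong) (use \<pi>(2) in auto)
    then have "(\<pi> \<circ> \<sigma>) ` insert x X = \<sigma> ` X \<union> {\<pi> (\<sigma> x)}" by (simp add: image_image)
    moreover have "\<forall>a\<in>B. (\<pi> \<circ> \<sigma>) a = a" using \<sigma>(2) \<pi>(2) by simp
    moreover have "(\<pi> \<circ> \<sigma>) ` insert x X \<subseteq> M" using calculation(2) \<sigma>(3) \<pi>(3) by simp
    ultimately show ?case using automorphism_comp[OF \<pi>(1) \<sigma>(1)] by metis
  qed
  then show ?thesis using that by blast
qed

text \<open>Density for a possibly infinite very small set. A maximal partial elementary map,
  identical on \<open>D\<close> and sending \<open>Z\<close> into \<open>Q\<close>, replaces a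
  transfinite enumeration of \<open>Z\<close>. If some \<open>z\<close> were missing, its type over
  the part already treated could be realized in \<open>Q\<close>, since the independence hypothesis
  survives every stage.\<close>

lemma density_set:
  assumes lp: "lp N Q" and D: "D \<subseteq> N" "|D| <o \<kappa>" and Z: "Z \<subseteq> U" "|Z| <o \<kappa>" "indep Z (Q \<inter> D) D"
  obtains \<pi> where "Aut \<pi>" "\<And>a. a \<in> D \<Longrightarrow> \<pi> a = a" "\<pi> ` Z \<subseteq> Q"
proof -
  note N = lpD[OF lp]
  have smD: "sm D" using D N(2) by (intro vs_sm) auto
  have smQD: "sm (Q \<inter> D)" by (rule sm_subset[OF smD]) auto
  have smZ: "sm Z" using Z by (intro vs_sm) auto
  define \<Z> where "\<Z> = {G. Id_on D \<subseteq> G \<and> erel L \<CC> \<CC> G \<and> fst ` G \<subseteq> D \<union> Z \<and>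
    (\<forall>(a, b)\<in>G. b \<in> N \<and> (a \<in> Z \<longrightarrow> b \<in> Q))}"
  \<comment> \<open>The identity on \<open>D\<close> is an admissible starting point only if it maps
    \<open>Z \<inter> D\<close> into \<open>Q\<close>. Such an element is independent from itself
    over \<open>D\<close>, so \<open>P_closed\<close> applies.\<close>
  have "a \<in> Q" if "a \<in> D" "a \<in> Z" for a
  proof -
    have sma: "sm {a}" using that Z(1) by (intro finite_sm) auto
    have a: "indep {a} (Q \<inter> D) D" by (rule ind_mono_left[OF Z(3) _ smZ smQD smD]) (use that in auto)
    have "indep {a} D D" by (rule ind_base_mono[OF a _ _ sma smQD smD]) auto
    then have "indep {a} D {a}" by (rule ind_mono_right[OF _ _ sma smD smD]) (use that in auto)
    then show ?thesis using P_closed[OF lp D _ _ a] D(1) that by auto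
  qed
  moreover have "erel L \<CC> \<CC> (Id_on D)"
    by (rule erel_automorphism[OF automorphism_id struct N(2)]) (use D(1) in auto)
  ultimately have "Id_on D \<in> \<Z>" using D(1) by (auto simp: \<Z>_def)
  moreover have "\<Union>\<C> \<in> \<Z>" if "\<C> \<noteq> {}" "subset.chain \<Z> \<C>" for \<C>
  proof -
    have sub: "\<C> \<subseteq> \<Z>" using that(2) by (simp add: subset_chain_def)
    then have "erel L \<CC> \<CC> (\<Union>\<C>)" using that by (intro erel_Union_chain) (auto simp: \<Z>_def)
    then show ?thesis using sub that(1) unfolding \<Z>_def by blast
  qed
  ultimately obtain G where G: "G \<in> \<Z>" "\<And>X. X \<in> \<Z> \<Longrightarrow> G \<subseteq> X \<Longrightarrow> X = G"
    using subset_Zorn_nonempty[of \<Z>] by blast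
  have ZG: "Id_on D \<subseteq> G" "erel L \<CC> \<CC> G" "fst ` G \<subseteq> D \<union> Z"
    and GN: "\<And>a b. (a, b) \<in> G \<Longrightarrow> b \<in> N" and GQ: "\<And>a b. (a, b) \<in> G \<Longrightarrow> a \<in> Z \<Longrightarrow> b \<in> Q"
    using G(1) by (auto simp: \<Z>_def)
  have "inj_on fst G" using erel_eq_iff[OF ZG(2)] by (intro inj_onI) (metis prod.collapse)
  then have "|G| \<le>o |D \<union> Z|" by (rule card_of_ordLeqI) (use ZG(3) in auto)
  then have less: "|G| <o \<kappa>" using less_kappa_Un[OF D(2) Z(2)] by (rule ordLeq_ordLess_trans)
  have GU: "a \<in> U \<and> b \<in> U" if "(a, b) \<in> G" for a b
  proof -
    have "a \<in> fst ` G" using that by force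
    then show ?thesis using ZG(3) GN[OF that] N(2) D(1) Z(1) by auto
  qed
  then have "G \<subseteq> U \<times> U" by auto
  then obtain \<sigma> where \<sigma>: "Aut \<sigma>" "\<And>a b. (a, b) \<in> G \<Longrightarrow> \<sigma> a = b"
    using extends_to_Aut[OF ZG(2) _ ordLess_transitive[OF less kappa(2)]] by metis
  let ?E = "fst ` G" and ?E' = "snd ` G"
  have D_sub: "D \<subseteq> ?E" using ZG(1) by (force simp: Id_on_def)
  have "Z \<subseteq> ?E"
  proof (rule ccontr)
    assume "\<not> Z \<subseteq> ?E"
    then obtain z where z: "z \<in> Z" "z \<notin> ?E" by auto
    have smE: "sm ?E" "sm ?E'" using GU less by (auto intro!: vs_sm less_kappa_image)
    have smz: "sm {z}" using z Z(1) by (intro finite_sm) auto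
    define Z0 where "Z0 = Z \<inter> ?E"
    have smQZ: "sm (Q \<inter> D \<union> Z0)" using D_sub by (intro sm_subset[OF smE(1)]) (auto simp: Z0_def)
    have "indep D (Q \<inter> D) Z" by (rule ind_sym[OF Z(3) smZ smQD smD])
    then have "indep D (Q \<inter> D \<union> Z0) Z"
      by (rule ind_base_mono[OF _ _ _ smD smQD smZ]) (auto simp: Z0_def)
    \<comment> \<open>The part \<open>Z0\<close> already treated goes into the base; normality then
      makes the left-hand side the whole domain of \<open>G\<close>.\<close>
    then have "indep (D \<union> (Q \<inter> D \<union> Z0)) (Q \<inter> D \<union> Z0) Z" by (rule ind_norm[OF _ smD smQZ smZ])
    moreover have "D \<union> (Q \<inter> D \<union> Z0) = ?E" using D_sub ZG(3) by (auto simp: Z0_def)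
    ultimately have "indep ?E (Q \<inter> D \<union> Z0) Z" by simp
    then have "indep ?E (Q \<inter> D \<union> Z0) {z}" by (rule ind_mono_right[OF _ _ smE(1) smQZ smZ]) (use z in auto)
    then have "indep {z} (Q \<inter> D \<union> Z0) ?E" by (rule ind_sym[OF _ smE(1) smQZ smz])
    then have *: "indep {\<sigma> z} (\<sigma> ` (Q \<inter> D \<union> Z0)) (\<sigma> ` ?E)"
      using ind_inv[OF _ \<sigma>(1) smz smQZ smE(1)] by simp
    have im: "\<sigma> ` ?E = ?E'" using \<sigma>(2) by (force simp: image_image intro!: image_cong)
    have "\<sigma> a \<in> Q \<inter> ?E'" if "a \<in> Q \<inter> D \<union> Z0" for a
    proof -
      have "a \<in> ?E" using that D_sub by (auto simp: Z0_def)
      then obtain b where b: "(a, b) \<in> G" by auto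
      have "b \<in> Q"
      proof (cases "a \<in> Z0")
        case True
        then show ?thesis using GQ[OF b] by (simp add: Z0_def)
      next
        case False
        then have "a \<in> Q" "(a, a) \<in> G" using that ZG(1) by auto
        then show ?thesis using erel_eq_iff[OF ZG(2) b, of a a] by auto
      qed
      then show ?thesis using \<sigma>(2)[OF b] b by force
    qed
    then have sub: "\<sigma> ` (Q \<inter> D \<union> Z0) \<subseteq> Q \<inter> ?E'" by blast
    \<comment> \<open>The image of the base lies in \<open>Q\<close>, and it is enlarged to the full
      trace of \<open>Q\<close> on the range of \<open>G\<close>, the form required by
      density.\<close>
    have "indep {\<sigma> z} (Q \<inter> ?E') ?E'"
      by (rule ind_base_mono[OF *[unfolded im] sub]) (auto intro!: smE sm_image[OF smQZ \<sigma>(1)] sm_image[OF smz \<sigma>(1), simplified])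
    moreover have "\<sigma> z \<in> U" using Aut_in_U[OF \<sigma>(1)] z Z(1) by auto
    moreover have "?E' \<subseteq> N" using GN by auto
    ultimately obtain \<pi> where \<pi>: "Aut \<pi>" "\<And>a. a \<in> ?E' \<Longrightarrow> \<pi> a = a" "\<pi> (\<sigma> z) \<in> Q"
      using density[OF lp _ less_kappa_image[OF less]] by metis
    let ?G = "insert (z, \<pi> (\<sigma> z)) G"
    have "(\<pi> \<circ> \<sigma>) a = b" if "(a, b) \<in> ?G" for a b using that \<sigma>(2) \<pi>(2) by force
    then have "erel L \<CC> \<CC> ?G"
      using GU Z(1) z(1)
      by (intro erel_automorphism[OF automorphism_comp[OF \<pi>(1) \<sigma>(1)] struct order_refl]) auto
    then have "?G \<in> \<Z>" unfolding \<Z>_def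
      using ZG(1,3) GN GQ \<pi>(3) z(1) N(3) by (intro CollectI conjI) auto
    then have "?G = G" using G(2) by blast
    then show False using z(2) by (metis fst_conv image_eqI insertI1)
  qed
  then have "\<sigma> ` Z \<subseteq> Q" using \<sigma>(2) GQ by force
  moreover have "\<sigma> a = a" if "a \<in> D" for a using that \<sigma>(2) ZG(1) by auto
  ultimately show ?thesis using that \<sigma>(1) by blast
qed

section \<open>Back and forth between lovely pairs\<close>

definition good :: "'a set \<Rightarrow> 'a set \<Rightarrow> 'a set \<Rightarrow> 'a set \<Rightarrow> ('a \<times> 'a) set \<Rightarrow> bool" where
  "good M P N Q G \<longleftrightarrow> G \<subseteq> M \<times> N \<and> erel L \<CC> \<CC> G \<and> |G| <o \<kappa> \<and>
     P_independent indep P (fst ` G) \<and> P_independent indep Q (snd ` G) \<and>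
     (\<forall>(a, b)\<in>G. a \<in> P \<longleftrightarrow> b \<in> Q)"

lemma goodD:
  assumes "good M P N Q G"
  shows "G \<subseteq> M \<times> N" "erel L \<CC> \<CC> G" "|G| <o \<kappa>" "P_independent indep P (fst ` G)"
    "P_independent indep Q (snd ` G)" "\<And>a b. (a, b) \<in> G \<Longrightarrow> a \<in> P \<longleftrightarrow> b \<in> Q"
    "fst ` G \<subseteq> M" "snd ` G \<subseteq> N" "|fst ` G| <o \<kappa>" "|snd ` G| <o \<kappa>"
  using assms by (auto simp: good_def intro: less_kappa_image)

lemma good_converse: "good M P N Q G \<Longrightarrow> good N Q M P (G\<inverse>)"
proof -
  assume G: "good M P N Q G"
  have *: "fst ` (G\<inverse>) = snd ` G" "snd ` (G\<inverse>) = fst ` G" by force+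
  have "G\<inverse> = prod.swap ` G" by force
  then have "|G\<inverse>| <o \<kappa>" using goodD(3)[OF G] by (simp add: less_kappa_image)
  then show ?thesis using goodD[OF G] erel_converse[OF goodD(2)[OF G]]
    unfolding good_def * by auto
qed

lemma good_Aut:
  assumes "lp M P" "lp N Q" "good M P N Q G"
  obtains \<sigma> where "Aut \<sigma>" "\<And>a b. (a, b) \<in> G \<Longrightarrow> \<sigma> a = b" "\<sigma> ` fst ` G = snd ` G"
    "\<sigma> ` (P \<inter> fst ` G) = Q \<inter> snd ` G"
proof -
  note G = goodD[OF assms(3)]
  have "G \<subseteq> U \<times> U" using G(1) lpD[OF assms(1)] lpD[OF assms(2)] by blast
  moreover have "|G| <o \<mu>" using G(3) kappa(2) by (rule ordLess_transitive)
  ultimately obtain \<sigma> where \<sigma>: "Aut \<sigma>" "\<And>a b. (a, b) \<in> G \<Longrightarrow> \<sigma> a = b"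
    using extends_to_Aut[OF G(2)] by metis
  have "\<sigma> ` fst ` G = snd ` G" using \<sigma>(2) by (force simp: image_image intro!: image_cong)
  moreover have "\<sigma> ` (P \<inter> fst ` G) = Q \<inter> snd ` G"
  proof (intro equalityI subsetI)
    fix b assume "b \<in> \<sigma> ` (P \<inter> fst ` G)"
    then obtain a b' where "a \<in> P" "(a, b') \<in> G" "b = \<sigma> a" by auto
    then show "b \<in> Q \<inter> snd ` G" using \<sigma>(2) G(6) by force
  next
    fix b assume "b \<in> Q \<inter> snd ` G"
    then obtain a where "(a, b) \<in> G" "a \<in> P" using G(6) by auto
    then show "b \<in> \<sigma> ` (P \<inter> fst ` G)" using \<sigma>(2) by force
  qed
  ultimately show ?thesis using that[OF \<sigma>] by simp
qed

text \<open>Transitivity first keeps the old base \<open>P \<inter> B\<close>; it may then grow to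
  the trace of \<open>P\<close> on the larger set because that trace lies in
  \<open>P\<close>.\<close>

lemma P_independent_Un:
  assumes "lp M P" "P_independent indep P B" "indep X B P" "sm B" "sm X"
  shows "P_independent indep P (B \<union> X)"
proof -
  note P = lpD(4)[OF assms(1)]
  have PB: "sm (P \<inter> B)" by (rule sm_subset[OF P]) auto
  have "P \<inter> B \<union> B = B" by auto
  then have "indep (B \<union> X) (P \<inter> B) P"
    using assms by (intro ind_chain PB P) (auto simp: P_independent_def)
  then have "indep (B \<union> X) (P \<inter> (B \<union> X)) P"
    by (rule ind_base_mono) (auto intro!: PB P sm_Un assms)
  then show ?thesis by (simp add: P_independent_def)
qed

lemma P_independent_Un_P:
  assumes "lp M P" "P_independent indep P B" "sm B" "X \<subseteq> P"
  shows "P_independent indep P (B \<union> X)"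
proof -
  note P = lpD(4)[OF assms(1)]
  have X: "sm X" by (rule sm_subset[OF P assms(4)])
  have PB: "sm (P \<inter> B)" "sm (P \<inter> B \<union> X)" using assms(4) by (auto intro!: sm_subset[OF P])
  have "indep B (P \<inter> B) P" using assms(2) by (simp add: P_independent_def)
  then have "indep B (P \<inter> B \<union> X) P"
    by (rule ind_base_mono) (use assms(4) in \<open>auto intro!: PB P assms(3)\<close>)
  then have "indep (B \<union> (P \<inter> B \<union> X)) (P \<inter> B \<union> X) P"
    by (rule ind_norm) (auto intro!: PB P assms(3))
  moreover have "B \<union> (P \<inter> B \<union> X) = B \<union> X" "P \<inter> (B \<union> X) = P \<inter> B \<union> X" using assms(4) by auto
  ultimately show ?thesis by (simp add: P_independent_def)
qed

text \<open>A point \<open>x\<close> of \<open>P\<close> that is independent from \<open>P\<close>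
  over the domain is independent from itself over it. This property is transported by \<sigma>, and
  in the target pair it forces membership in the predicate by \<open>P_closed\<close>.\<close>

lemma good_preserves:
  assumes "lp M P" "lp N Q" "good M P N Q G" "Aut \<sigma>" "\<And>a b. (a, b) \<in> G \<Longrightarrow> \<sigma> a = b"
    and x: "x \<in> P" "indep {x} (fst ` G) P" "\<sigma> x \<in> N"
  shows "\<sigma> x \<in> Q"
proof -
  note G = goodD[OF assms(3)]
  note M = lpD[OF assms(1)] and N = lpD[OF assms(2)]
  let ?B = "fst ` G"
  have B: "sm ?B" using G(7,9) M(2) by (intro vs_sm) auto
  have PB: "sm (P \<inter> ?B)" by (rule sm_subset[OF B]) auto
  have X: "sm {x}" using x(1) M(5) by (intro finite_sm) auto
  have im: "\<sigma> ` ?B = snd ` G" "\<sigma> ` (P \<inter> ?B) = Q \<inter> snd ` G"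
  proof -
    obtain \<tau> where \<tau>: "\<And>a b. (a, b) \<in> G \<Longrightarrow> \<tau> a = b" "\<tau> ` fst ` G = snd ` G" "\<tau> ` (P \<inter> fst ` G) = Q \<inter> snd ` G"
      using good_Aut[OF assms(1-3)] by metis
    have "\<sigma> a = \<tau> a" if "a \<in> ?B" for a using that \<tau>(1) assms(5) by auto
    then have "\<sigma> ` ?B = \<tau> ` ?B" "\<sigma> ` (P \<inter> ?B) = \<tau> ` (P \<inter> ?B)" by (auto intro!: image_cong)
    then show "\<sigma> ` ?B = snd ` G" "\<sigma> ` (P \<inter> ?B) = Q \<inter> snd ` G" using \<tau> by simp_all
  qed
  have "indep {x} ?B {x}" by (rule ind_mono_right[OF x(2) _ X B M(4)]) (use x(1) in auto)
  then have 1: "indep {\<sigma> x} (snd ` G) {\<sigma> x}"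
    using ind_inv[OF _ assms(4) X B X] im by simp
  have "indep ?B (P \<inter> ?B) P" using G(4) by (simp add: P_independent_def)
  then have "indep ?B (P \<inter> ?B) {x}" by (rule ind_mono_right[OF _ _ B PB M(4)]) (use x(1) in auto)
  then have "indep {x} (P \<inter> ?B) ?B" by (rule ind_sym[OF _ B PB X])
  then have 2: "indep {\<sigma> x} (Q \<inter> snd ` G) (snd ` G)"
    using ind_inv[OF _ assms(4) X PB B] im by simp
  show ?thesis by (rule P_closed[OF assms(2) G(8,10) x(3) 1 2])
qed

text \<open>Agreement on the predicate comes for free: \<open>good_preserves\<close> is applied to
  the map and to its converse.\<close>

lemma good_extend:
  assumes lp: "lp M P" "lp N Q" and good: "good M P N Q G"
    and \<sigma>: "Aut \<sigma>" "\<And>a b. (a, b) \<in> G \<Longrightarrow> \<sigma> a = b"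
    and X: "X \<subseteq> M" "|X| <o \<kappa>" "\<sigma> ` X \<subseteq> N" "indep X (fst ` G) P" "indep (\<sigma> ` X) (snd ` G) Q"
  shows "good M P N Q (G \<union> (\<lambda>x. (x, \<sigma> x)) ` X)"
  unfolding good_def
proof (intro conjI)
  note G = goodD[OF good]
  note M = lpD[OF lp(1)] and N = lpD[OF lp(2)]
  let ?G = "G \<union> (\<lambda>x. (x, \<sigma> x)) ` X"
  have f: "fst ` ?G = fst ` G \<union> X" "snd ` ?G = snd ` G \<union> \<sigma> ` X" by (force simp: image_Un image_image)+
  have smX: "sm X" using X M(2) by (intro vs_sm) auto
  note smX = smX sm_image[OF smX \<sigma>(1)]
  have smB: "sm (fst ` G)" "sm (snd ` G)" using G M(2) N(2) by (auto intro!: vs_sm)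
  show "?G \<subseteq> M \<times> N" using G(1) X by auto
  show "|?G| <o \<kappa>" using G(3) X(2) by (intro less_kappa_Un less_kappa_image) auto
  show "erel L \<CC> \<CC> ?G"
    by (rule erel_automorphism[OF \<sigma>(1) struct M(2)]) (use \<sigma>(2) G(1) X(1) in auto)
  show "P_independent indep P (fst ` ?G)"
    unfolding f by (rule P_independent_Un[OF lp(1) G(4) X(4) smB(1) smX(1)])
  show "P_independent indep Q (snd ` ?G)"
    unfolding f by (rule P_independent_Un[OF lp(2) G(5) X(5) smB(2) smX(2)])
  have "x \<in> P \<longleftrightarrow> \<sigma> x \<in> Q" if "x \<in> X" for x
  proof
    assume "x \<in> P"
    moreover have "indep {x} (fst ` G) P"
      by (rule ind_mono_left[OF X(4) _ smX(1) smB(1) M(4)]) (use that in auto)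
    ultimately show "\<sigma> x \<in> Q" using good_preserves[OF lp good \<sigma>] X(3) that by auto
  next
    assume *: "\<sigma> x \<in> Q"
    obtain \<tau> where \<tau>: "Aut \<tau>" "\<And>x. x \<in> U \<Longrightarrow> \<tau> (\<sigma> x) = x" using Aut_inverse[OF \<sigma>(1)] by metis
    have "\<tau> b = a" if "(b, a) \<in> G\<inverse>" for a b
    proof -
      have "\<sigma> a = b" "a \<in> U" using that \<sigma>(2) G(1) M(2) by auto
      then show ?thesis using \<tau>(2) by auto
    qed
    moreover have "fst ` (G\<inverse>) = snd ` G" by force
    moreover have "indep {\<sigma> x} (snd ` G) Q"
      by (rule ind_mono_left[OF X(5) _ smX(2) smB(2) N(4)]) (use that in auto)
    moreover have "\<tau> (\<sigma> x) = x" using \<tau>(2) X(1) M(2) that by auto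
    ultimately have "\<tau> (\<sigma> x) \<in> P"
      using good_preserves[OF lp(2,1) good_converse[OF good] \<tau>(1), of "\<sigma> x"] * X(1) that by auto
    then show "x \<in> P" using \<open>\<tau> (\<sigma> x) = x\<close> by simp
  qed
  then show "\<forall>(a, b)\<in>?G. a \<in> P \<longleftrightarrow> b \<in> Q" using G(6) by auto
qed

lemma good_extend_P:
  assumes lp: "lp M P" "lp N Q" and good: "good M P N Q G"
    and \<sigma>: "Aut \<sigma>" "\<And>a b. (a, b) \<in> G \<Longrightarrow> \<sigma> a = b"
    and X: "X \<subseteq> P" "|X| <o \<kappa>" "\<sigma> ` X \<subseteq> Q"
  shows "good M P N Q (G \<union> (\<lambda>x. (x, \<sigma> x)) ` X)"
  unfolding good_def
proof (intro conjI)
  note G = goodD[OF good]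
  note M = lpD[OF lp(1)] and N = lpD[OF lp(2)]
  let ?G = "G \<union> (\<lambda>x. (x, \<sigma> x)) ` X"
  have f: "fst ` ?G = fst ` G \<union> X" "snd ` ?G = snd ` G \<union> \<sigma> ` X" by (force simp: image_Un image_image)+
  have smB: "sm (fst ` G)" "sm (snd ` G)" using G M(2) N(2) by (auto intro!: vs_sm)
  show "?G \<subseteq> M \<times> N" using G(1) X M(3) N(3) by auto
  show "|?G| <o \<kappa>" using G(3) X(2) by (intro less_kappa_Un less_kappa_image) auto
  show "erel L \<CC> \<CC> ?G"
    by (rule erel_automorphism[OF \<sigma>(1) struct M(2)]) (use \<sigma>(2) G(1) X(1) M(3) in auto)
  show "P_independent indep P (fst ` ?G)"
    unfolding f by (rule P_independent_Un_P[OF lp(1) G(4) smB(1) X(1)])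
  show "P_independent indep Q (snd ` ?G)"
    unfolding f by (rule P_independent_Un_P[OF lp(2) G(5) smB(2) X(3)])
  show "\<forall>(a, b)\<in>?G. a \<in> P \<longleftrightarrow> b \<in> Q" using G(6) X by auto
qed

text \<open>P-independence of the domain says that \<open>P1\<close> is independent from it over its
  trace on \<open>P\<close>; the image of this independence is the hypothesis of
  \<open>density_set\<close>.\<close>

lemma good_add_P:
  assumes lp: "lp M P" "lp N Q" and good: "good M P N Q G" and P1: "P1 \<subseteq> P" "|P1| <o \<kappa>"
  obtains G' where "G \<subseteq> G'" "good M P N Q G'" "fst ` G' = fst ` G \<union> P1"
proof -
  note G = goodD[OF good]
  note M = lpD[OF lp(1)] and N = lpD[OF lp(2)]
  obtain \<sigma> where \<sigma>: "Aut \<sigma>" "\<And>a b. (a, b) \<in> G \<Longrightarrow> \<sigma> a = b" "\<sigma> ` fst ` G = snd ` G"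
    "\<sigma> ` (P \<inter> fst ` G) = Q \<inter> snd ` G" using good_Aut[OF lp good] by metis
  let ?B = "fst ` G"
  have B: "sm ?B" using G M(2) by (auto intro!: vs_sm)
  have PB: "sm (P \<inter> ?B)" by (rule sm_subset[OF B]) auto
  have X: "sm P1" by (rule sm_subset[OF M(4) P1(1)])
  have "indep ?B (P \<inter> ?B) P" using G(4) by (simp add: P_independent_def)
  then have "indep ?B (P \<inter> ?B) P1" by (rule ind_mono_right[OF _ P1(1) B PB M(4)])
  then have "indep P1 (P \<inter> ?B) ?B" by (rule ind_sym[OF _ B PB X])
  then have "indep (\<sigma> ` P1) (Q \<inter> snd ` G) (snd ` G)"
    using ind_inv[OF _ \<sigma>(1) X PB B] \<sigma>(3,4) by simp
  moreover have "\<sigma> ` P1 \<subseteq> U" using sm_image[OF X \<sigma>(1)] by (simp add: small_def)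
  ultimately obtain \<pi> where \<pi>: "Aut \<pi>" "\<And>a. a \<in> snd ` G \<Longrightarrow> \<pi> a = a" "\<pi> ` \<sigma> ` P1 \<subseteq> Q"
    using density_set[OF lp(2) G(8,10) _ less_kappa_image[OF P1(2)]] by metis
  let ?G = "G \<union> (\<lambda>x. (x, (\<pi> \<circ> \<sigma>) x)) ` P1"
  have "(\<pi> \<circ> \<sigma>) a = b" if "(a, b) \<in> G" for a b using that \<sigma>(2) \<pi>(2) by force
  then have g: "good M P N Q ?G"
    by (intro good_extend_P[OF lp good automorphism_comp[OF \<pi>(1) \<sigma>(1)]] P1) (use \<pi>(3) in auto)
  have f: "fst ` ?G = fst ` G \<union> P1" by (force simp: image_Un image_image)
  show ?thesis by (rule that[OF Un_upper1 g f])
qed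

lemma local_character:
  assumes "finite X" "X \<subseteq> U" "sm B"
  obtains B0 where "B0 \<subseteq> B" "|B0| <o \<kappa>" "indep X B0 B"
proof -
  obtain B0 where "B0 \<subseteq> B" "|B0| <o \<kappa>\<^sub>0" "indep X B0 B"
    using kappa0 assms unfolding is_kappa0_def kappa0_bound_def by metis
  then show ?thesis using that kappa(3) by (meson ordLess_transitive)
qed

text \<open>Local character gives a small base inside \<open>B \<union> P\<close>. Adding all of
  \<open>B\<close> to it is harmless, so only its part in \<open>P\<close> has to be
  remembered.\<close>

lemma indep_over_P_part:
  assumes lp: "lp M P" and "finite X" "X \<subseteq> U" "sm B"
  obtains C where "C \<subseteq> P" "|C| <o \<kappa>" "indep X (B \<union> C) P"
proof -
  note M = lpD[OF lp]
  have BP: "sm (B \<union> P)" by (rule sm_Un[OF assms(4) M(4)])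
  obtain C0 where C0: "C0 \<subseteq> B \<union> P" "|C0| <o \<kappa>" "indep X C0 (B \<union> P)"
    using local_character[OF assms(2,3) BP] .
  have X: "sm X" by (rule finite_sm[OF assms(2,3)])
  have "indep X (B \<union> (C0 \<inter> P)) (B \<union> P)"
    by (rule ind_base_mono[OF C0(3)]) (use C0(1) sm_subset[OF BP] X BP in auto)
  then have "indep X (B \<union> (C0 \<inter> P)) P"
    by (rule ind_mono_right[OF _ _ X _ BP]) (auto intro!: sm_subset[OF BP])
  then show ?thesis using that[of "C0 \<inter> P"] less_kappa_subset[OF C0(2)] by auto
qed

text \<open>A finite set need not be independent from \<open>P\<close> over the domain. A very small
  piece \<open>C\<close> of \<open>P\<close> is added first, by density, after which
  \<open>X\<close> is independent from \<open>P\<close> over the domain and can be copied by the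
  extension property.\<close>

lemma forth:
  assumes lp: "lp M P" "lp N Q" and good: "good M P N Q G" and X: "finite X" "X \<subseteq> M"
  obtains G' where "G \<subseteq> G'" "good M P N Q G'" "X \<subseteq> fst ` G'"
proof -
  note G = goodD[OF good]
  note M = lpD[OF lp(1)] and N = lpD[OF lp(2)]
  have "sm (fst ` G)" using G M(2) by (auto intro!: vs_sm)
  then obtain C where C: "C \<subseteq> P" "|C| <o \<kappa>" "indep X (fst ` G \<union> C) P"
    using indep_over_P_part[OF lp(1) X(1)] X(2) M(2) by blast
  obtain G1 where G1: "G \<subseteq> G1" "good M P N Q G1" "fst ` G1 = fst ` G \<union> C"
    using good_add_P[OF lp good C(1,2)] .
  obtain \<sigma> where \<sigma>: "Aut \<sigma>" "\<And>a b. (a, b) \<in> G1 \<Longrightarrow> \<sigma> a = b"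
    using good_Aut[OF lp G1(2)] by metis
  have "\<sigma> ` X \<subseteq> U" using Aut_in_U[OF \<sigma>(1)] X(2) M(2) by blast
  then obtain \<pi> where \<pi>: "Aut \<pi>" "\<And>a. a \<in> snd ` G1 \<Longrightarrow> \<pi> a = a" "\<pi> ` \<sigma> ` X \<subseteq> N"
    "indep (\<pi> ` \<sigma> ` X) (snd ` G1) Q"
    using extension[OF lp(2) goodD(8,10)[OF G1(2)] finite_imageI[OF X(1)]] by metis
  have "(\<pi> \<circ> \<sigma>) a = b" if "(a, b) \<in> G1" for a b using that \<sigma>(2) \<pi>(2) by force
  then have g: "good M P N Q (G1 \<union> (\<lambda>x. (x, (\<pi> \<circ> \<sigma>) x)) ` X)"
    using \<pi> C(3) X G1(3)
    by (intro good_extend[OF lp G1(2) automorphism_comp[OF \<pi>(1) \<sigma>(1)]])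
      (auto simp: image_comp intro: finite_less_kappa)
  have f: "X \<subseteq> fst ` (G1 \<union> (\<lambda>x. (x, (\<pi> \<circ> \<sigma>) x)) ` X)"
    by (auto simp: image_Un image_image)
  show ?thesis by (rule that[OF le_supI1[OF G1(1)] g f])
qed

lemma sat_elementary:
  assumes "elementary_substruct L \<CC> M" "wf_fm L \<phi>" "e ` fv \<phi> \<subseteq> M"
  shows "sat (substruct \<CC> M) e \<phi> \<longleftrightarrow> sat \<CC> e \<phi>"
proof -
  obtain m where "m \<in> M" using assms(1) by (auto simp: elementary_substruct_def is_struct_def)
  define e' where "e' = (\<lambda>i. if i \<in> fv \<phi> then e i else m)"
  have "range e' \<subseteq> M" using assms(3) \<open>m \<in> M\<close> by (auto simp: e'_def)
  then have "sat (substruct \<CC> M) e' \<phi> \<longleftrightarrow> sat \<CC> e' \<phi>"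
    using assms(1,2) by (simp add: elementary_substruct_def)
  moreover have "sat S e' \<phi> = sat S e \<phi>" for S :: "('a, 'f, 'r) struct"
    by (rule sat_cong) (simp add: e'_def)
  ultimately show ?thesis by simp
qed

lemma forth_back:
  assumes lp: "lp M P" "lp N Q" and good: "good M P N Q G" and X: "finite X" "X \<subseteq> N"
  obtains G' where "G \<subseteq> G'" "good M P N Q G'" "X \<subseteq> snd ` G'"
proof -
  obtain G' where G': "G\<inverse> \<subseteq> G'" "good N Q M P G'" "X \<subseteq> fst ` G'"
    using forth[OF lp(2,1) good_converse[OF good] X] .
  show ?thesis
  proof (rule that)
    show "G \<subseteq> G'\<inverse>" using G'(1) by auto
    show "good M P N Q (G'\<inverse>)" by (rule good_converse[OF G'(2)])
    show "X \<subseteq> snd ` (G'\<inverse>)" using G'(3) by force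
  qed
qed

text \<open>The predicate may be applied to a term whose value is outside the domain of
  \<open>G\<close>. The map is extended to that value, and the formula \<open>x = t\<close>
  identifies the partner of the value as the value of the term on the other side.\<close>

lemma good_term:
  assumes lp: "lp M P" "lp N Q" and good: "good M P N Q G"
    and "wf_trm L t" "e ` vars t \<subseteq> G"
  shows "val \<CC> (fst \<circ> e) t \<in> P \<longleftrightarrow> val \<CC> (snd \<circ> e) t \<in> Q"
proof -
  note M = lpD[OF lp(1)]
  have eM: "(fst \<circ> e) ` vars t \<subseteq> M" using assms(5) goodD(7)[OF good] by (auto simp: image_subset_iff)
  have "val (substruct \<CC> M) (fst \<circ> e) t \<in> univ (substruct \<CC> M)"
    using M(6) assms(4) eM by (intro val_in_univ[of L]) (auto simp: elementary_substruct_def)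
  then have "val \<CC> (fst \<circ> e) t \<in> M" by simp
  then obtain G' where G': "G \<subseteq> G'" "good M P N Q G'" "val \<CC> (fst \<circ> e) t \<in> fst ` G'"
    using forth[OF lp good, of "{val \<CC> (fst \<circ> e) t}"] by auto
  then obtain b where b: "(val \<CC> (fst \<circ> e) t, b) \<in> G'" by auto
  obtain x where x: "x \<notin> vars t" using ex_new_if_finite[OF infinite_UNIV_nat finite_vars] by blast
  let ?e = "e(x := (val \<CC> (fst \<circ> e) t, b))"
  have "sat \<CC> (fst \<circ> ?e) (Equ (Var x) t) \<longleftrightarrow> sat \<CC> (snd \<circ> ?e) (Equ (Var x) t)"
    by (rule erelD[OF goodD(2)[OF G'(2)]]) (use assms(4,5) x b G'(1) in auto)
  moreover have "val \<CC> (fst \<circ> ?e) t = val \<CC> (fst \<circ> e) t" "val \<CC> (snd \<circ> ?e) t = val \<CC> (snd \<circ> e) t"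
    using x by (auto intro!: val_cong)
  ultimately have "b = val \<CC> (snd \<circ> e) t" by simp
  then show ?thesis using goodD(6)[OF G'(2) b] by simp
qed

lemma good_elementary:
  assumes lp: "lp M P" "lp N Q" and good: "good M P N Q G"
  shows "erel (lang2 L) (pair_struct \<CC> M P) (pair_struct \<CC> N Q) G"
  unfolding erel_def
proof (intro allI impI)
  fix \<phi> e assume "wf_fm (lang2 L) \<phi>" "e ` fv \<phi> \<subseteq> G"
  then show "sat (pair_struct \<CC> M P) (fst \<circ> e) \<phi> \<longleftrightarrow> sat (pair_struct \<CC> N Q) (snd \<circ> e) \<phi>"
    using good
  proof (induction \<phi> arbitrary: G e)
    case (Equ s t)
    then have "sat \<CC> (fst \<circ> e) (Equ s t :: ('f, 'r) fm) \<longleftrightarrow> sat \<CC> (snd \<circ> e) (Equ s t :: ('f, 'r) fm)"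
      by (intro erelD[OF goodD(2)[OF Equ(3)]]) auto
    then show ?case unfolding sat.simps val_pair_struct .
  next
    case (Atom R ts)
    have map: "map (val (pair_struct \<CC> M P) (fst \<circ> e)) ts = map (val \<CC> (fst \<circ> e)) ts"
      "map (val (pair_struct \<CC> N Q) (snd \<circ> e)) ts = map (val \<CC> (snd \<circ> e)) ts" by simp_all
    show ?case
    proof (cases R)
      case None
      then obtain t where t: "ts = [t]" using Atom by (auto simp: length_Suc_conv)
      have "val \<CC> (fst \<circ> e) t \<in> P \<longleftrightarrow> val \<CC> (snd \<circ> e) t \<in> Q"
        by (rule good_term[OF lp Atom(3)]) (use t Atom(1,2) in auto)
      moreover have "rel_int (pair_struct \<CC> M P) None xs \<longleftrightarrow> set xs \<subseteq> P"
        "rel_int (pair_struct \<CC> N Q) None xs \<longleftrightarrow> set xs \<subseteq> Q" for xs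
        by (simp_all add: pair_struct_def)
      ultimately show ?thesis unfolding sat.simps t None list.map val_pair_struct by simp
    next
      case (Some R')
      then have "sat \<CC> (fst \<circ> e) (Atom R' ts) \<longleftrightarrow> sat \<CC> (snd \<circ> e) (Atom R' ts)"
        using Atom by (intro erelD[OF goodD(2)[OF Atom(3)]]) (auto simp: list_all_iff)
      then show ?thesis unfolding sat.simps map Some by (simp add: pair_struct_def)
    qed
  next
    case (Imp \<phi> \<psi>)
    have "sat (pair_struct \<CC> M P) (fst \<circ> e) \<phi> \<longleftrightarrow> sat (pair_struct \<CC> N Q) (snd \<circ> e) \<phi>"
      by (rule Imp.IH(1)[OF _ _ Imp.prems(3)]) (use Imp.prems in auto)
    moreover have "sat (pair_struct \<CC> M P) (fst \<circ> e) \<psi> \<longleftrightarrow> sat (pair_struct \<CC> N Q) (snd \<circ> e) \<psi>"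
      by (rule Imp.IH(2)[OF _ _ Imp.prems(3)]) (use Imp.prems in auto)
    ultimately show ?case unfolding sat.simps by simp
  next
    case (All x \<phi>)
    have upd: "fst \<circ> e(x := (a, b)) = (fst \<circ> e)(x := a)" "snd \<circ> e(x := (a, b)) = (snd \<circ> e)(x := b)" for a b
      by auto
    have *: "sat (pair_struct \<CC> M P) ((fst \<circ> e)(x := a)) \<phi> \<longleftrightarrow> sat (pair_struct \<CC> N Q) ((snd \<circ> e)(x := b)) \<phi>"
      if "G \<subseteq> G'" "good M P N Q G'" "(a, b) \<in> G'" for G' a b
    proof -
      have "sat (pair_struct \<CC> M P) (fst \<circ> e(x := (a, b))) \<phi> \<longleftrightarrow>
          sat (pair_struct \<CC> N Q) (snd \<circ> e(x := (a, b))) \<phi>"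
        by (rule All.IH[OF _ _ that(2)]) (use All.prems(1,2) that in auto)
      then show ?thesis unfolding upd .
    qed
    show ?case
    proof
      assume l: "sat (pair_struct \<CC> M P) (fst \<circ> e) (All x \<phi>)"
      have "sat (pair_struct \<CC> N Q) ((snd \<circ> e)(x := b)) \<phi>" if b: "b \<in> N" for b
      proof -
        obtain G' where G': "G \<subseteq> G'" "good M P N Q G'" "{b} \<subseteq> snd ` G'"
          using forth_back[OF lp All.prems(3), of "{b}"] b by auto
        then obtain a where "(a, b) \<in> G'" by auto
        then show ?thesis using *[OF G'(1,2)] l goodD(1)[OF G'(2)] by auto
      qed
      then show "sat (pair_struct \<CC> N Q) (snd \<circ> e) (All x \<phi>)" by simp
    next
      assume r: "sat (pair_struct \<CC> N Q) (snd \<circ> e) (All x \<phi>)"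
      have "sat (pair_struct \<CC> M P) ((fst \<circ> e)(x := a)) \<phi>" if a: "a \<in> M" for a
      proof -
        obtain G' where G': "G \<subseteq> G'" "good M P N Q G'" "{a} \<subseteq> fst ` G'"
          using forth[OF lp All.prems(3), of "{a}"] a by auto
        then obtain b where "(a, b) \<in> G'" by auto
        then show ?thesis using *[OF G'(1,2)] r goodD(1)[OF G'(2)] by auto
      qed
      then show "sat (pair_struct \<CC> M P) (fst \<circ> e) (All x \<phi>)" by simp
    qed
  qed simp
qed

end

subsection \<open>The type of a tuple determines the value\<close>

definition frame :: "'a list \<Rightarrow> (nat \<Rightarrow> 'a) \<Rightarrow> nat \<Rightarrow> 'a" where
  "frame d b i = (if i < length d then d ! i else b (i - length d))"

lemma frame_comp: "h \<circ> frame d b = frame (map h d) (h \<circ> b)"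
  by (auto simp: frame_def)

context monster begin

lemma good_Id:
  assumes "lp N Q" "B \<subseteq> N" "|B| <o \<kappa>" "P_independent indep Q B"
  shows "good N Q N Q (Id_on B)"
  unfolding good_def
proof (intro conjI)
  have f: "fst ` Id_on B = B" "snd ` Id_on B = B" by (force simp: Id_on_def)+
  show "P_independent indep Q (fst ` Id_on B)" "P_independent indep Q (snd ` Id_on B)"
    using assms(4) by (simp_all only: f)
  have "Id_on B = (\<lambda>x. (x, x)) ` B" by auto
  then show "|Id_on B| <o \<kappa>" using assms(3) by (simp add: less_kappa_image)
  show "erel L \<CC> \<CC> (Id_on B)"
    by (rule erel_automorphism[OF automorphism_id struct lpD(2)[OF assms(1)]]) (use assms(2) in auto)
qed (use assms(2) in auto)

end

text \<open>The first \<open>k\<close> variables of \<open>\<phi>\<close> stand for the value, the others for arguments and parameters.\<close>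

locale imaginary_valued = monster L T \<CC> indep \<mu> \<kappa>\<^sub>0 \<kappa>
  for L :: "('f, 'r) lang" and T and \<CC> :: "('a, 'f, 'r) struct" and indep
    and \<mu> \<kappa>\<^sub>0 \<kappa> :: "'k rel" +
  fixes N Q :: "'a set" and \<phi> :: "('f, 'r option) fm" and k :: nat
    and E :: "'a list \<Rightarrow> 'a list \<Rightarrow> bool"
  assumes lp: "lovely_pair L \<mu> \<CC> indep \<kappa> N Q"
    and wf: "wf_fm (lang2 L) \<phi>"
    and E_Aut: "\<And>\<sigma> u v. automorphism L \<CC> \<sigma> \<Longrightarrow> u \<in> tuples k (univ \<CC>) \<Longrightarrow> v \<in> tuples k (univ \<CC>) \<Longrightarrow>
      E (map \<sigma> u) (map \<sigma> v) \<longleftrightarrow> E u v"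
    and E_sym: "\<And>u v. u \<in> tuples k (univ \<CC>) \<Longrightarrow> v \<in> tuples k (univ \<CC>) \<Longrightarrow> E u v \<Longrightarrow> E v u"
    and E_trans: "\<And>u v w. u \<in> tuples k (univ \<CC>) \<Longrightarrow> v \<in> tuples k (univ \<CC>) \<Longrightarrow> w \<in> tuples k (univ \<CC>) \<Longrightarrow>
      E u v \<Longrightarrow> E v w \<Longrightarrow> E u w"
begin

definition Phi :: "(nat \<Rightarrow> 'a) \<Rightarrow> 'a list \<Rightarrow> bool" where
  "Phi b d \<longleftrightarrow> sat (pair_struct \<CC> N Q) (frame d b) \<phi>"

definition J :: "nat set" where "J = {j. j + k \<in> fv \<phi>}"

definition single_valued_at :: "(nat \<Rightarrow> 'a) \<Rightarrow> bool" where
  "single_valued_at b \<longleftrightarrow> (\<forall>d\<in>tuples k N. \<forall>d'\<in>tuples k N. Phi b d \<longrightarrow> Phi b d' \<longleftrightarrow> E d d')"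

lemma finite_J: "finite J"
  unfolding J_def using finite_vimageI[OF finite_fv[of \<phi>], of "\<lambda>j. j + k"] by (simp add: vimage_def)

lemmas N = lpD[OF lp]

lemma tuples_N_U: "d \<in> tuples k N \<Longrightarrow> d \<in> tuples k U"
  using N(2) by (auto simp: tuples_def)

lemma tuples_map_U: "Aut \<sigma> \<Longrightarrow> d \<in> tuples k U \<Longrightarrow> map \<sigma> d \<in> tuples k U"
  using Aut_in_U by (auto simp: tuples_def)

lemma Phi_good:
  assumes "good N Q N Q G" "\<And>j. j \<in> J \<Longrightarrow> (b j, b' j) \<in> G"
    and "length d = k" "\<And>x. x \<in> set d \<Longrightarrow> (x, \<sigma> x) \<in> G"
  shows "Phi b d \<longleftrightarrow> Phi b' (map \<sigma> d)"
proof -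
  let ?e = "\<lambda>i. (frame d b i, frame (map \<sigma> d) b' i)"
  have "?e i \<in> G" if i: "i \<in> fv \<phi>" for i
  proof (cases "i < k")
    case True
    then show ?thesis using assms(3,4) by (simp add: frame_def)
  next
    case False
    then have "i - k \<in> J" using i by (simp add: J_def)
    then show ?thesis using False assms(2,3) by (simp add: frame_def)
  qed
  then have "?e ` fv \<phi> \<subseteq> G" by blast
  then show ?thesis
    using erelD[OF good_elementary[OF lp lp assms(1)] wf, of ?e] by (simp add: Phi_def comp_def)
qed

text \<open>The conjugate \<open>map \<pi> d\<close> may lie outside \<open>N\<close>, so it is
  brought into \<open>N\<close> together with \<open>d\<close>, by some \<rho> fixing
  \<open>B\<close>, with independence from \<open>Q\<close> over \<open>B\<close>. Both images then
  have the type of \<open>d\<close> in the language of pairs over \<open>B\<close>, hence satisfy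
  \<open>Phi b\<close> and are equivalent; \<rho> is cancelled at the end.\<close>

lemma class_fixed_indep:
  assumes B: "B \<subseteq> N" "|B| <o \<kappa>" "P_independent indep Q B" "b ` J \<subseteq> B" "single_valued_at b"
    and d: "d \<in> tuples k N" "Phi b d" "indep (set d) B Q"
    and \<pi>: "Aut \<pi>" "\<And>a. a \<in> B \<Longrightarrow> \<pi> a = a"
  shows "E d (map \<pi> d)"
proof -
  have dU: "d \<in> tuples k U" "map \<pi> d \<in> tuples k U" using tuples_N_U d(1) tuples_map_U \<pi>(1) by auto
  have smB: "sm B" using B N(2) by (intro vs_sm) auto
  have "finite (set d \<union> \<pi> ` set d)" "set d \<union> \<pi> ` set d \<subseteq> U" using dU by (auto simp: tuples_def)
  then obtain \<rho> where \<rho>: "Aut \<rho>" "\<And>a. a \<in> B \<Longrightarrow> \<rho> a = a" "\<rho> ` (set d \<union> \<pi> ` set d) \<subseteq> N"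
    "indep (\<rho> ` (set d \<union> \<pi> ` set d)) B Q" using extension[OF lp B(1,2)] by metis
  have G0: "good N Q N Q (Id_on B)" by (rule good_Id[OF lp B(1-3)])
  have f: "fst ` Id_on B = B" "snd ` Id_on B = B" by (force simp: Id_on_def)+
  have smX: "sm (\<rho> ` (set d \<union> \<pi> ` set d))"
    using \<rho>(3) N(2) by (intro finite_sm) auto
  have *: "Phi b (map \<sigma> d)" if \<sigma>: "Aut \<sigma>" "\<And>a. a \<in> B \<Longrightarrow> \<sigma> a = a" "\<sigma> ` set d \<subseteq> \<rho> ` (set d \<union> \<pi> ` set d)" for \<sigma>
  proof -
    have "good N Q N Q (Id_on B \<union> (\<lambda>x. (x, \<sigma> x)) ` set d)"
    proof (rule good_extend[OF lp lp G0 \<sigma>(1)], unfold f)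
      show "indep (\<sigma> ` set d) B Q" by (rule ind_mono_left[OF \<rho>(4) \<sigma>(3) smX smB N(4)])
      show "\<sigma> ` set d \<subseteq> N" using \<sigma>(3) \<rho>(3) by blast
    qed (use d \<sigma>(2) in \<open>auto simp: tuples_def finite_less_kappa\<close>)
    then show ?thesis
      using Phi_good[of "Id_on B \<union> (\<lambda>x. (x, \<sigma> x)) ` set d" b b d \<sigma>] d B(4) by (auto simp: tuples_def)
  qed
  have 1: "Phi b (map \<rho> d)" by (rule *) (use \<rho> in auto)
  have 2: "Phi b (map (\<rho> \<circ> \<pi>) d)"
    by (rule *) (use \<rho> \<pi> automorphism_comp[OF \<rho>(1) \<pi>(1)] in \<open>auto simp: comp_def\<close>)
  have "map \<rho> d \<in> tuples k N" "map (\<rho> \<circ> \<pi>) d \<in> tuples k N"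
    using \<rho>(3) d(1) by (auto simp: tuples_def)
  then have "E (map \<rho> d) (map (\<rho> \<circ> \<pi>) d)" using B(5) 1 2 unfolding single_valued_at_def by blast
  then have "E (map \<rho> d) (map \<rho> (map \<pi> d))" by simp
  then show ?thesis using E_Aut[OF \<rho>(1) dU] by simp
qed

lemma E_cancel:
  "Aut \<sigma> \<Longrightarrow> u \<in> tuples k U \<Longrightarrow> v \<in> tuples k U \<Longrightarrow> E (map \<sigma> u) (map \<sigma> v) \<Longrightarrow> E u v"
  using E_Aut by blast

context
  fixes B C b d
  assumes B: "B \<subseteq> N" "|B| <o \<kappa>" "P_independent indep Q B" "b ` J \<subseteq> B" "single_valued_at b"
    and C: "C \<subseteq> Q" "|C| <o \<kappa>"
    and d: "d \<in> tuples k N" "Phi b d" "indep (set d) (B \<union> C) Q"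
begin

private lemma smB: "sm B" using B N(2) by (intro vs_sm) auto
private lemma smC: "sm C" by (rule sm_subset[OF N(4) C(1)])
private lemma BC: "B \<union> C \<subseteq> N" "|B \<union> C| <o \<kappa>" "P_independent indep Q (B \<union> C)"
  using B C N(3) less_kappa_Un P_independent_Un_P[OF lp B(3) smB C(1)] by auto
private lemma dU: "d \<in> tuples k U" using tuples_N_U d(1) .

private lemma class_moved_into_P:
  assumes \<sigma>: "Aut \<sigma>" "\<And>a. a \<in> B \<Longrightarrow> \<sigma> a = a" "\<sigma> ` C \<subseteq> Q"
  shows "E d (map \<sigma> d)"
proof -
  let ?G = "Id_on B \<union> (\<lambda>x. (x, \<sigma> x)) ` C"
  have G: "good N Q N Q ?G"
    by (rule good_extend_P[OF lp lp good_Id[OF lp B(1-3)] \<sigma>(1) _ C \<sigma>(3)]) (use \<sigma>(2) in auto)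
  have f: "fst ` ?G = B \<union> C" "snd ` ?G = B \<union> \<sigma> ` C" by (force simp: Id_on_def)+
  have \<sigma>d: "map \<sigma> d \<in> tuples k U" using tuples_map_U[OF \<sigma>(1) dU] .
  then have "\<sigma> ` set d \<subseteq> U" by (auto simp: tuples_def)
  then obtain \<rho> where \<rho>: "Aut \<rho>" "\<And>a. a \<in> B \<union> \<sigma> ` C \<Longrightarrow> \<rho> a = a" "\<rho> ` \<sigma> ` set d \<subseteq> N"
    "indep (\<rho> ` \<sigma> ` set d) (B \<union> \<sigma> ` C) Q"
    using extension[OF lp goodD(8,10)[OF G] finite_imageI[OF finite_set]] unfolding f by metis
  let ?d = "map (\<rho> \<circ> \<sigma>) d"
  have \<rho>\<sigma>: "Aut (\<rho> \<circ> \<sigma>)" by (rule automorphism_comp[OF \<rho>(1) \<sigma>(1)])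
  have "good N Q N Q (?G \<union> (\<lambda>x. (x, (\<rho> \<circ> \<sigma>) x)) ` set d)"
  proof (rule good_extend[OF lp lp G \<rho>\<sigma>], unfold f)
    show "(\<rho> \<circ> \<sigma>) x = y" if "(x, y) \<in> ?G" for x y using that \<sigma>(2) \<rho>(2) by auto
    show "indep ((\<rho> \<circ> \<sigma>) ` set d) (B \<union> \<sigma> ` C) Q" using \<rho>(4) by (simp add: image_comp)
    show "(\<rho> \<circ> \<sigma>) ` set d \<subseteq> N" using \<rho>(3) by (simp add: image_comp)
  qed (use d in \<open>auto simp: tuples_def finite_less_kappa\<close>)
  then have Phi: "Phi b ?d"
    using Phi_good[of "?G \<union> (\<lambda>x. (x, (\<rho> \<circ> \<sigma>) x)) ` set d" b b d "\<rho> \<circ> \<sigma>"] d B(4) by (auto simp: tuples_def)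
  have dN: "?d \<in> tuples k N" using d(1) \<rho>(3) by (auto simp: tuples_def)
  then have 1: "E d ?d" using B(5) Phi d unfolding single_valued_at_def by blast
  obtain \<tau> where \<tau>: "Aut \<tau>" "\<And>x. x \<in> U \<Longrightarrow> \<tau> (\<rho> x) = x" using Aut_inverse[OF \<rho>(1)] by metis
  have "E ?d (map \<tau> ?d)"
  proof (rule class_fixed_indep[OF goodD(8,10,5)[OF G, unfolded f] _ B(5) dN Phi _ \<tau>(1)])
    show "b ` J \<subseteq> B \<union> \<sigma> ` C" using B(4) by auto
    show "indep (set ?d) (B \<union> \<sigma> ` C) Q" using \<rho>(4) by (simp add: image_comp)
    fix a assume a: "a \<in> B \<union> \<sigma> ` C"
    then have "a \<in> U" using goodD(8)[OF G, unfolded f] N(2) by auto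
    then show "\<tau> a = a" using \<tau>(2) \<rho>(2)[OF a] by metis
  qed
  moreover have "map \<tau> ?d = map \<sigma> d" using \<tau>(2) \<sigma>d by (auto simp: tuples_def)
  ultimately have "E ?d (map \<sigma> d)" by (simp only:)
  then show ?thesis by (rule E_trans[OF dU tuples_N_U[OF dN] \<sigma>d 1])
qed

private lemma class_moved_indep:
  assumes \<rho>: "Aut \<rho>" "\<And>a. a \<in> B \<Longrightarrow> \<rho> a = a" "indep (\<rho> ` C) B C"
  shows "E d (map \<rho> d)"
proof -
  let ?Z = "\<rho> ` C" and ?D = "B \<union> C"
  have smZ: "sm ?Z" by (rule sm_image[OF smC \<rho>(1)])
  have smQB: "sm (Q \<inter> B)" by (rule sm_subset[OF smB]) auto
  have smD: "sm ?D" by (rule sm_Un[OF smB smC])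
  have "indep B (Q \<inter> B) Q" using B(3) by (simp add: P_independent_def)
  then have "indep B (Q \<inter> B) C" by (rule ind_mono_right[OF _ C(1) smB smQB N(4)])
  \<comment> \<open>P-independence of \<open>B\<close> gives independence of \<open>C\<close> from
    \<open>B\<close> over \<open>Q \<inter> B\<close>; conjugating by \<rho> preserves it, because
    \<rho> fixes \<open>B\<close>.\<close>
  then have "indep C (Q \<inter> B) B" by (rule ind_sym[OF _ smB smQB smC])
  then have "indep ?Z (\<rho> ` (Q \<inter> B)) (\<rho> ` B)" by (rule ind_inv[OF _ \<rho>(1) smC smQB smB])
  moreover have "\<rho> ` (Q \<inter> B) = (\<lambda>x. x) ` (Q \<inter> B)" "\<rho> ` B = (\<lambda>x. x) ` B"
    by (rule image_cong; use \<rho>(2) in auto)+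
  ultimately have 1: "indep ?Z (Q \<inter> B) B" by simp
  have "Q \<inter> B \<union> B = B" by auto
  then have "indep ?Z (Q \<inter> B) ?D" using \<rho>(3) by (intro ind_chain_right[OF 1] smB smC smQB smZ) simp
  then have "indep ?Z (Q \<inter> ?D) ?D" by (rule ind_base_mono[OF _ _ _ smZ smQB smD]) auto
  moreover have "?Z \<subseteq> U" using smZ by (simp add: small_def)
  ultimately obtain \<pi> where \<pi>: "Aut \<pi>" "\<And>a. a \<in> ?D \<Longrightarrow> \<pi> a = a" "\<pi> ` ?Z \<subseteq> Q"
    using density_set[OF lp BC(1,2) _ less_kappa_image[OF C(2)]] by metis
  have 2: "E d (map (\<pi> \<circ> \<rho>) d)"
    by (rule class_moved_into_P[OF automorphism_comp[OF \<pi>(1) \<rho>(1)]]) (use \<rho>(2) \<pi>(2,3) in auto)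
  have 3: "E d (map \<pi> d)"
    by (rule class_fixed_indep[OF BC _ B(5) d \<pi>(1,2)]) (use B(4) in auto)
  have U: "map \<rho> d \<in> tuples k U" "map \<pi> d \<in> tuples k U" "map (\<pi> \<circ> \<rho>) d \<in> tuples k U"
    by (auto intro!: tuples_map_U dU \<rho>(1) \<pi>(1) automorphism_comp)
  have "E (map \<pi> d) (map \<pi> (map \<rho> d))"
    using E_trans[OF U(2) dU U(3) E_sym[OF dU U(2) 3] 2] by simp
  then show ?thesis by (rule E_cancel[OF \<pi>(1) dU U(1)])
qed

text \<open>A third copy \<open>\<rho>\<close>
  C\<open>, independent over\<close>B\<open>from both\<close>C\<open>and\<close>\<sigma>
  \<open>C\<close>, links \<open>d\<close> with \<open>map \<sigma> d\<close>: each of the two is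
  equivalent to \<open>map \<rho> d\<close>, the second one after conjugating back by the inverse
  \<tau> of \<sigma>.\<close>

lemma class_fixed:
  assumes \<sigma>: "Aut \<sigma>" "\<And>a. a \<in> B \<Longrightarrow> \<sigma> a = a"
  shows "E d (map \<sigma> d)"
proof -
  have sm\<sigma>C: "sm (\<sigma> ` C)" by (rule sm_image[OF smC \<sigma>(1)])
  have smCC: "sm (C \<union> \<sigma> ` C)" by (rule sm_Un[OF smC sm\<sigma>C])
  obtain \<rho> where \<rho>: "Aut \<rho>" "\<And>a. a \<in> B \<Longrightarrow> \<rho> a = a" "indep (\<rho> ` C) B (C \<union> \<sigma> ` C)"
    using Aut_indep[OF smC smB smCC] by metis
  have sm\<rho>C: "sm (\<rho> ` C)" by (rule sm_image[OF smC \<rho>(1)])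
  have 1: "indep (\<rho> ` C) B C" "indep (\<rho> ` C) B (\<sigma> ` C)"
    by (rule ind_mono_right[OF \<rho>(3) _ sm\<rho>C smB smCC]; simp)+
  have 2: "E d (map \<rho> d)" by (rule class_moved_indep[OF \<rho>(1,2) 1(1)])
  obtain \<tau> where \<tau>: "Aut \<tau>" "\<And>x. x \<in> U \<Longrightarrow> \<tau> (\<sigma> x) = x" "\<And>x. x \<in> U \<Longrightarrow> \<sigma> (\<tau> x) = x"
    using Aut_inverse[OF \<sigma>(1)] by metis
  have fixB: "\<tau> a = a" if "a \<in> B" for a using that \<sigma>(2) \<tau>(2) smB by (metis small_def subsetD)
  have "indep (\<tau> ` \<rho> ` C) (\<tau> ` B) (\<tau> ` \<sigma> ` C)" by (rule ind_inv[OF 1(2) \<tau>(1) sm\<rho>C smB sm\<sigma>C])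
  moreover have "\<tau> ` B = (\<lambda>x. x) ` B" by (rule image_cong) (use fixB in auto)
  moreover have "(\<lambda>x. \<tau> (\<sigma> x)) ` C = (\<lambda>x. x) ` C"
    by (rule image_cong) (use \<tau>(2) smC in \<open>auto simp: small_def\<close>)
  ultimately have "indep ((\<tau> \<circ> \<rho>) ` C) B C" by (simp add: image_comp image_image)
  then have 3: "E d (map (\<tau> \<circ> \<rho>) d)"
    by (intro class_moved_indep automorphism_comp[OF \<tau>(1) \<rho>(1)]) (use fixB \<rho>(2) in auto)
  have U: "map \<rho> d \<in> tuples k U" "map \<sigma> d \<in> tuples k U" "map (\<tau> \<circ> \<rho>) d \<in> tuples k U"
    by (auto intro!: tuples_map_U dU \<rho>(1) \<sigma>(1) \<tau>(1) automorphism_comp)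
  have "map \<sigma> (map (\<tau> \<circ> \<rho>) d) = map \<rho> d"
    using \<tau>(3) U(1) by (auto simp: tuples_def)
  then have "E (map \<sigma> d) (map \<rho> d)" using E_Aut[OF \<sigma>(1) dU U(3)] 3 by metis
  then show ?thesis using E_trans[OF dU U(1,2) 2] E_sym[OF U(2,1)] by simp
qed

end

text \<open>An automorphism \<sigma> realizing the equality of \<L>-types need not respect
  \<open>Q\<close> on \<open>d\<close>, but it is good on \<open>A\<close> and on the entries of
  \<open>b\<close> in \<open>Q\<close>. Going forth to \<open>d\<close> gives another image
  \<open>map \<tau> d\<close> that does satisfy \<open>Phi b'\<close>. It differs from
  \<open>d'\<close> by an automorphism fixing the range of the good map, so
  \<open>class_fixed\<close> shows the two to be equivalent.\<close>

lemma type_determines: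
  assumes A: "A \<subseteq> N" "|A| <o \<kappa>" "P_independent indep Q A"
    and b: "\<And>j. j \<in> J \<Longrightarrow> b j \<in> Q \<and> b' j \<in> Q \<or> b j \<in> A \<and> b' j = b j"
    and sv: "single_valued_at b" "single_valued_at b'"
    and d: "d \<in> tuples k N" "d' \<in> tuples k N"
    and er: "erel L \<CC> \<CC> (Id_on A \<union> (\<lambda>j. (b j, b' j)) ` J \<union> (\<lambda>i. (d ! i, d' ! i)) ` {..<k})"
    and Phi: "Phi b d"
  shows "Phi b' d'"
proof -
  let ?R = "Id_on A \<union> (\<lambda>j. (b j, b' j)) ` J \<union> (\<lambda>i. (d ! i, d' ! i)) ` {..<k}"
  have RU: "?R \<subseteq> U \<times> U"
  proof -
    have "d ! i \<in> N" "d' ! i \<in> N" if "i < k" for i using d that by (auto simp: tuples_def)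
    moreover have "b j \<in> N \<and> b' j \<in> N" if "j \<in> J" for j using b[OF that] A(1) N(3) by auto
    ultimately show ?thesis using A(1) N(2) by auto
  qed
  have "Id_on A = (\<lambda>x. (x, x)) ` A" by auto
  then have "|Id_on A| <o \<kappa>" using less_kappa_image[OF A(2)] by simp
  then have "|?R| <o \<kappa>"
    using finite_J by (intro less_kappa_Un) (auto intro: finite_less_kappa)
  then obtain \<sigma> where \<sigma>: "Aut \<sigma>" "\<And>x y. (x, y) \<in> ?R \<Longrightarrow> \<sigma> x = y"
    using extends_to_Aut[OF er RU ordLess_transitive[OF _ kappa(2)]] by metis
  define X where "X = {b j |j. j \<in> J \<and> b j \<in> Q \<and> b' j \<in> Q}"
  have "X \<subseteq> b ` J" by (auto simp: X_def)
  then have finX: "finite X" using finite_J finite_surj by blast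
  have \<sigma>b: "\<sigma> (b j) = b' j" if "j \<in> J" for j by (rule \<sigma>(2)) (use that in auto)
  have \<sigma>d: "map \<sigma> d = d'"
    by (rule nth_equalityI) (use d \<sigma>(2) in \<open>auto simp: tuples_def\<close>)
  let ?G0 = "Id_on A \<union> (\<lambda>x. (x, \<sigma> x)) ` X"
  have "X \<subseteq> Q" "\<sigma> ` X \<subseteq> Q" using \<sigma>b by (auto simp: X_def)
  then have G0: "good N Q N Q ?G0"
    by (intro good_extend_P[OF lp lp good_Id[OF lp A] \<sigma>(1)] finite_less_kappa finX) (use \<sigma>(2) in auto)
  have bG: "(b j, b' j) \<in> ?G0" if "j \<in> J" for j using b[OF that] \<sigma>b[OF that] that by (auto simp: X_def)
  have \<sigma>G: "\<sigma> x = y" if "(x, y) \<in> ?G0" for x y using that \<sigma>(2)[of x y] by auto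
  have "set d \<subseteq> N" using d by (simp add: tuples_def)
  then obtain G where G: "?G0 \<subseteq> G" "good N Q N Q G" "set d \<subseteq> fst ` G"
    using forth[OF lp lp G0 finite_set] by metis
  obtain \<tau> where \<tau>: "Aut \<tau>" "\<And>x y. (x, y) \<in> G \<Longrightarrow> \<tau> x = y" using good_Aut[OF lp lp G(2)] by metis
  have dG: "(x, \<tau> x) \<in> G" if "x \<in> set d" for x
  proof -
    have "x \<in> fst ` G" using that G(3) by blast
    then obtain y where "(x, y) \<in> G" by auto
    then show ?thesis using \<tau>(2) by auto
  qed
  let ?u = "map \<tau> d"
  have "Phi b d \<longleftrightarrow> Phi b' ?u"
  proof (rule Phi_good[OF G(2)])
    show "(b j, b' j) \<in> G" if "j \<in> J" for j using bG[OF that] G(1) by (rule subsetD[rotated])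
    show "length d = k" using d(1) by (simp add: tuples_def)
  qed (rule dG)
  then have Phiu: "Phi b' ?u" using Phi by simp
  have "\<tau> x \<in> N" if "x \<in> set d" for x using dG[OF that] goodD(1)[OF G(2)] by auto
  then have uN: "?u \<in> tuples k N" using d by (auto simp: tuples_def)
  let ?B = "snd ` ?G0"
  have "sm ?B" using goodD(8,10)[OF G0] N(2) by (intro vs_sm) auto
  moreover have "set ?u \<subseteq> U" using uN N(2) by (auto simp: tuples_def)
  ultimately obtain C where C: "C \<subseteq> Q" "|C| <o \<kappa>" "indep (set ?u) (?B \<union> C) Q"
    using indep_over_P_part[OF lp finite_set] by metis
  obtain \<tau>' where \<tau>': "Aut \<tau>'" "\<And>x. x \<in> U \<Longrightarrow> \<tau>' (\<tau> x) = x" using Aut_inverse[OF \<tau>(1)] by metis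
  have "E ?u (map (\<sigma> \<circ> \<tau>') ?u)"
  proof (rule class_fixed[OF goodD(8,10,5)[OF G0] _ sv(2) C(1,2) uN Phiu C(3)])
    show "b' ` J \<subseteq> ?B"
    proof (rule image_subsetI)
      fix j assume "j \<in> J"
      from imageI[OF bG[OF this], of snd] show "b' j \<in> ?B" by (simp only: snd_conv)
    qed
    show "Aut (\<sigma> \<circ> \<tau>')" by (rule automorphism_comp[OF \<sigma>(1) \<tau>'(1)])
    fix y assume "y \<in> ?B"
    then obtain p where "p \<in> ?G0" "y = snd p" by (rule imageE)
    then obtain x where xy: "(x, y) \<in> ?G0" by (metis prod.collapse)
    have "\<tau> x = y" by (rule \<tau>(2)[OF subsetD[OF G(1) xy]])
    moreover have "\<sigma> x = y" by (rule \<sigma>G[OF xy])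
    moreover have "x \<in> U" using subsetD[OF goodD(1)[OF G0] xy] N(2) by auto
    ultimately show "(\<sigma> \<circ> \<tau>') y = y" using \<tau>'(2) by auto
  qed
  moreover have "map (\<sigma> \<circ> \<tau>') ?u = d'"
  proof -
    have "\<tau>' (\<tau> x) = x" if "x \<in> set d" for x using that \<tau>'(2) \<open>set d \<subseteq> N\<close> N(2) by auto
    then have "map (\<sigma> \<circ> \<tau>') ?u = map \<sigma> d" by simp
    then show ?thesis using \<sigma>d by simp
  qed
  ultimately have "E ?u d'" by simp
  then show ?thesis using sv(2) uN d(2) Phiu unfolding single_valued_at_def by blast
qed

end

subsection \<open>A saturated description over new constants\<close>

text \<open>Stated for abstract worlds because it is used twice: with assignments of constants as
  worlds, to complete a description, and with elements of a structure as worlds, to complete a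
  partial 1-type.\<close>

lemma lindenbaum:
  fixes holds :: "'w \<Rightarrow> 'x \<Rightarrow> bool"
  assumes neg: "\<And>x. x \<in> F \<Longrightarrow> n x \<in> F" "\<And>x w. x \<in> F \<Longrightarrow> w \<in> \<Omega> \<Longrightarrow> holds w (n x) \<longleftrightarrow> \<not> holds w x"
    and p: "p \<subseteq> F" "\<And>p0. p0 \<subseteq> p \<Longrightarrow> finite p0 \<Longrightarrow> \<exists>w\<in>\<Omega>. \<forall>x\<in>p0. holds w x"
  obtains q where "p \<subseteq> q" "q \<subseteq> F" "\<And>q0. q0 \<subseteq> q \<Longrightarrow> finite q0 \<Longrightarrow> \<exists>w\<in>\<Omega>. \<forall>x\<in>q0. holds w x"
    "\<And>x. x \<in> F \<Longrightarrow> x \<in> q \<or> n x \<in> q"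
proof -
  define fs where "fs = (\<lambda>q. \<forall>q0\<subseteq>q. finite q0 \<longrightarrow> (\<exists>w\<in>\<Omega>. \<forall>x\<in>q0. holds w x))"
  define \<Z> where "\<Z> = {q. p \<subseteq> q \<and> q \<subseteq> F \<and> fs q}"
  have "p \<in> \<Z>" using p by (auto simp: \<Z>_def fs_def)
  moreover have "\<Union>\<C> \<in> \<Z>" if C: "\<C> \<noteq> {}" "subset.chain \<Z> \<C>" for \<C>
  proof -
    have sub: "\<And>q. q \<in> \<C> \<Longrightarrow> p \<subseteq> q \<and> q \<subseteq> F \<and> fs q" using C(2) by (auto simp: subset_chain_def \<Z>_def)
    have "fs (\<Union>\<C>)" unfolding fs_def
    proof (intro allI impI)
      fix q0 assume "q0 \<subseteq> \<Union>\<C>" "finite q0"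
      then obtain q where "q \<in> \<C>" "q0 \<subseteq> q" using finite_subset_Union_chain[OF _ _ C] by metis
      then show "\<exists>w\<in>\<Omega>. \<forall>x\<in>q0. holds w x" using sub[of q] \<open>finite q0\<close> by (auto simp: fs_def)
    qed
    then show ?thesis using sub C(1) by (auto simp: \<Z>_def)
  qed
  ultimately obtain q where q: "q \<in> \<Z>" "\<And>X. X \<in> \<Z> \<Longrightarrow> q \<subseteq> X \<Longrightarrow> X = q"
    using subset_Zorn_nonempty[of \<Z>] by blast
  have q': "p \<subseteq> q" "q \<subseteq> F" "fs q" using q(1) by (auto simp: \<Z>_def)
  have "x \<in> q \<or> n x \<in> q" if x: "x \<in> F" for x
  proof (rule ccontr)
    assume *: "\<not> (x \<in> q \<or> n x \<in> q)"
    have "\<exists>q0\<subseteq>q. finite q0 \<and> \<not> (\<exists>w\<in>\<Omega>. holds w y \<and> (\<forall>x\<in>q0. holds w x))" if y: "y \<in> F" "y \<notin> q" for y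
    proof (rule ccontr)
      assume **: "\<not> ?thesis"
      have "fs (insert y q)" unfolding fs_def
      proof (intro allI impI)
        fix q0 assume "q0 \<subseteq> insert y q" "finite q0"
        then have "q0 - {y} \<subseteq> q" "finite (q0 - {y})" by auto
        then obtain w where "w \<in> \<Omega>" "holds w y" "\<forall>x\<in>q0 - {y}. holds w x" using ** by blast
        then show "\<exists>w\<in>\<Omega>. \<forall>x\<in>q0. holds w x" by blast
      qed
      then have "insert y q \<in> \<Z>" using q' y by (auto simp: \<Z>_def)
      then show False using q(2) y(2) by blast
    qed
    then obtain q1 q2 where q12: "q1 \<subseteq> q" "finite q1" "\<not> (\<exists>w\<in>\<Omega>. holds w x \<and> (\<forall>x\<in>q1. holds w x))"
      "q2 \<subseteq> q" "finite q2" "\<not> (\<exists>w\<in>\<Omega>. holds w (n x) \<and> (\<forall>x\<in>q2. holds w x))"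
      using * x neg(1)[OF x] by metis
    have "q1 \<union> q2 \<subseteq> q" "finite (q1 \<union> q2)" using q12 by auto
    then obtain w where "w \<in> \<Omega>" "\<forall>x\<in>q1 \<union> q2. holds w x" using q'(3) unfolding fs_def by metis
    then show False using q12(3,6) neg(2)[OF x] by blast
  qed
  then show ?thesis using that[of q] q' by (auto simp: fs_def)
qed

section \<open>Conditions on formal constants\<close>

text \<open>A condition is a formula together with the constants substituted for its variables.
  Formulas thus stay in the original language although the constants change.\<close>

definition holds :: "('a, 'f, 'r) struct \<Rightarrow> ('y \<Rightarrow> 'a) \<Rightarrow> ('f, 'r) fm \<times> (nat \<Rightarrow> 'y) \<Rightarrow> bool" where
  "holds S a x = sat S (a \<circ> snd x) (fst x)"

definition finsat :: "('a, 'f, 'r) struct \<Rightarrow> (('f, 'r) fm \<times> (nat \<Rightarrow> 'y)) set \<Rightarrow> bool" where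
  "finsat S \<Gamma> \<longleftrightarrow> (\<forall>\<Gamma>0\<subseteq>\<Gamma>. finite \<Gamma>0 \<longrightarrow> (\<exists>a. range a \<subseteq> univ S \<and> (\<forall>x\<in>\<Gamma>0. holds S a x)))"

lemma holds_cong:
  "(\<And>i. i \<in> fv (fst x) \<Longrightarrow> a (snd x i) = a' (snd x i)) \<Longrightarrow> holds S a x = holds S a' x"
  unfolding holds_def by (rule sat_cong) simp

text \<open>
  \<open>Wit q f 0\<close>, \<open>Wit q f 1\<close>, \dots are constants for a realization of the type \<open>q\<close> in countably many
  variables. An element \<open>(\<phi>, ks)\<close> of \<open>q\<close> stands for the formula \<open>\<phi>\<close> in which the first variables
  are replaced by the parameters \<open>f (ks ! 0)\<close>, \<open>f (ks ! 1)\<close>, \dots.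
\<close>

datatype ('x, 'k) cst = Base | Wit "'x set" "'k \<Rightarrow> ('x, 'k) cst" nat

type_synonym ('f, 'r, 'k) tpe = "(('f, 'r) fm \<times> 'k list) set"
type_synonym ('f, 'r, 'k) con = "(('f, 'r) fm \<times> 'k list, 'k) cst"

definition wit_conds :: "('f, 'r, 'k) tpe \<Rightarrow> ('k \<Rightarrow> ('f, 'r, 'k) con) \<Rightarrow>
    (('f, 'r) fm \<times> (nat \<Rightarrow> ('f, 'r, 'k) con)) set" where
  "wit_conds q f = (\<lambda>x. (fst x, frame (map f (snd x)) (Wit q f))) ` q"

text \<open>The presence of this valid condition records that \<open>Wit q f\<close> has been dealt with.\<close>

definition marker :: "('f, 'r, 'k) tpe \<Rightarrow> ('k \<Rightarrow> ('f, 'r, 'k) con) \<Rightarrow>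
    ('f, 'r) fm \<times> (nat \<Rightarrow> ('f, 'r, 'k) con)" where
  "marker q f = (Neg Falsum, \<lambda>_. Wit q f 0)"

definition processed :: "(('f, 'r) fm \<times> (nat \<Rightarrow> ('f, 'r, 'k) con)) set \<Rightarrow> ('f, 'r, 'k) con set" where
  "processed \<Gamma> = {c. c = Base \<or> (\<exists>q f i. c = Wit q f i \<and> marker q f \<in> \<Gamma>)}"

text \<open>Well-founded trees with branches indexed by \<open>K\<close>. Putting
  \<open>Base\<close> outside \<open>K\<close> makes a constant depend only on its branches in
  \<open>K\<close>, which is what bounds the number of constants.\<close>

inductive_set consts_over :: "'x set \<Rightarrow> 'k set \<Rightarrow> ('x, 'k) cst set" for X K where
  "Base \<in> consts_over X K"
| "q \<subseteq> X \<Longrightarrow> (\<And>i. i \<in> K \<Longrightarrow> f i \<in> consts_over X K) \<Longrightarrow> (\<And>i. i \<notin> K \<Longrightarrow> f i = Base) \<Longrightarrow>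
    Wit q f j \<in> consts_over X K"

definition indexing :: "'x set \<Rightarrow> 'k set \<Rightarrow> ('k \<Rightarrow> ('x, 'k) cst) \<Rightarrow> bool" where
  "indexing X K f \<longleftrightarrow> (\<forall>i\<in>K. f i \<in> consts_over X K) \<and> (\<forall>i. i \<notin> K \<longrightarrow> f i = Base)"

text \<open>The reason for leaving \<open>Wit q f\<close> without its intended properties: finitely
  many conditions already rule out a realization of a finite part of \<open>q\<close>. A refutation
  persists when conditions are added.\<close>

definition unsatisfiable_with :: "('a, 'f, 'r) struct \<Rightarrow> ('f, 'r, 'k) tpe \<Rightarrow> ('k \<Rightarrow> ('f, 'r, 'k) con) \<Rightarrow>
    (('f, 'r) fm \<times> (nat \<Rightarrow> ('f, 'r, 'k) con)) set \<Rightarrow> bool" where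
  "unsatisfiable_with S q f \<Gamma> \<longleftrightarrow> (\<exists>\<Gamma>0 q0. \<Gamma>0 \<subseteq> \<Gamma> \<and> finite \<Gamma>0 \<and> q0 \<subseteq> q \<and> finite q0 \<and>
     \<not> (\<exists>a g. range a \<subseteq> univ S \<and> range g \<subseteq> univ S \<and> (\<forall>x\<in>\<Gamma>0. holds S a x) \<and>
          (\<forall>x\<in>q0. sat S (frame (map (a \<circ> f) (snd x)) g) (fst x))))"

lemma unsatisfiable_with_mono: "unsatisfiable_with S q f \<Gamma> \<Longrightarrow> \<Gamma> \<subseteq> \<Gamma>' \<Longrightarrow> unsatisfiable_with S q f \<Gamma>'"
  unfolding unsatisfiable_with_def by (meson subset_trans)

definition types_over :: "('f, 'r) lang \<Rightarrow> 'k set \<Rightarrow> ('f, 'r, 'k) tpe" where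
  "types_over L K = {(\<phi>, ks). wf_fm L \<phi> \<and> set ks \<subseteq> K}"

lemma marker_notin_wit_conds: "marker q f \<notin> wit_conds q' f'"
proof
  assume "marker q f \<in> wit_conds q' f'"
  then obtain x where "(\<lambda>_. Wit q f 0) = frame (map f' (snd x)) (Wit q' f')"
    by (auto simp: marker_def wit_conds_def)
  from fun_cong[OF this, of "Suc (length (snd x))"] show False by (simp add: frame_def)
qed

lemma marker_inject: "marker q f = marker q' f' \<longleftrightarrow> q = q' \<and> f = f'"
  by (auto simp: marker_def dest: fun_cong)

text \<open>The constants \<open>Wit q f\<close> depend on other constants, so they have to be
  treated in a well-founded order. Zorn's lemma hides this order: in the sets considered, conditions
  mention only processed constants, so an unprocessed \<open>Wit q f\<close> is fresh and may be
  interpreted at will.\<close>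

lemma ex_processing:
  fixes S :: "('a, 'f, 'r) struct" and L :: "('f, 'r) lang" and K :: "'k set"
  assumes "univ S \<noteq> {}"
  obtains \<Gamma> :: "(('f, 'r) fm \<times> (nat \<Rightarrow> ('f, 'r, 'k) con)) set"
  where "finsat S \<Gamma>" "\<And>x. x \<in> \<Gamma> \<Longrightarrow> wf_fm L (fst x)"
    "\<And>q f. q \<subseteq> types_over L K \<Longrightarrow> indexing (types_over L K) K f \<Longrightarrow> wit_conds q f \<subseteq> \<Gamma> \<or> unsatisfiable_with S q f \<Gamma>"
proof -
  define \<Z> where "\<Z> = {\<Gamma> :: (('f, 'r) fm \<times> (nat \<Rightarrow> ('f, 'r, 'k) con)) set. finsat S \<Gamma> \<and>
    (\<forall>x\<in>\<Gamma>. wf_fm L (fst x) \<and> snd x ` fv (fst x) \<subseteq> processed \<Gamma>) \<and>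
    (\<forall>q f. marker q f \<in> \<Gamma> \<longrightarrow> wit_conds q f \<subseteq> \<Gamma> \<or> unsatisfiable_with S q f \<Gamma>)}"
  have proc_mono: "processed \<Gamma> \<subseteq> processed \<Gamma>'" if "\<Gamma> \<subseteq> \<Gamma>'"
    for \<Gamma> \<Gamma>' :: "(('f, 'r) fm \<times> (nat \<Rightarrow> ('f, 'r, 'k) con)) set"
    using that by (auto simp: processed_def)
  obtain m where m: "m \<in> univ S" using assms by auto
  have "\<Union>\<C> \<in> \<Z>" if chain: "subset.chain \<Z> \<C>" for \<C>
  proof (cases "\<C> = {}")
    case True
    then show ?thesis using m by (auto simp: \<Z>_def finsat_def intro!: exI[of _ "\<lambda>_. m"])
  next
    case False
    have Z: "\<Gamma> \<in> \<Z>" if "\<Gamma> \<in> \<C>" for \<Gamma> using chain that by (auto simp: subset_chain_def)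
    have "finsat S (\<Union>\<C>)" unfolding finsat_def
    proof (intro allI impI)
      fix \<Gamma>0 assume "\<Gamma>0 \<subseteq> \<Union>\<C>" "finite \<Gamma>0"
      then obtain \<Gamma> where "\<Gamma> \<in> \<C>" "\<Gamma>0 \<subseteq> \<Gamma>"
        using finite_subset_Union_chain[OF _ _ False chain] by metis
      then show "\<exists>a. range a \<subseteq> univ S \<and> (\<forall>x\<in>\<Gamma>0. holds S a x)"
        using Z \<open>finite \<Gamma>0\<close> by (auto simp: \<Z>_def finsat_def)
    qed
    moreover have "wf_fm L (fst x) \<and> snd x ` fv (fst x) \<subseteq> processed (\<Union>\<C>)" if "x \<in> \<Union>\<C>" for x
    proof -
      obtain \<Gamma> where "x \<in> \<Gamma>" "\<Gamma> \<in> \<C>" using \<open>x \<in> \<Union>\<C>\<close> by (rule UnionE)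
      then show ?thesis using Z[of \<Gamma>] proc_mono[of \<Gamma> "\<Union>\<C>"] by (fastforce simp: \<Z>_def)
    qed
    moreover have "wit_conds q f \<subseteq> \<Union>\<C> \<or> unsatisfiable_with S q f (\<Union>\<C>)" if "marker q f \<in> \<Union>\<C>" for q f
    proof -
      obtain \<Gamma> where \<Gamma>: "marker q f \<in> \<Gamma>" "\<Gamma> \<in> \<C>" using \<open>marker q f \<in> \<Union>\<C>\<close> by (rule UnionE)
      then have "wit_conds q f \<subseteq> \<Gamma> \<or> unsatisfiable_with S q f \<Gamma>" using Z by (auto simp: \<Z>_def)
      then show ?thesis using \<Gamma>(2) unsatisfiable_with_mono[of S q f \<Gamma> "\<Union>\<C>"] by auto
    qed
    ultimately show ?thesis by (simp add: \<Z>_def)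
  qed
  then obtain \<Gamma> where \<Gamma>: "\<Gamma> \<in> \<Z>" "\<And>X. X \<in> \<Z> \<Longrightarrow> \<Gamma> \<subseteq> X \<Longrightarrow> X = \<Gamma>"
    using subset_Zorn'[of \<Z>] by blast
  have fs: "finsat S \<Gamma>" and wf: "\<And>x. x \<in> \<Gamma> \<Longrightarrow> wf_fm L (fst x) \<and> snd x ` fv (fst x) \<subseteq> processed \<Gamma>"
    and dec: "\<And>q f. marker q f \<in> \<Gamma> \<Longrightarrow> wit_conds q f \<subseteq> \<Gamma> \<or> unsatisfiable_with S q f \<Gamma>"
    using \<Gamma>(1) by (auto simp: \<Z>_def)
  \<comment> \<open>By maximality: if the witness conditions are consistent with \<Gamma>, they can
    be added with the marker; if not, the marker alone can be added, because the type is then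
    refuted.\<close>
  have step: "marker q f \<in> \<Gamma>"
    if q: "q \<subseteq> types_over L K" and f: "\<And>i. f i \<in> processed \<Gamma>" for q f
  proof (rule ccontr)
    assume new: "marker q f \<notin> \<Gamma>"
    then have fresh: "Wit q f i \<notin> processed \<Gamma>" for i by (auto simp: processed_def)
    have fs_marker: "finsat S (insert (marker q f) \<Gamma>')" if "finsat S \<Gamma>'" for \<Gamma>'
      unfolding finsat_def
    proof (intro allI impI)
      fix \<Gamma>0 assume "\<Gamma>0 \<subseteq> insert (marker q f) \<Gamma>'" "finite \<Gamma>0"
      then have "\<Gamma>0 - {marker q f} \<subseteq> \<Gamma>'" "finite (\<Gamma>0 - {marker q f})" by auto
      then obtain a where "range a \<subseteq> univ S" "\<forall>x\<in>\<Gamma>0 - {marker q f}. holds S a x"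
        using \<open>finsat S \<Gamma>'\<close> unfolding finsat_def by metis
      then show "\<exists>a. range a \<subseteq> univ S \<and> (\<forall>x\<in>\<Gamma>0. holds S a x)"
        by (intro exI[of _ a]) (auto simp: holds_def marker_def)
    qed
    show False
    proof (cases "finsat S (\<Gamma> \<union> wit_conds q f)")
      case True
      let ?\<Gamma> = "insert (marker q f) (\<Gamma> \<union> wit_conds q f)"
      have "snd x ` fv (fst x) \<subseteq> processed ?\<Gamma> \<and> wf_fm L (fst x)" if "x \<in> ?\<Gamma>" for x
      proof -
        consider "x = marker q f" | "x \<in> \<Gamma>" | "x \<in> wit_conds q f" using \<open>x \<in> ?\<Gamma>\<close> by auto
        then show ?thesis
        proof cases
          case 1
          then show ?thesis by (simp add: marker_def)
        next
          case 2
          then show ?thesis using wf[OF 2] proc_mono[of \<Gamma> ?\<Gamma>] by blast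
        next
          case 3
          then obtain y where y: "y \<in> q" "x = (fst y, frame (map f (snd y)) (Wit q f))"
            by (auto simp: wit_conds_def)
          have "frame (map f (snd y)) (Wit q f) i \<in> processed ?\<Gamma>" for i
          proof (cases "i < length (snd y)")
            case True
            then show ?thesis using f proc_mono[of \<Gamma> ?\<Gamma>] by (auto simp: frame_def)
          next
            case False
            then show ?thesis by (auto simp: frame_def processed_def)
          qed
          moreover have "wf_fm L (fst y)" using y(1) q by (auto simp: types_over_def)
          ultimately show ?thesis using y(2) by auto
        qed
      qed
      moreover have "wit_conds q' f' \<subseteq> ?\<Gamma> \<or> unsatisfiable_with S q' f' ?\<Gamma>" if "marker q' f' \<in> ?\<Gamma>" for q' f'
      proof -
        have "marker q' f' \<in> \<Gamma> \<or> q' = q \<and> f' = f"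
          using that marker_notin_wit_conds[of q' f' q f] marker_inject[of q' f' q f] by auto
        then show ?thesis
        proof
          assume "marker q' f' \<in> \<Gamma>"
          then show ?thesis using dec[of q' f'] unsatisfiable_with_mono[of S q' f' \<Gamma> ?\<Gamma>] by auto
        qed auto
      qed
      ultimately have "?\<Gamma> \<in> \<Z>" using fs_marker[OF True] by (simp add: \<Z>_def)
      then show False using \<Gamma>(2) new by blast
    next
      case False
      let ?\<Gamma> = "insert (marker q f) \<Gamma>"
      have unsat: "unsatisfiable_with S q f \<Gamma>"
      proof -
        obtain \<Gamma>1 where \<Gamma>1: "\<Gamma>1 \<subseteq> \<Gamma> \<union> wit_conds q f" "finite \<Gamma>1"
          "\<not> (\<exists>a. range a \<subseteq> univ S \<and> (\<forall>x\<in>\<Gamma>1. holds S a x))" using False by (auto simp: finsat_def)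
        have sub: "\<Gamma>1 \<inter> wit_conds q f \<subseteq> (\<lambda>x. (fst x, frame (map f (snd x)) (Wit q f))) ` q"
          by (auto simp: wit_conds_def)
        have fin: "finite (\<Gamma>1 \<inter> wit_conds q f)" using \<Gamma>1(2) by simp
        obtain q0 where q0: "q0 \<subseteq> q" "finite q0"
          "\<Gamma>1 \<inter> wit_conds q f = (\<lambda>x. (fst x, frame (map f (snd x)) (Wit q f))) ` q0"
          using finite_subset_image[OF fin sub] by blast
        have no_model: False if a: "range a \<subseteq> univ S" "range g \<subseteq> univ S" "\<forall>x\<in>\<Gamma>1 \<inter> \<Gamma>. holds S a x"
          "\<forall>x\<in>q0. sat S (frame (map (a \<circ> f) (snd x)) g) (fst x)" for a g
        proof -
          \<comment> \<open>Reinterpreting only the fresh constants \<open>Wit q f i\<close> by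
            \<open>g\<close> keeps the old conditions true and makes the new ones true.\<close>
          define a' where "a' = (\<lambda>c. case c of Base \<Rightarrow> a c | Wit q' f' i \<Rightarrow> if q' = q \<and> f' = f then g i else a c)"
          have a'_old: "a' c = a c" if "c \<in> processed \<Gamma>" for c
            using that fresh by (auto simp: a'_def split: cst.splits)
          have a'_new: "a' \<circ> Wit q f = g" by (auto simp: a'_def)
          have "a' c \<in> univ S" for c using a(1,2) by (auto simp: a'_def split: cst.splits)
          then have "range a' \<subseteq> univ S" by auto
          moreover have "holds S a' x" if "x \<in> \<Gamma>1" for x
          proof (cases "x \<in> \<Gamma>")
            case True
            then have "holds S a' x = holds S a x"
              by (intro holds_cong a'_old) (use wf[OF True] in auto)
            then show ?thesis using True that a(3) by auto
          next
            case False
            then have "x \<in> \<Gamma>1 \<inter> wit_conds q f" using \<Gamma>1(1) \<open>x \<in> \<Gamma>1\<close> by auto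
            then have "x \<in> (\<lambda>x. (fst x, frame (map f (snd x)) (Wit q f))) ` q0" by (simp only: q0(3))
            then obtain y where y: "y \<in> q0" "x = (fst y, frame (map f (snd y)) (Wit q f))" by blast
            have mm: "map (a' \<circ> f) (snd y) = map (a \<circ> f) (snd y)" using a'_old[OF f] by simp
            have "holds S a' x = sat S (frame (map (a \<circ> f) (snd y)) g) (fst y)"
              unfolding holds_def y(2) snd_conv fst_conv frame_comp a'_new list.map_comp mm ..
            then show ?thesis using a(4) y(1) by simp
          qed
          ultimately show False using \<Gamma>1(3) by blast
        qed
        show ?thesis unfolding unsatisfiable_with_def
        proof (intro exI[of _ "\<Gamma>1 \<inter> \<Gamma>"] exI[of _ q0] conjI notI)
          assume "\<exists>a g. range a \<subseteq> univ S \<and> range g \<subseteq> univ S \<and> (\<forall>x\<in>\<Gamma>1 \<inter> \<Gamma>. holds S a x) \<and>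
            (\<forall>x\<in>q0. sat S (frame (map (a \<circ> f) (snd x)) g) (fst x))"
          then show False by (elim exE conjE) (rule no_model)
        qed (use \<Gamma>1(2) q0(1,2) in auto)
      qed
      have "snd x ` fv (fst x) \<subseteq> processed ?\<Gamma> \<and> wf_fm L (fst x)" if "x \<in> ?\<Gamma>" for x
      proof (cases "x \<in> \<Gamma>")
        case True
        then show ?thesis using wf[OF True] proc_mono[of \<Gamma> ?\<Gamma>] by blast
      next
        case False
        then show ?thesis using that by (simp add: marker_def)
      qed
      moreover have "wit_conds q' f' \<subseteq> ?\<Gamma> \<or> unsatisfiable_with S q' f' ?\<Gamma>" if "marker q' f' \<in> ?\<Gamma>" for q' f'
      proof -
        have "wit_conds q' f' \<subseteq> \<Gamma> \<or> unsatisfiable_with S q' f' \<Gamma>"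
          using that dec[of q' f'] unsat marker_inject[of q' f' q f] by auto
        then show ?thesis using unsatisfiable_with_mono[of S q' f' \<Gamma> ?\<Gamma>] by auto
      qed
      ultimately have "?\<Gamma> \<in> \<Z>" using fs_marker[OF fs] by (simp add: \<Z>_def)
      then show False using \<Gamma>(2) new by blast
    qed
  qed
  \<comment> \<open>Induction on the tree replaces the missing enumeration: once all branches are
    processed, \<open>step\<close> applies to the constant itself.\<close>
  have proc: "c \<in> processed \<Gamma>" if "c \<in> consts_over (types_over L K) K" for c
    using that
  proof induction
    case (2 q f j)
    have "f i \<in> processed \<Gamma>" for i
      using 2 by (cases "i \<in> K") (auto simp: processed_def)
    then show ?case using step[OF 2(1), of f] by (auto simp: processed_def)
  qed (simp add: processed_def)
  show ?thesis
  proof (rule that[OF fs])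
    show "wf_fm L (fst x)" if "x \<in> \<Gamma>" for x using wf[OF that] by simp
    fix q f assume q: "q \<subseteq> types_over L K" "indexing (types_over L K) K f"
    have "f i \<in> processed \<Gamma>" for i
      using q proc by (cases "i \<in> K") (auto simp: processed_def indexing_def)
    then show "wit_conds q f \<subseteq> \<Gamma> \<or> unsatisfiable_with S q f \<Gamma>" using dec step[OF q(1)] by blast
  qed
qed

text \<open>A complete description of a sufficiently saturated model on the new constants.\<close>

locale description =
  fixes S :: "('a, 'f, 'r) struct" and L :: "('f, 'r) lang" and K :: "'k set"
    and \<Gamma> :: "(('f, 'r) fm \<times> (nat \<Rightarrow> ('f, 'r, 'k) con)) set"
  assumes finsat: "finsat S \<Gamma>"
    and complete: "wf_fm L \<phi> \<Longrightarrow> (\<phi>, e) \<in> \<Gamma> \<or> (Neg \<phi>, e) \<in> \<Gamma>"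
    and wit: "q \<subseteq> types_over L K \<Longrightarrow> indexing (types_over L K) K f \<Longrightarrow> wit_conds q f \<subseteq> \<Gamma> \<or> unsatisfiable_with S q f \<Gamma>"
    and infinite_K: "infinite K"

lemma ex_description:
  fixes S :: "('a, 'f, 'r) struct" and L :: "('f, 'r) lang" and K :: "'k set"
  assumes "univ S \<noteq> {}" "infinite K"
  obtains \<Gamma> :: "(('f, 'r) fm \<times> (nat \<Rightarrow> ('f, 'r, 'k) con)) set"
  where "description S L K \<Gamma>"
proof -
  obtain \<Gamma>0 :: "(('f, 'r) fm \<times> (nat \<Rightarrow> ('f, 'r, 'k) con)) set" where \<Gamma>0:
    "finsat S \<Gamma>0" "\<And>x. x \<in> \<Gamma>0 \<Longrightarrow> wf_fm L (fst x)"
    "\<And>q f. q \<subseteq> types_over L K \<Longrightarrow> indexing (types_over L K) K f \<Longrightarrow> wit_conds q f \<subseteq> \<Gamma>0 \<or> unsatisfiable_with S q f \<Gamma>0"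
    using ex_processing[OF assms(1)] by blast
  obtain \<Gamma> where \<Gamma>: "\<Gamma>0 \<subseteq> \<Gamma>" "\<And>q0. q0 \<subseteq> \<Gamma> \<Longrightarrow> finite q0 \<Longrightarrow> \<exists>w\<in>{a. range a \<subseteq> univ S}. \<forall>x\<in>q0. holds S w x"
    "\<And>x. x \<in> {x. wf_fm L (fst x)} \<Longrightarrow> x \<in> \<Gamma> \<or> (Neg (fst x), snd x) \<in> \<Gamma>"
  proof (rule lindenbaum[of "{x. wf_fm L (fst x)}" "\<lambda>x. (Neg (fst x), snd x)" "{a. range a \<subseteq> univ S}" "holds S" \<Gamma>0])
    show "\<exists>w\<in>{a. range a \<subseteq> univ S}. \<forall>x\<in>p0. holds S w x" if "p0 \<subseteq> \<Gamma>0" "finite p0" for p0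
      using \<Gamma>0(1) that unfolding finsat_def by auto
  qed (use \<Gamma>0(2) in \<open>auto simp: holds_def\<close>)
  have "description S L K \<Gamma>"
  proof
    show "finsat S \<Gamma>" using \<Gamma>(2) by (auto simp: finsat_def)
    show "(\<phi>, e) \<in> \<Gamma> \<or> (Neg \<phi>, e) \<in> \<Gamma>" if "wf_fm L \<phi>" for \<phi> e using \<Gamma>(3)[of "(\<phi>, e)"] that by simp
    show "wit_conds q f \<subseteq> \<Gamma> \<or> unsatisfiable_with S q f \<Gamma>"
      if "q \<subseteq> types_over L K" "indexing (types_over L K) K f" for q f
      using \<Gamma>0(3)[OF that] \<Gamma>(1) unsatisfiable_with_mono[of S q f \<Gamma>0 \<Gamma>] by blast
  qed (rule assms(2))
  then show ?thesis by (rule that)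
qed

context description
begin

abbreviation "W \<equiv> consts_over (types_over L K) K"

text \<open>Consequence is tested in the single structure \<open>S\<close> under all assignments of
  the constants. With no premises this puts every sentence true in \<open>S\<close> into
  \<Gamma>.\<close>

lemma consequence:
  assumes "\<Gamma>0 \<subseteq> \<Gamma>" "finite \<Gamma>0" "wf_fm L \<psi>"
    and "\<And>a. range a \<subseteq> univ S \<Longrightarrow> (\<And>x. x \<in> \<Gamma>0 \<Longrightarrow> holds S a x) \<Longrightarrow> sat S (a \<circ> e) \<psi>"
  shows "(\<psi>, e) \<in> \<Gamma>"
proof (rule ccontr)
  assume "(\<psi>, e) \<notin> \<Gamma>"
  then have "insert (Neg \<psi>, e) \<Gamma>0 \<subseteq> \<Gamma>" using complete[OF assms(3)] assms(1) by blast
  then obtain a where "range a \<subseteq> univ S" "\<forall>x\<in>insert (Neg \<psi>, e) \<Gamma>0. holds S a x"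
    using finsat assms(2) unfolding finsat_def by (metis finite_insert)
  then show False using assms(4)[of a] by (auto simp: holds_def)
qed

lemma consequence1:
  assumes "(\<phi>, e') \<in> \<Gamma>" "wf_fm L \<psi>"
    and "\<And>a. range a \<subseteq> univ S \<Longrightarrow> sat S (a \<circ> e') \<phi> \<Longrightarrow> sat S (a \<circ> e) \<psi>"
  shows "(\<psi>, e) \<in> \<Gamma>"
  by (rule consequence[of "{(\<phi>, e')}"]) (use assms in \<open>auto simp: holds_def\<close>)

lemma consequence2:
  assumes "(\<phi>, e') \<in> \<Gamma>" "(\<phi>', e'') \<in> \<Gamma>" "wf_fm L \<psi>"
    and "\<And>a. range a \<subseteq> univ S \<Longrightarrow> sat S (a \<circ> e') \<phi> \<Longrightarrow> sat S (a \<circ> e'') \<phi>' \<Longrightarrow> sat S (a \<circ> e) \<psi>"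
  shows "(\<psi>, e) \<in> \<Gamma>"
proof (rule consequence[of "{(\<phi>, e'), (\<phi>', e'')}"])
  fix a assume a: "range a \<subseteq> univ S" "\<And>x. x \<in> {(\<phi>, e'), (\<phi>', e'')} \<Longrightarrow> holds S a x"
  show "sat S (a \<circ> e) \<psi>" using assms(4)[OF a(1)] a(2)[of "(\<phi>, e')"] a(2)[of "(\<phi>', e'')"]
    by (simp add: holds_def)
qed (use assms in auto)

lemma Falsum_notin: "(Falsum, e) \<notin> \<Gamma>"
proof
  assume "(Falsum, e) \<in> \<Gamma>"
  then have "{(Falsum, e)} \<subseteq> \<Gamma>" "finite {(Falsum, e)}" by auto
  then obtain a where "\<forall>x\<in>{(Falsum, e)}. holds S a x" using finsat unfolding finsat_def by metis
  then show False by (simp add: holds_def)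
qed

lemma Neg_iff: "wf_fm L \<phi> \<Longrightarrow> (Neg \<phi>, e) \<in> \<Gamma> \<longleftrightarrow> (\<phi>, e) \<notin> \<Gamma>"
proof -
  assume wf: "wf_fm L \<phi>"
  have "(Falsum, e) \<in> \<Gamma>" if "(\<phi>, e) \<in> \<Gamma>" "(Neg \<phi>, e) \<in> \<Gamma>"
    by (rule consequence2[OF that]) simp_all
  then show ?thesis using complete[OF wf, of e] Falsum_notin by blast
qed

lemma Imp_iff:
  assumes "wf_fm L \<phi>" "wf_fm L \<psi>"
  shows "(Imp \<phi> \<psi>, e) \<in> \<Gamma> \<longleftrightarrow> ((\<phi>, e) \<in> \<Gamma> \<longrightarrow> (\<psi>, e) \<in> \<Gamma>)"
proof
  assume imp: "(Imp \<phi> \<psi>, e) \<in> \<Gamma>"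
  show "(\<phi>, e) \<in> \<Gamma> \<longrightarrow> (\<psi>, e) \<in> \<Gamma>"
  proof
    assume "(\<phi>, e) \<in> \<Gamma>"
    then show "(\<psi>, e) \<in> \<Gamma>"
    proof (rule consequence2[OF _ imp assms(2)])
      fix a assume "sat S (a \<circ> e) \<phi>" "sat S (a \<circ> e) (Imp \<phi> \<psi>)"
      then show "sat S (a \<circ> e) \<psi>" unfolding sat.simps by (rule rev_mp)
    qed
  qed
next
  assume *: "(\<phi>, e) \<in> \<Gamma> \<longrightarrow> (\<psi>, e) \<in> \<Gamma>"
  show "(Imp \<phi> \<psi>, e) \<in> \<Gamma>"
  proof (cases "(\<phi>, e) \<in> \<Gamma>")
    case True
    then have "(\<psi>, e) \<in> \<Gamma>" using * by simp
    then show ?thesis by (rule consequence1) (use assms in auto)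
  next
    case False
    then have "(Neg \<phi>, e) \<in> \<Gamma>" using Neg_iff[OF assms(1)] by simp
    then show ?thesis by (rule consequence1) (use assms in auto)
  qed
qed

lemma realized:
  assumes "q \<subseteq> types_over L K" "indexing (types_over L K) K f"
    and "\<And>\<Gamma>0 q0. \<Gamma>0 \<subseteq> \<Gamma> \<Longrightarrow> finite \<Gamma>0 \<Longrightarrow> q0 \<subseteq> q \<Longrightarrow> finite q0 \<Longrightarrow>
      \<exists>a g. range a \<subseteq> univ S \<and> range g \<subseteq> univ S \<and> (\<forall>x\<in>\<Gamma>0. holds S a x) \<and>
          (\<forall>x\<in>q0. sat S (frame (map (a \<circ> f) (snd x)) g) (fst x))"
    and "x \<in> q"
  shows "(fst x, frame (map f (snd x)) (Wit q f)) \<in> \<Gamma>"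
proof -
  have "\<not> unsatisfiable_with S q f \<Gamma>" unfolding unsatisfiable_with_def using assms(3) by blast
  then have "wit_conds q f \<subseteq> \<Gamma>" using wit[OF assms(1,2)] by blast
  then show ?thesis using assms(4) by (auto simp: wit_conds_def)
qed

lemma Wit_in_W:
  assumes "q \<subseteq> types_over L K" "indexing (types_over L K) K f"
  shows "Wit q f j \<in> W"
  by (rule consts_over.intros(2)[OF assms(1)]) (use assms(2) in \<open>auto simp: indexing_def\<close>)

text \<open>As \<open>K\<close> is infinite, the finitely many constants occurring in a formula can
  be given distinct indices in \<open>K\<close>, so that the formula becomes an element of a
  type.\<close>

lemma ex_indexing:
  fixes V :: "nat set"
  assumes "finite V" "\<And>i. i \<in> V \<Longrightarrow> e i \<in> W"
  obtains f ks ys where "indexing (types_over L K) K f" "set ks \<subseteq> K"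
    "length ks = length ys" "set ys = V" "distinct ys" "map f ks = map e ys"
proof -
  obtain ys :: "nat list" where ys: "set ys = V" "distinct ys" using finite_distinct_list[OF assms(1)] by blast
  obtain k :: "nat \<Rightarrow> 'k" where k: "inj k" "range k \<subseteq> K"
    using infinite_countable_subset[OF infinite_K] by auto
  define f where "f = (\<lambda>x. if x \<in> k ` V then e (inv k x) else Base)"
  show ?thesis
  proof (rule that[of f "map k ys" ys])
    show "indexing (types_over L K) K f"
      using assms(2) k by (auto simp: indexing_def f_def intro: consts_over.intros(1))
    show "map f (map k ys) = map e ys" using ys k(1) by (auto simp: f_def)
  qed (use ys k in auto)
qed

text \<open>Constants for realizations of types also serve as Henkin witnesses: a failing universal
  formula makes the one-formula type of its counterexample consistent with \<Gamma>, and the first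
  constant of that type is the witness.\<close>

lemma All_iff:
  assumes "wf_fm L \<phi>" "e ` fv (All x \<phi>) \<subseteq> W"
  shows "(All x \<phi>, e) \<in> \<Gamma> \<longleftrightarrow> (\<forall>w\<in>W. (\<phi>, e(x := w)) \<in> \<Gamma>)"
proof
  assume all: "(All x \<phi>, e) \<in> \<Gamma>"
  show "\<forall>w\<in>W. (\<phi>, e(x := w)) \<in> \<Gamma>"
  proof
    fix w
    show "(\<phi>, e(x := w)) \<in> \<Gamma>"
    proof (rule consequence1[OF all assms(1)])
      fix a :: "('f, 'r, 'k) con \<Rightarrow> 'a" assume "range a \<subseteq> univ S" "sat S (a \<circ> e) (All x \<phi>)"
      moreover have "a \<circ> e(x := w) = (a \<circ> e)(x := a w)" by auto
      ultimately show "sat S (a \<circ> e(x := w)) \<phi>" by (metis rangeI sat.simps(5) subsetD)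
    qed
  qed
next
  assume all: "\<forall>w\<in>W. (\<phi>, e(x := w)) \<in> \<Gamma>"
  show "(All x \<phi>, e) \<in> \<Gamma>"
  proof (rule ccontr)
    assume "(All x \<phi>, e) \<notin> \<Gamma>"
    then have neg: "(Neg (All x \<phi>), e) \<in> \<Gamma>" using Neg_iff[of "All x \<phi>" e] assms(1) by simp
    have "finite (fv (All x \<phi>))" by (rule finite_fv)
    then obtain f ks ys where f: "indexing (types_over L K) K f" "set ks \<subseteq> K"
      "length ks = length ys" "set ys = fv (All x \<phi>)" "distinct ys" "map f ks = map e ys"
      by (rule ex_indexing) (use assms(2) in auto)
    \<comment> \<open>Free variables of the universal formula go to their positions in the parameter
      list; the quantified \<open>x\<close> goes to the first place behind the parameters, which is
      read as \<open>g 0\<close>.\<close>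
    define r where "r = (\<lambda>i. if i \<in> set ys then (SOME j. j < length ys \<and> ys ! j = i) else length ys)"
    have r: "r i < length ys \<and> ys ! r i = i" if "i \<in> set ys" for i
    proof -
      have "(SOME j. j < length ys \<and> ys ! j = i) < length ys \<and> ys ! (SOME j. j < length ys \<and> ys ! j = i) = i"
        by (rule someI_ex) (use that in \<open>auto simp: in_set_conv_nth\<close>)
      then show ?thesis using that by (simp add: r_def)
    qed
    have "wf_fm L (Neg \<phi>)" using assms(1) by simp
    then obtain \<phi>' where \<phi>': "wf_fm L \<phi>'" "\<And>(S :: ('a, 'f, 'r) struct) e. sat S e \<phi>' = sat S (e \<circ> r) (Neg \<phi>)"
      by (rule ex_renaming[where r = r]) blast
    have fr: "sat S (frame (map (a \<circ> e) ys) g) \<phi>' \<longleftrightarrow> \<not> sat S ((a \<circ> e)(x := g 0)) \<phi>"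
      for a :: "('f, 'r, 'k) con \<Rightarrow> 'a" and g
    proof -
      have "sat S (frame (map (a \<circ> e) ys) g \<circ> r) \<phi> \<longleftrightarrow> sat S ((a \<circ> e)(x := g 0)) \<phi>"
      proof (rule sat_cong)
        fix y assume y: "y \<in> fv \<phi>"
        show "(frame (map (a \<circ> e) ys) g \<circ> r) y = ((a \<circ> e)(x := g 0)) y"
        proof (cases "y = x")
          case True
          then have "r y = length ys" using f(4) by (simp add: r_def)
          then show ?thesis using True by (simp add: frame_def)
        next
          case False
          then have "y \<in> set ys" using y f(4) by simp
          then show ?thesis using r[of y] False by (simp add: frame_def)
        qed
      qed
      then show ?thesis by (simp add: \<phi>'(2))
    qed
    let ?q = "{(\<phi>', ks)}"
    have q: "?q \<subseteq> types_over L K" using \<phi>'(1) f(2) by (auto simp: types_over_def)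
    have mapf: "map (a \<circ> f) ks = map (a \<circ> e) ys" for a :: "('f, 'r, 'k) con \<Rightarrow> 'a"
      using arg_cong[OF f(6), of "map a"] by simp
    have "(fst (\<phi>', ks), frame (map f (snd (\<phi>', ks))) (Wit ?q f)) \<in> \<Gamma>"
    proof (rule realized[OF q f(1)])
      fix \<Gamma>0 q0 assume \<Gamma>0: "\<Gamma>0 \<subseteq> \<Gamma>" "finite \<Gamma>0" and q0: "q0 \<subseteq> ?q"
      have "insert (Neg (All x \<phi>), e) \<Gamma>0 \<subseteq> \<Gamma>" "finite (insert (Neg (All x \<phi>), e) \<Gamma>0)"
        using neg \<Gamma>0 by auto
      then obtain a where a: "range a \<subseteq> univ S" "\<forall>x\<in>insert (Neg (All x \<phi>), e) \<Gamma>0. holds S a x"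
        using finsat unfolding finsat_def by metis
      then obtain m where m: "m \<in> univ S" "\<not> sat S ((a \<circ> e)(x := m)) \<phi>" by (auto simp: holds_def)
      show "\<exists>a g. range a \<subseteq> univ S \<and> range g \<subseteq> univ S \<and> (\<forall>x\<in>\<Gamma>0. holds S a x) \<and>
          (\<forall>x\<in>q0. sat S (frame (map (a \<circ> f) (snd x)) g) (fst x))"
      proof (intro exI[of _ a] exI[of _ "\<lambda>_. m"] conjI ballI)
        fix y assume "y \<in> q0"
        then have "y = (\<phi>', ks)" using q0 by auto
        then show "sat S (frame (map (a \<circ> f) (snd y)) (\<lambda>_. m)) (fst y)"
          using fr[of a "\<lambda>_. m"] m(2) by (simp only: fst_conv snd_conv mapf) simp
      qed (use a m in auto)
    qed auto
    then have "(\<phi>', frame (map f ks) (Wit ?q f)) \<in> \<Gamma>" by simp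
    then have "(Neg \<phi>, e(x := Wit ?q f 0)) \<in> \<Gamma>"
    proof (rule consequence1)
      fix a :: "('f, 'r, 'k) con \<Rightarrow> 'a" assume "sat S (a \<circ> frame (map f ks) (Wit ?q f)) \<phi>'"
      then have "\<not> sat S ((a \<circ> e)(x := (a \<circ> Wit ?q f) 0)) \<phi>"
        unfolding frame_comp list.map_comp mapf fr .
      moreover have "a \<circ> e(x := Wit ?q f 0) = (a \<circ> e)(x := (a \<circ> Wit ?q f) 0)" by auto
      ultimately show "sat S (a \<circ> e(x := Wit ?q f 0)) (Neg \<phi>)" by (simp only: sat.simps) simp
    qed (use assms(1) in simp)
    moreover have "Wit ?q f 0 \<in> W" using q f(1) by (rule Wit_in_W)
    ultimately show False using all Neg_iff[OF assms(1)] by blast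
  qed
qed

end

section \<open>Cardinality of formulas and constants\<close>

lemma Cinfinite_card_of: "infinite K \<Longrightarrow> Cinfinite |K|"
  by (simp add: cinfinite_def Field_card_of card_of_card_order_on)

lemma card_of_Times_le:
  assumes "infinite K" "|A| \<le>o |K|" "|B| \<le>o |K|" shows "|A \<times> B| \<le>o |K|"
  by (rule card_of_Times_ordLeq_infinite_Field[OF _ assms(2,3) card_of_Card_order]) (simp add: Field_card_of assms(1))

text \<open>Lists are folded into a single element by an injection of \<open>K \<times> K\<close>
  into \<open>K\<close>. This is injective only on lists of equal length, so the length is recorded
  as well.\<close>

lemma card_of_lists_ordLeq:
  assumes "infinite K" shows "|lists K| \<le>o |K|"
proof -
  obtain g where g: "inj_on g (K \<times> K)" "g ` (K \<times> K) \<subseteq> K"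
    using card_of_ordLeq[of "K \<times> K" K] card_of_Times_same_infinite[OF assms] ordIso_iff_ordLeq by metis
  obtain k0 where k0: "k0 \<in> K" using assms by fastforce
  define enc where "enc = (\<lambda>xs. foldr (\<lambda>x y. g (x, y)) xs k0)"
  have enc_in: "enc xs \<in> K" if "xs \<in> lists K" for xs
    using that by (induction xs) (use k0 g(2) in \<open>auto simp: enc_def\<close>)
  have enc_inj: "xs = ys" if "xs \<in> lists K" "ys \<in> lists K" "length xs = length ys" "enc xs = enc ys" for xs ys
    using that(3,1,2,4)
  proof (induction xs ys rule: list_induct2)
    case (Cons x xs y ys)
    then have "(x, enc xs) \<in> K \<times> K" "(y, enc ys) \<in> K \<times> K" using enc_in by auto
    moreover have "g (x, enc xs) = g (y, enc ys)" using Cons.prems by (simp add: enc_def)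
    ultimately have "(x, enc xs) = (y, enc ys)" using g(1) by (meson inj_onD)
    then show ?case using Cons by auto
  qed simp
  have "inj_on (\<lambda>xs. (length xs, enc xs)) (lists K)" using enc_inj by (auto simp: inj_on_def)
  moreover have "(length xs, enc xs) \<in> UNIV \<times> K" if "xs \<in> lists K" for xs using enc_in that by auto
  ultimately have "|lists K| \<le>o |(UNIV :: nat set) \<times> K|" by (rule card_of_ordLeqI)
  moreover have "|UNIV :: nat set| \<le>o |K|" using assms by (simp add: infinite_iff_card_of_nat)
  then have "|(UNIV :: nat set) \<times> K| \<le>o |K|" by (intro card_of_Times_le assms card_of_mono1) auto
  ultimately show ?thesis by (rule ordLeq_transitive)
qed

text \<open>The labelled paths of a constant, seen as a well-founded tree.\<close>

primrec code :: "('x, 'k) cst \<Rightarrow> ('k list \<times> ('x + nat)) set" where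
  "code Base = {}"
| "code (Wit q f j) = (\<lambda>x. ([], Inl x)) ` q \<union> {([], Inr j)} \<union> {(k # p, y) |k p y. (p, y) \<in> code (f k)}"

text \<open>The paths of length zero recover the root (\<open>q\<close> and \<open>j\<close>), and
  the paths starting with \<open>k\<close> recover the branch at \<open>k\<close>. The label
  \<open>Inr j\<close> is always present, which separates a \<open>Wit\<close> from
  \<open>Base\<close>.\<close>

lemma code_inject: "code c = code c' \<Longrightarrow> c = c'"
proof (induction c arbitrary: c')
  case Base
  then show ?case by (cases c') auto
next
  case (Wit q f j)
  obtain q' f' j' where c': "c' = Wit q' f' j'" using Wit.prems by (cases c') auto
  have eq: "z \<in> code (Wit q f j) \<longleftrightarrow> z \<in> code (Wit q' f' j')" for z using Wit.prems c' by simp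
  have "x \<in> q \<longleftrightarrow> x \<in> q'" for x using eq[of "([], Inl x)"] by auto
  moreover have "j = j'" using eq[of "([], Inr j)"] by auto
  moreover have "code (f k) = code (f' k)" for k
    using eq[of "(k # fst z, snd z)" for z] by (auto simp: set_eq_iff)
  then have "f k = f' k" for k by (rule Wit.IH[OF rangeI])
  ultimately show ?case using c' by auto
qed

lemma code_consts_over: "c \<in> consts_over X K \<Longrightarrow> code c \<subseteq> lists K \<times> (X <+> UNIV)"
proof (induction rule: consts_over.induct)
  case (2 q f j)
  have k: "k \<in> K" "p \<in> lists K" "y \<in> X <+> UNIV" if "(p, y) \<in> code (f k)" for k p y
  proof -
    show "k \<in> K" using 2(3)[of k] that by fastforce
    then have "(p, y) \<in> lists K \<times> (X <+> UNIV)" using 2(4) that by blast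
    then show "p \<in> lists K" "y \<in> X <+> UNIV" by simp_all
  qed
  show ?case
  proof
    fix z assume "z \<in> code (Wit q f j)"
    then consider x where "x \<in> q" "z = ([], Inl x)" | "z = ([], Inr j)"
      | k p y where "z = (k # p, y)" "(p, y) \<in> code (f k)" by auto
    then show "z \<in> lists K \<times> (X <+> UNIV)"
    proof cases
      case 3
      then show ?thesis using k[OF 3(2)] by simp
    qed (use 2(1) in auto)
  qed
qed simp

lemma card_of_Pow_mono:
  assumes "|A| \<le>o |B|" shows "|Pow A| \<le>o |Pow B|"
proof -
  obtain i where "inj_on i A" "i ` A \<subseteq> B" using assms card_of_ordLeq[of A B] by auto
  then show ?thesis by (intro card_of_ordLeqI[of "image i"]) (auto intro: inj_on_image_Pow)
qed

lemma card_of_consts_over: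
  assumes "infinite K" "|X| \<le>o |K|" shows "|consts_over X K| \<le>o |Pow K|"
proof -
  have nat: "|UNIV :: nat set| \<le>o |K|" using assms(1) by (simp add: infinite_iff_card_of_nat)
  have "|X <+> (UNIV :: nat set)| \<le>o |K|"
    by (rule card_of_Plus_ordLeq_infinite_Field[OF _ assms(2) nat card_of_Card_order]) (simp add: Field_card_of assms(1))
  then have "|lists K \<times> (X <+> (UNIV :: nat set))| \<le>o |K|"
    by (intro card_of_Times_le assms(1) card_of_lists_ordLeq)
  then have "|Pow (lists K \<times> (X <+> (UNIV :: nat set)))| \<le>o |Pow K|" by (rule card_of_Pow_mono)
  moreover have "|consts_over X K| \<le>o |Pow (lists K \<times> (X <+> (UNIV :: nat set)))|"
  proof (rule card_of_ordLeqI[of code])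
    show "inj_on code (consts_over X K)" by (rule inj_onI) (rule code_inject)
    show "code c \<in> Pow (lists K \<times> (X <+> UNIV))" if "c \<in> consts_over X K" for c
      using code_consts_over[OF that] by (rule PowI)
  qed
  ultimately show ?thesis using ordLeq_transitive by blast
qed

text \<open>An injection that does not preserve the meaning; it serves to count the formulas for pairs.\<close>

primrec drop_P :: "('f, 'r option) fm \<Rightarrow> ('f, 'r) fm" where
  "drop_P Falsum = Falsum"
| "drop_P (Equ s t) = Equ s t"
| "drop_P (Atom R ts) = (case R of None \<Rightarrow> Imp (Equ (hd ts) (hd ts)) Falsum | Some R' \<Rightarrow> Atom R' ts)"
| "drop_P (Imp \<phi> \<psi>) = Imp Falsum (Imp (drop_P \<phi>) (drop_P \<psi>))"
| "drop_P (All x \<phi>) = All x (drop_P \<phi>)"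

text \<open>Prefixing \<open>Falsum\<close> in the image of an implication keeps it apart from the
  image of the predicate, an implication that starts with an equation. Well-formedness gives the
  predicate exactly one argument, so \<open>hd\<close> loses nothing.\<close>

lemma drop_P_inject:
  "wf_fm (lang2 L) \<phi> \<Longrightarrow> wf_fm (lang2 L) \<psi> \<Longrightarrow> drop_P \<phi> = drop_P \<psi> \<Longrightarrow> \<phi> = \<psi>"
proof (induction \<phi> arbitrary: \<psi>)
  case Falsum
  then show ?case by (cases \<psi>) (auto split: option.splits)
next
  case (Equ s t)
  then show ?case by (cases \<psi>) (auto split: option.splits)
next
  case (Atom R ts)
  then show ?case by (cases \<psi>) (auto split: option.splits simp: length_Suc_conv)
next
  case (Imp \<phi>1 \<phi>2)
  then show ?case by (cases \<psi>) (auto split: option.splits)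
next
  case (All x \<phi>)
  then show ?case by (cases \<psi>) (auto split: option.splits)
qed

lemma wf_drop_P: "wf_fm (lang2 L) \<phi> \<Longrightarrow> wf_fm L (drop_P \<phi>)"
  by (induction \<phi>) (auto simp: list_all_iff length_Suc_conv split: option.splits)

text \<open>A complete theory contains the universal closure of each formula or its negation. The
  number of quantifiers in the closure, one bit, and that element of \<open>T\<close> determine the
  formula.\<close>

lemma card_of_formulas:
  assumes "complete_theory L T" "infinite K" "|T| \<le>o |K|"
  shows "|{\<phi>. wf_fm L \<phi>}| \<le>o |K|"
proof -
  define m where "m = (\<lambda>\<phi> :: ('a, 'b) fm. Suc (Max (insert 0 (fv \<phi>))))"
  define cl where "cl = (\<lambda>\<phi> :: ('a, 'b) fm. foldr All [0..<m \<phi>] \<phi>)"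
  have m: "fv \<phi> \<subseteq> {..<m \<phi>}" for \<phi> by (auto simp: m_def less_Suc_eq_le)
  have fold: "wf_fm L (foldr All xs \<phi>) = wf_fm L \<phi>" "fv (foldr All xs \<phi>) = fv \<phi> - set xs"
    "foldr All xs \<phi> = foldr All xs \<psi> \<longleftrightarrow> \<phi> = \<psi>" for xs and \<phi> \<psi> :: "('a, 'b) fm"
    by (induction xs) auto
  have cl: "cl \<phi> \<in> sentences L" if "wf_fm L \<phi>" for \<phi>
    using that m[of \<phi>] by (auto simp: sentences_def cl_def fold)
  let ?c = "\<lambda>\<phi>. (m \<phi>, cl \<phi> \<in> T, if cl \<phi> \<in> T then cl \<phi> else Neg (cl \<phi>))"
  have "inj_on ?c {\<phi>. wf_fm L \<phi>}"
  proof (rule inj_onI)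
    fix \<phi> \<psi> assume "?c \<phi> = ?c \<psi>"
    then have "m \<phi> = m \<psi>" "cl \<phi> = cl \<psi>" by (auto split: if_splits)
    then show "\<phi> = \<psi>" by (simp add: cl_def fold)
  qed
  moreover have "?c \<phi> \<in> UNIV \<times> UNIV \<times> T" if "\<phi> \<in> {\<phi>. wf_fm L \<phi>}" for \<phi>
    using assms(1) cl[of \<phi>] that by (auto simp: complete_theory_def)
  ultimately have le: "|{\<phi>. wf_fm L \<phi>}| \<le>o |(UNIV :: nat set) \<times> (UNIV :: bool set) \<times> T|"
    by (rule card_of_ordLeqI)
  have "|UNIV :: bool set| \<le>o |K|"
    by (intro ordLess_imp_ordLeq finite_less_Cinfinite Cinfinite_card_of assms(2)) simp
  then have bT: "|(UNIV :: bool set) \<times> T| \<le>o |K|" using assms(3) by (rule card_of_Times_le[OF assms(2)])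
  have "|UNIV :: nat set| \<le>o |K|" using assms(2) by (simp add: infinite_iff_card_of_nat)
  then have "|(UNIV :: nat set) \<times> (UNIV :: bool set) \<times> T| \<le>o |K|" using bT by (rule card_of_Times_le[OF assms(2)])
  with le show ?thesis by (rule ordLeq_transitive)
qed

lemma card_of_types_over_lang2:
  assumes "complete_theory L T" "infinite K" "|T| \<le>o |K|"
  shows "|types_over (lang2 L) K| \<le>o |K|"
proof -
  have "|{\<phi>. wf_fm (lang2 L) \<phi>}| \<le>o |{\<phi>. wf_fm L \<phi>}|"
    by (rule card_of_ordLeqI[of drop_P]) (auto intro!: inj_onI wf_drop_P dest: drop_P_inject)
  then have "|{\<phi>. wf_fm (lang2 L) \<phi>}| \<le>o |K|" using card_of_formulas[OF assms] by (rule ordLeq_transitive)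
  then have "|{\<phi>. wf_fm (lang2 L) \<phi>} \<times> lists K| \<le>o |K|"
    by (intro card_of_Times_le card_of_lists_ordLeq assms(2))
  moreover have "|types_over (lang2 L) K| \<le>o |{\<phi>. wf_fm (lang2 L) \<phi>} \<times> lists K|"
    by (rule card_of_mono1) (auto simp: types_over_def)
  ultimately show ?thesis using ordLeq_transitive by blast
qed

section \<open>Finite sets of conditions, and interpretation of the constants in the monster
  model\<close>

text \<open>Conditions carry different substitutions, so their variables are made disjoint before
  conjoining: even variables for the new condition, odd ones for the previous conjunction.\<close>

lemma ex_conjunction:
  fixes \<Delta> :: "(('f, 'r) fm \<times> (nat \<Rightarrow> 'y)) set"
  assumes "finite \<Delta>" "\<And>x. x \<in> \<Delta> \<Longrightarrow> wf_fm L (fst x)"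
  shows "\<exists>\<Phi> E. wf_fm L \<Phi> \<and> E ` fv \<Phi> \<subseteq> (\<Union>x\<in>\<Delta>. snd x ` fv (fst x)) \<and>
    (\<forall>(S :: ('a, 'f, 'r) struct) a. sat S (a \<circ> E) \<Phi> \<longleftrightarrow> (\<forall>x\<in>\<Delta>. holds S a x))"
  using assms
proof (induction \<Delta> rule: finite_induct)
  case empty
  show ?case by (rule exI[of _ "Neg Falsum"]) auto
next
  case (insert x \<Delta>)
  obtain \<phi> e where x: "x = (\<phi>, e)" by (cases x)
  have "\<exists>\<Phi> E. wf_fm L \<Phi> \<and> E ` fv \<Phi> \<subseteq> (\<Union>x\<in>\<Delta>. snd x ` fv (fst x)) \<and>
    (\<forall>(S :: ('a, 'f, 'r) struct) a. sat S (a \<circ> E) \<Phi> \<longleftrightarrow> (\<forall>x\<in>\<Delta>. holds S a x))"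
    by (rule insert.IH) (use insert.prems in auto)
  then obtain \<Phi> E where "wf_fm L \<Phi> \<and> E ` fv \<Phi> \<subseteq> (\<Union>x\<in>\<Delta>. snd x ` fv (fst x)) \<and>
    (\<forall>(S :: ('a, 'f, 'r) struct) a. sat S (a \<circ> E) \<Phi> \<longleftrightarrow> (\<forall>x\<in>\<Delta>. holds S a x))"
    by (elim exE)
  note E = this[THEN conjunct1] this[THEN conjunct2, THEN conjunct1] this[THEN conjunct2, THEN conjunct2, rule_format]
  have "wf_fm L \<phi>" using insert.prems[of x] by (simp add: x)
  then obtain \<phi>' where \<phi>': "wf_fm L \<phi>'" "fv \<phi>' \<subseteq> (\<lambda>i. 2 * i) ` fv \<phi>"
    "\<And>(S :: ('a, 'f, 'r) struct) e. sat S e \<phi>' = sat S (e \<circ> (\<lambda>i. 2 * i)) \<phi>"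
    by (rule ex_renaming[where r = "\<lambda>i. 2 * i"]) blast
  obtain \<Phi>' where \<Phi>': "wf_fm L \<Phi>'" "fv \<Phi>' \<subseteq> (\<lambda>i. Suc (2 * i)) ` fv \<Phi>"
    "\<And>(S :: ('a, 'f, 'r) struct) e. sat S e \<Phi>' = sat S (e \<circ> (\<lambda>i. Suc (2 * i))) \<Phi>"
    by (rule ex_renaming[where r = "\<lambda>i. Suc (2 * i)", OF E(1)]) blast
  let ?E = "\<lambda>i. if even i then e (i div 2) else E (i div 2)"
  show ?case
  proof (intro exI conjI allI)
    show "wf_fm L (Conj \<phi>' \<Phi>')" using \<phi>' \<Phi>' by simp
    have 1: "?E ` fv \<phi>' \<subseteq> e ` fv \<phi>" using \<phi>'(2) by (intro image_subsetI) auto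
    have 2: "?E ` fv \<Phi>' \<subseteq> E ` fv \<Phi>" using \<Phi>'(2) by (intro image_subsetI) auto
    have "?E ` fv (Conj \<phi>' \<Phi>') = ?E ` fv \<phi>' \<union> ?E ` fv \<Phi>'" by (simp only: Conj_simps image_Un)
    also have "\<dots> \<subseteq> e ` fv \<phi> \<union> (\<Union>x\<in>\<Delta>. snd x ` fv (fst x))"
      by (rule Un_mono[OF 1 subset_trans[OF 2 E(2)]])
    finally show "?E ` fv (Conj \<phi>' \<Phi>') \<subseteq> (\<Union>x\<in>insert x \<Delta>. snd x ` fv (fst x))"
      by (simp only: x UN_insert fst_conv snd_conv)
    fix S :: "('a, 'f, 'r) struct" and a :: "'y \<Rightarrow> 'a"
    have "sat S (a \<circ> ?E) \<phi>' \<longleftrightarrow> holds S a x" unfolding \<phi>'(3) holds_def by (simp add: x comp_def)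
    moreover have "sat S (a \<circ> ?E) \<Phi>' \<longleftrightarrow> (\<forall>x\<in>\<Delta>. holds S a x)"
      unfolding \<Phi>'(3) E(3)[symmetric] by (simp add: comp_def)
    ultimately show "sat S (a \<circ> ?E) (Conj \<phi>' \<Phi>') \<longleftrightarrow> (\<forall>x\<in>insert x \<Delta>. holds S a x)" by simp
  qed
qed

text \<open>\<open>None\<close> stands for the element to be found. All variables sent to it are
  identified with variable 0 and quantified; the others move up by one.\<close>

lemma ex_existential:
  fixes \<Delta> :: "(('f, 'r) fm \<times> (nat \<Rightarrow> 'y option)) set"
  assumes "finite \<Delta>" "\<And>x. x \<in> \<Delta> \<Longrightarrow> wf_fm L (fst x)" "\<And>x. x \<in> \<Delta> \<Longrightarrow> snd x ` fv (fst x) \<subseteq> insert None (Some ` H)"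
  obtains \<Phi> E where "wf_fm L \<Phi>" "E ` fv \<Phi> \<subseteq> H"
    "\<And>(S :: ('a, 'f, 'r) struct) a. sat S (a \<circ> E) \<Phi> \<longleftrightarrow> (\<exists>c\<in>univ S. \<forall>x\<in>\<Delta>. holds S (case_option c a) x)"
proof -
  have "\<exists>\<Psi> E. wf_fm L \<Psi> \<and> E ` fv \<Psi> \<subseteq> (\<Union>x\<in>\<Delta>. snd x ` fv (fst x)) \<and>
    (\<forall>(S :: ('a, 'f, 'r) struct) a. sat S (a \<circ> E) \<Psi> \<longleftrightarrow> (\<forall>x\<in>\<Delta>. holds S a x))"
    by (rule ex_conjunction[OF assms(1,2)])
  then obtain \<Psi> E where "wf_fm L \<Psi> \<and> E ` fv \<Psi> \<subseteq> (\<Union>x\<in>\<Delta>. snd x ` fv (fst x)) \<and>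
    (\<forall>(S :: ('a, 'f, 'r) struct) a. sat S (a \<circ> E) \<Psi> \<longleftrightarrow> (\<forall>x\<in>\<Delta>. holds S a x))"
    by (elim exE)
  note E = this[THEN conjunct1] this[THEN conjunct2, THEN conjunct1] this[THEN conjunct2, THEN conjunct2, rule_format]
  let ?r = "\<lambda>i. if E i = None then 0 else Suc i"
  obtain \<Psi>' where \<Psi>': "wf_fm L \<Psi>'" "fv \<Psi>' \<subseteq> ?r ` fv \<Psi>"
    "\<And>(S :: ('a, 'f, 'r) struct) e. sat S e \<Psi>' = sat S (e \<circ> ?r) \<Psi>"
    by (rule ex_renaming[where r = ?r, OF E(1)]) blast
  let ?E = "\<lambda>i. the (E (i - 1))"
  show ?thesis
  proof (rule that[of "Exists 0 \<Psi>'" ?E])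
    show "wf_fm L (Exists 0 \<Psi>')" using \<Psi>'(1) by simp
    have EH: "E i \<in> insert None (Some ` H)" if "i \<in> fv \<Psi>" for i
      using that E(2) assms(3) by blast
    show "?E ` fv (Exists 0 \<Psi>') \<subseteq> H"
    proof
      fix y assume "y \<in> ?E ` fv (Exists 0 \<Psi>')"
      then obtain j where j: "j \<in> fv \<Psi>'" "j \<noteq> 0" "y = ?E j" by auto
      then obtain i where "i \<in> fv \<Psi>" "j = Suc i" "E i \<noteq> None" using \<Psi>'(2) by (auto split: if_splits)
      then show "y \<in> H" using EH[of i] j(3) by auto
    qed
    fix S :: "('a, 'f, 'r) struct" and a :: "'y \<Rightarrow> 'a"
    have "(a \<circ> ?E)(0 := c) \<circ> ?r = case_option c a \<circ> E" for c
      by (auto simp: fun_eq_iff split: option.split)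
    then show "sat S (a \<circ> ?E) (Exists 0 \<Psi>') \<longleftrightarrow> (\<exists>c\<in>univ S. \<forall>x\<in>\<Delta>. holds S (case_option c a) x)"
      by (simp only: Exists_simps \<Psi>'(3) E(3))
  qed
qed

text \<open>Saturation is about complete 1-types in a language with constants. Conditions are
  translated into such formulas, and \<open>lindenbaum\<close> completes the partial type.\<close>

lemma saturated_realizes:
  fixes S :: "('a, 'f, 'r) struct" and p :: "(('f, 'r) fm \<times> (nat \<Rightarrow> 'a option)) set"
  assumes sat: "saturated L S \<theta>" and A: "A \<subseteq> univ S" "|A| <o \<theta>"
    and p: "\<And>x. x \<in> p \<Longrightarrow> wf_fm L (fst x)" "\<And>x. x \<in> p \<Longrightarrow> snd x ` fv (fst x) \<subseteq> insert None (Some ` A)"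
    and fin: "\<And>p0. p0 \<subseteq> p \<Longrightarrow> finite p0 \<Longrightarrow> \<exists>c\<in>univ S. \<forall>x\<in>p0. holds S (case_option c id) x"
  obtains c where "c \<in> univ S" "\<And>x. x \<in> p \<Longrightarrow> holds S (case_option c id) x"
proof -
  let ?F = "{\<phi>. wf_fm (lang_params L A) \<phi> \<and> fv \<phi> \<subseteq> {0}}"
  let ?sat = "\<lambda>c. sat (struct_params S) (\<lambda>_. c)"
  have "\<exists>\<phi>'. \<phi>' \<in> ?F \<and> (\<forall>c. ?sat c \<phi>' \<longleftrightarrow> holds S (case_option c id) x)" if x: "x \<in> p" for x
  proof -
    obtain \<phi>' where \<phi>': "wf_fm (lang_params L A) \<phi>'" "fv \<phi>' \<subseteq> (\<lambda>_. 0) ` (fv (fst x) \<inter> {i. snd x i = None})"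
      "\<And>S g. sat (struct_params S) g \<phi>' =
        sat S (\<lambda>i. if i \<in> {i. snd x i = None} then g 0 else the (snd x i)) (fst x)"
    proof (rule ex_instance[OF p(1)[OF x], of "{i. snd x i = None}" "\<lambda>i. the (snd x i)" A "\<lambda>_. 0"])
      show "the (snd x i) \<in> A" if "i \<in> fv (fst x)" "i \<notin> {i. snd x i = None}" for i
        using p(2)[OF x] that by auto
    qed blast
    have "?sat c \<phi>' \<longleftrightarrow> holds S (case_option c id) x" for c
      unfolding \<phi>'(3) holds_def by (rule sat_cong) (auto split: option.split)
    then show ?thesis using \<phi>'(1,2) by blast
  qed
  then have "\<forall>x\<in>p. \<exists>\<phi>'. \<phi>' \<in> ?F \<and> (\<forall>c. ?sat c \<phi>' \<longleftrightarrow> holds S (case_option c id) x)" by (rule ballI)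
  from bchoice[OF this] obtain tr
    where tr': "\<forall>x\<in>p. tr x \<in> ?F \<and> (\<forall>c. ?sat c (tr x) \<longleftrightarrow> holds S (case_option c id) x)" by (elim exE)
  have tr: "tr x \<in> ?F" "?sat c (tr x) \<longleftrightarrow> holds S (case_option c id) x" if "x \<in> p" for x c
    using bspec[OF tr' that] by auto
  obtain q where q: "tr ` p \<subseteq> q" "q \<subseteq> ?F" "\<And>q0. q0 \<subseteq> q \<Longrightarrow> finite q0 \<Longrightarrow> \<exists>c\<in>univ S. \<forall>x\<in>q0. ?sat c x"
    "\<And>x. x \<in> ?F \<Longrightarrow> x \<in> q \<or> Neg x \<in> q"
  proof (rule lindenbaum[of ?F Neg "univ S" ?sat "tr ` p"])
    show "tr ` p \<subseteq> ?F" using tr(1) by blast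
    fix p0 assume "p0 \<subseteq> tr ` p" "finite p0"
    then obtain p1 where p1: "p1 \<subseteq> p" "finite p1" "p0 = tr ` p1" by (meson finite_subset_image)
    then obtain c where "c \<in> univ S" "\<forall>x\<in>p1. holds S (case_option c id) x" using fin by blast
    then show "\<exists>c\<in>univ S. \<forall>x\<in>p0. ?sat c x" using tr(2) p1 by (intro bexI[of _ c]) auto
  qed auto
  have "q \<in> types1 L S A" unfolding types1_def using q(2-4) by auto
  from sat[unfolded saturated_def, rule_format, OF A this]
  obtain c where c: "c \<in> univ S" "realizes S c q" by blast
  have "holds S (case_option c id) x" if "x \<in> p" for x
    using tr(2)[OF that] c(2) q(1) that by (auto simp: realizes_def)
  then show ?thesis using that c(1) by blast
qed

text \<open>Universality of a saturated structure: an interpretation of constants is extended one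
  constant at a time, again by a maximal relation. Its graph has size below \<mu>, so saturation
  supplies a value for the next constant. Only conditions in \<L> are made true here; the predicate
  is read off from \<Gamma> afterwards.\<close>

lemma (in monster) ex_interpretation:
  fixes \<Gamma> :: "(('f, 'r option) fm \<times> (nat \<Rightarrow> 'c)) set" and W :: "'c set"
  assumes M: "elementary_substruct L \<CC> M" and W: "|W| <o \<mu>"
    and \<Gamma>: "\<And>\<Gamma>0 \<psi> e. \<Gamma>0 \<subseteq> \<Gamma> \<Longrightarrow> finite \<Gamma>0 \<Longrightarrow> wf_fm (lang2 L) \<psi> \<Longrightarrow>
      (\<And>a. range a \<subseteq> M \<Longrightarrow> (\<And>x. x \<in> \<Gamma>0 \<Longrightarrow> holds (pair_struct \<CC> M P) a x) \<Longrightarrow>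
        sat (pair_struct \<CC> M P) (a \<circ> e) \<psi>) \<Longrightarrow> (\<psi>, e) \<in> \<Gamma>"
    and False: "\<And>e. (Falsum, e) \<notin> \<Gamma>"
  obtains h where "\<And>w. w \<in> W \<Longrightarrow> h w \<in> U"
    "\<And>\<phi> e. wf_fm L \<phi> \<Longrightarrow> e ` fv \<phi> \<subseteq> W \<Longrightarrow> (map_fm id Some \<phi>, e) \<in> \<Gamma> \<Longrightarrow> sat \<CC> (h \<circ> e) \<phi>"
proof -
  let ?S = "pair_struct \<CC> M P"
  define good' where "good' = (\<lambda>H :: ('c \<times> 'a) set. \<forall>\<phi> e. wf_fm L \<phi> \<longrightarrow> e ` fv \<phi> \<subseteq> H \<longrightarrow>
    (map_fm id Some \<phi>, fst \<circ> e) \<in> \<Gamma> \<longrightarrow> sat \<CC> (snd \<circ> e) \<phi>)"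
  define \<Z> where "\<Z> = {H. H \<subseteq> W \<times> U \<and> good' H}"
  have model: "\<exists>a. range a \<subseteq> M \<and> sat ?S (a \<circ> e) \<phi>" if "(\<phi>, e) \<in> \<Gamma>" for \<phi> e
  proof (rule ccontr)
    assume no: "\<not> ?thesis"
    have "(Falsum, e) \<in> \<Gamma>"
    proof (rule \<Gamma>[of "{(\<phi>, e)}"])
      fix a assume "range a \<subseteq> M" "\<And>x. x \<in> {(\<phi>, e)} \<Longrightarrow> holds ?S a x"
      then have "range a \<subseteq> M \<and> sat ?S (a \<circ> e) \<phi>" by (simp add: holds_def)
      then show "sat ?S (a \<circ> e) Falsum" using no by blast
    qed (use \<open>(\<phi>, e) \<in> \<Gamma>\<close> in auto)
    then show False using False by blast
  qed
  have "{} \<in> \<Z>"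
  proof -
    have "sat \<CC> (snd \<circ> e) \<phi>" if \<phi>: "wf_fm L \<phi>" "fv \<phi> = {}" "(map_fm id Some \<phi>, fst \<circ> e) \<in> \<Gamma>"
      for \<phi> and e :: "nat \<Rightarrow> 'c \<times> 'a"
    proof -
      obtain a where a: "range a \<subseteq> M" "sat ?S (a \<circ> (fst \<circ> e)) (map_fm id Some \<phi>)"
        using model[OF \<phi>(3)] by blast
      then have "sat \<CC> (a \<circ> (fst \<circ> e)) \<phi>"
        using sat_elementary[OF M \<phi>(1)] \<phi>(2) unfolding sat_map_fm by blast
      moreover have "sat \<CC> (a \<circ> (fst \<circ> e)) \<phi> = sat \<CC> (snd \<circ> e) \<phi>" by (rule sat_cong) (simp add: \<phi>(2))
      ultimately show ?thesis by blast
    qed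
    then show ?thesis by (auto simp: \<Z>_def good'_def)
  qed
  moreover have "\<Union>\<C> \<in> \<Z>" if C: "\<C> \<noteq> {}" "subset.chain \<Z> \<C>" for \<C>
  proof -
    have sub: "H \<subseteq> W \<times> U" "good' H" if "H \<in> \<C>" for H using C(2) that by (auto simp: subset_chain_def \<Z>_def)
    have "good' (\<Union>\<C>)" unfolding good'_def
    proof (intro allI impI)
      fix \<phi> e assume *: "wf_fm L \<phi>" "e ` fv \<phi> \<subseteq> \<Union>\<C>" "(map_fm id Some \<phi>, fst \<circ> e) \<in> \<Gamma>"
      then obtain H where "H \<in> \<C>" "e ` fv \<phi> \<subseteq> H"
        using finite_subset_Union_chain[OF _ _ C, of "e ` fv \<phi>"] by auto
      then show "sat \<CC> (snd \<circ> e) \<phi>" using sub(2) * unfolding good'_def by blast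
    qed
    then show ?thesis using sub(1) by (auto simp: \<Z>_def)
  qed
  ultimately obtain H where H: "H \<in> \<Z>" "\<And>X. X \<in> \<Z> \<Longrightarrow> H \<subseteq> X \<Longrightarrow> X = H"
    using subset_Zorn_nonempty[of \<Z>] by blast
  have HW: "H \<subseteq> W \<times> U" using H(1) by (simp add: \<Z>_def)
  have gH: "sat \<CC> (snd \<circ> e) \<phi>" if "wf_fm L \<phi>" "e ` fv \<phi> \<subseteq> H" "(map_fm id Some \<phi>, fst \<circ> e) \<in> \<Gamma>" for \<phi> e
    using H(1) that unfolding \<Z>_def good'_def by blast
  \<comment> \<open>The equation of a constant with itself holds in every assignment and so lies in
    \<Gamma>; hence \<open>H\<close> is a function and is no larger than \<open>W\<close>.\<close>
  have single: "b = b'" if "(w, b) \<in> H" "(w, b') \<in> H" for w b b'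
  proof -
    let ?e = "\<lambda>i. if i = 0 then (w, b) else (w, b')" and ?\<phi> = "Equ (Var 0) (Var 1) :: ('f, 'r) fm"
    have "(map_fm id Some ?\<phi>, fst \<circ> ?e) \<in> \<Gamma>" by (rule \<Gamma>[of "{}"]) auto
    then have "sat \<CC> (snd \<circ> ?e) ?\<phi>" by (rule gH[rotated 2]) (use that in auto)
    then show ?thesis by simp
  qed
  have "inj_on fst H" using single by (intro inj_onI) (metis prod.collapse)
  then have "|H| \<le>o |W|" by (rule card_of_ordLeqI) (use HW in auto)
  then have "|H| <o \<mu>" using W by (rule ordLeq_ordLess_trans)
  then have A: "|snd ` H| <o \<mu>" by (meson card_of_image ordLeq_ordLess_trans)
  have AU: "snd ` H \<subseteq> U" using HW by auto
  have "W \<subseteq> fst ` H"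
  proof
    fix w assume w: "w \<in> W"
    \<comment> \<open>The \<L>-conditions on \<open>w\<close> over constants that already have a
      value, with \<open>None\<close> in the place of \<open>w\<close>; \<open>cv\<close> then
      replaces those constants by their values.\<close>
    define p' where "p' = {x :: ('f, 'r) fm \<times> (nat \<Rightarrow> ('c \<times> 'a) option). wf_fm L (fst x) \<and>
      snd x ` fv (fst x) \<subseteq> insert None (Some ` H) \<and> (map_fm id Some (fst x), case_option w fst \<circ> snd x) \<in> \<Gamma>}"
    define cv where "cv = (\<lambda>x :: ('f, 'r) fm \<times> (nat \<Rightarrow> ('c \<times> 'a) option). (fst x, map_option snd \<circ> snd x))"
    have holds_cv: "holds \<CC> (case_option c id) (cv x) \<longleftrightarrow> holds \<CC> (case_option c snd) x" for c x
      unfolding holds_def cv_def fst_conv snd_conv by (rule sat_cong) (auto split: option.split)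
    obtain c where c: "c \<in> U" "\<And>y. y \<in> cv ` p' \<Longrightarrow> holds \<CC> (case_option c id) y"
    proof (rule saturated_realizes[of L \<CC> \<mu> "snd ` H" "cv ` p'"])
      show "saturated L \<CC> \<mu>" using monster by (simp add: monster_model_def)
      show "wf_fm L (fst y)" if "y \<in> cv ` p'" for y using that by (auto simp: p'_def cv_def)
      show "snd y ` fv (fst y) \<subseteq> insert None (Some ` snd ` H)" if "y \<in> cv ` p'" for y
      proof -
        obtain x where x: "x \<in> p'" "y = cv x" using \<open>y \<in> cv ` p'\<close> by (rule imageE)
        have "snd y i \<in> insert None (Some ` snd ` H)" if i: "i \<in> fv (fst x)" for i
        proof -
          have "snd x i \<in> insert None (Some ` H)" using x(1) i by (auto simp: p'_def)
          then show ?thesis by (auto simp: x(2) cv_def)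
        qed
        then show ?thesis by (auto simp: x(2) cv_def)
      qed
      fix p0 assume p0: "p0 \<subseteq> cv ` p'" "finite p0"
      obtain \<Delta> where \<Delta>: "\<Delta> \<subseteq> p'" "finite \<Delta>" "p0 = cv ` \<Delta>" using finite_subset_image[OF p0(2,1)] by blast
      obtain \<Phi> E where E: "wf_fm L \<Phi>" "E ` fv \<Phi> \<subseteq> H"
        "\<And>(S :: ('a, 'f, 'r) struct) a. sat S (a \<circ> E) \<Phi> \<longleftrightarrow> (\<exists>c\<in>univ S. \<forall>x\<in>\<Delta>. holds S (case_option c a) x)"
      proof (rule ex_existential[OF \<Delta>(2)])
        show "wf_fm L (fst x)" "snd x ` fv (fst x) \<subseteq> insert None (Some ` H)" if "x \<in> \<Delta>" for x
          using \<Delta>(1) that by (auto simp: p'_def)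
      qed blast
      \<comment> \<open>Quantifying \<open>w\<close> away from finitely many conditions leaves a
        consequence about old constants. It lies in \<Gamma> and is true under \<open>H\<close>, and
        this yields the finite satisfiability.\<close>
      let ?\<Delta> = "(\<lambda>x. (map_fm id Some (fst x), case_option w fst \<circ> snd x)) ` \<Delta>"
      have "(map_fm id Some \<Phi>, fst \<circ> E) \<in> \<Gamma>"
      proof (rule \<Gamma>[of ?\<Delta>])
        show "?\<Delta> \<subseteq> \<Gamma>" using \<Delta>(1) by (auto simp: p'_def)
        fix a assume a: "range a \<subseteq> M" "\<And>x. x \<in> ?\<Delta> \<Longrightarrow> holds ?S a x"
        have "holds (substruct \<CC> M) (case_option (a w) (a \<circ> fst)) x" if x: "x \<in> \<Delta>" for x
        proof -
          have "holds ?S a (map_fm id Some (fst x), case_option w fst \<circ> snd x)" by (rule a(2)) (use x in auto)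
          then have "sat (substruct \<CC> M) (a \<circ> (case_option w fst \<circ> snd x)) (fst x)"
            by (simp only: holds_def fst_conv snd_conv sat_map_fm)
          moreover have "a \<circ> (case_option w fst \<circ> snd x) = case_option (a w) (a \<circ> fst) \<circ> snd x"
            by (auto simp: fun_eq_iff split: option.split)
          ultimately show ?thesis by (simp only: holds_def)
        qed
        moreover have "a w \<in> univ (substruct \<CC> M)" using a(1) by auto
        ultimately have "sat (substruct \<CC> M) ((a \<circ> fst) \<circ> E) \<Phi>" unfolding E(3) by blast
        then show "sat ?S (a \<circ> (fst \<circ> E)) (map_fm id Some \<Phi>)" unfolding sat_map_fm comp_assoc .
      qed (use \<Delta>(2) E(1) in \<open>auto simp: wf_map_fm\<close>)
      then have "sat \<CC> (snd \<circ> E) \<Phi>" by (rule gH[OF E(1,2)])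
      then obtain c where "c \<in> U" "\<forall>x\<in>\<Delta>. holds \<CC> (case_option c snd) x" unfolding E(3) by blast
      then show "\<exists>c\<in>U. \<forall>y\<in>p0. holds \<CC> (case_option c id) y" unfolding \<Delta>(3) by (auto simp: holds_cv)
    qed (use A AU in auto)
    have "good' (insert (w, c) H)" unfolding good'_def
    proof (intro allI impI)
      fix \<phi> e assume *: "wf_fm L \<phi>" "e ` fv \<phi> \<subseteq> insert (w, c) H" "(map_fm id Some \<phi>, fst \<circ> e) \<in> \<Gamma>"
      define e' where "e' = (\<lambda>i. if e i = (w, c) then None else Some (e i))"
      have "case_option w fst \<circ> e' = fst \<circ> e" by (auto simp: e'_def fun_eq_iff)
      moreover have "e' ` fv \<phi> \<subseteq> insert None (Some ` H)" using *(2) by (auto simp: e'_def)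
      ultimately have "(\<phi>, e') \<in> p'" using * by (simp add: p'_def del: o_apply)
      then have "holds \<CC> (case_option c snd) (\<phi>, e')" using c(2) holds_cv by blast
      moreover have "case_option c snd \<circ> e' = snd \<circ> e" by (auto simp: e'_def fun_eq_iff)
      ultimately show "sat \<CC> (snd \<circ> e) \<phi>" by (simp only: holds_def fst_conv snd_conv)
    qed
    then have "insert (w, c) H \<in> \<Z>" using HW w c(1) by (simp add: \<Z>_def)
    then have "insert (w, c) H = H" using H(2) by blast
    then show "w \<in> fst ` H" by (metis fst_conv image_eqI insertI1)
  qed
  define h where "h = (\<lambda>w. SOME b. (w, b) \<in> H)"
  have h: "(w, h w) \<in> H" if "w \<in> W" for w
  proof -
    have "w \<in> fst ` H" using \<open>W \<subseteq> fst ` H\<close> that by blast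
    then have "\<exists>b. (w, b) \<in> H" by auto
    then show ?thesis unfolding h_def by (rule someI_ex)
  qed
  show ?thesis
  proof (rule that)
    show "h w \<in> U" if "w \<in> W" for w using h[OF that] HW by auto
    fix \<phi> e assume *: "wf_fm L \<phi>" "e ` fv \<phi> \<subseteq> W" "(map_fm id Some \<phi>, e) \<in> \<Gamma>"
    let ?e = "\<lambda>i. (e i, h (e i))"
    have eq: "fst \<circ> ?e = e" "snd \<circ> ?e = h \<circ> e" by (auto simp: fun_eq_iff)
    have "sat \<CC> (snd \<circ> ?e) \<phi>"
    proof (rule gH[OF *(1)])
      show "?e ` fv \<phi> \<subseteq> H" using h *(2) by blast
    qed (use *(3) in \<open>simp only: eq\<close>)
    then show "sat \<CC> (h \<circ> e) \<phi>" by (simp only: eq)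
  qed
qed

subsection \<open>Saturated pairs inside the monster model\<close>

context monster begin

text \<open>Types in countably many variables; the listed parameters of a formula replace its first variables.\<close>

definition realizes_types :: "'a set \<Rightarrow> 'a set \<Rightarrow> 'a set \<Rightarrow> bool" where
  "realizes_types N Q A \<longleftrightarrow> (\<forall>p. (\<forall>x\<in>p. wf_fm (lang2 L) (fst x) \<and> set (snd x) \<subseteq> A) \<longrightarrow>
     (\<forall>p0\<subseteq>p. finite p0 \<longrightarrow> (\<exists>g. range g \<subseteq> N \<and>
        (\<forall>x\<in>p0. sat (pair_struct \<CC> N Q) (frame (snd x) g) (fst x)))) \<longrightarrow>
     (\<exists>g. range g \<subseteq> N \<and> (\<forall>x\<in>p. sat (pair_struct \<CC> N Q) (frame (snd x) g) (fst x))))"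

text \<open>A 1-type is a type in countably many variables that uses only the first one; its
  constants are turned into listed parameters.\<close>

lemma saturated_if_realizes_types:
  assumes "\<And>A. A \<subseteq> N \<Longrightarrow> |A| <o \<theta> \<Longrightarrow> realizes_types N Q A"
  shows "saturated (lang2 L) (pair_struct \<CC> N Q) \<theta>"
  unfolding saturated_def
proof (intro allI impI ballI)
  let ?S = "pair_struct \<CC> N Q"
  fix A q assume A: "A \<subseteq> univ ?S" "|A| <o \<theta>" and q: "q \<in> types1 (lang2 L) ?S A"
  have q': "\<And>\<phi>. \<phi> \<in> q \<Longrightarrow> wf_fm (lang_params (lang2 L) A) \<phi> \<and> fv \<phi> \<subseteq> {0}"
    "\<And>q0. q0 \<subseteq> q \<Longrightarrow> finite q0 \<Longrightarrow> \<exists>c\<in>univ ?S. \<forall>\<phi>\<in>q0. sat (struct_params ?S) (\<lambda>_. c) \<phi>"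
    using q by (auto simp: types1_def)
  have "\<exists>x. wf_fm (lang2 L) (fst x) \<and> set (snd x) \<subseteq> A \<and>
      (\<forall>g. sat ?S (frame (snd x) g) (fst x) = sat (struct_params ?S) (\<lambda>_. g 0) \<phi>)" if \<phi>: "\<phi> \<in> q" for \<phi>
  proof -
    obtain \<phi>' as where d: "set as \<subseteq> A" "wf_fm (lang2 L) \<phi>'" "fv \<phi>' \<subseteq> {..<length as} \<union> (\<lambda>y. y + length as) ` fv \<phi>"
      "\<And>S e. sat (struct_params S) e \<phi> = sat S (\<lambda>i. if i < length as then as ! i else e (i - length as)) \<phi>'"
      by (rule ex_deparametrized[OF conjunct1[OF q'(1)[OF \<phi>]]]) blast
    have "sat ?S (frame as g) \<phi>' = sat (struct_params ?S) (\<lambda>_. g 0) \<phi>" for g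
      unfolding d(4)
    proof (rule sat_cong)
      fix i assume "i \<in> fv \<phi>'"
      then show "frame as g i = (if i < length as then as ! i else g 0)"
      proof (cases "i < length as")
        case False
        then obtain y where "y \<in> fv \<phi>" "i = y + length as" using d(3) \<open>i \<in> fv \<phi>'\<close> by blast
        then show ?thesis using q'(1)[OF \<phi>] False by (auto simp: frame_def)
      qed (simp add: frame_def)
    qed
    then show ?thesis using d(1,2) by (intro exI[of _ "(\<phi>', as)"]) simp
  qed
  then have "\<forall>\<phi>\<in>q. \<exists>x. wf_fm (lang2 L) (fst x) \<and> set (snd x) \<subseteq> A \<and>
      (\<forall>g. sat ?S (frame (snd x) g) (fst x) = sat (struct_params ?S) (\<lambda>_. g 0) \<phi>)" by (rule ballI)
  from bchoice[OF this] obtain tr where tr: "\<forall>\<phi>\<in>q. wf_fm (lang2 L) (fst (tr \<phi>)) \<and> set (snd (tr \<phi>)) \<subseteq> A \<and>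
      (\<forall>g. sat ?S (frame (snd (tr \<phi>)) g) (fst (tr \<phi>)) = sat (struct_params ?S) (\<lambda>_. g 0) \<phi>)" by (elim exE)
  have fin: "\<exists>g. range g \<subseteq> N \<and> (\<forall>x\<in>p0. sat ?S (frame (snd x) g) (fst x))"
    if p0: "p0 \<subseteq> tr ` q" "finite p0" for p0
  proof -
    obtain q0 where q0: "q0 \<subseteq> q" "finite q0" "p0 = tr ` q0" using finite_subset_image[OF p0(2,1)] by blast
    obtain c where "c \<in> N" "\<forall>\<phi>\<in>q0. sat (struct_params ?S) (\<lambda>_. c) \<phi>" using q'(2)[OF q0(1,2)] by auto
    then show ?thesis using tr q0 by (intro exI[of _ "\<lambda>_. c"]) auto
  qed
  have "A \<subseteq> N" using A(1) by simp
  then have rt: "realizes_types N Q A" by (rule assms[OF _ A(2)])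
  have 1: "\<forall>x\<in>tr ` q. wf_fm (lang2 L) (fst x) \<and> set (snd x) \<subseteq> A" using tr by auto
  have 2: "\<forall>p0\<subseteq>tr ` q. finite p0 \<longrightarrow> (\<exists>g. range g \<subseteq> N \<and> (\<forall>x\<in>p0. sat ?S (frame (snd x) g) (fst x)))"
    using fin by simp
  obtain g where "range g \<subseteq> N" "\<forall>x\<in>tr ` q. sat ?S (frame (snd x) g) (fst x)"
    using rt[unfolded realizes_types_def, THEN spec, THEN mp, OF 1, THEN mp, OF 2] by blast
  then show "\<exists>c\<in>univ ?S. realizes ?S c q"
    using tr by (intro bexI[of _ "g 0"]) (auto simp: realizes_def)
qed

lemma is_struct_pair: "is_struct L (substruct \<CC> M) \<Longrightarrow> is_struct (lang2 L) (pair_struct \<CC> M P)"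
  by (simp add: is_struct_def pair_struct_def substruct_def)

text \<open>The model consists of the values of the constants, and \<open>truth\<close> says that
  \<Gamma> is its elementary diagram. A set of size at most \<theta> can be named by one indexing
  from \<open>K\<close>, so a finitely satisfiable type over it is one of the types for which
  constants were provided.\<close>

lemma ex_realizing_pair:
  fixes \<theta> :: "'k rel"
  assumes M: "elementary_substruct L \<CC> M" and \<theta>: "Cinfinite \<theta>" "ctwo ^c \<theta> <o \<mu>" "|T| \<le>o \<theta>"
  obtains N Q where "sm N" "elementary_substruct L \<CC> N" "Q \<subseteq> N"
    "\<And>\<phi>. \<phi> \<in> sentences (lang2 L) \<Longrightarrow> models (pair_struct \<CC> M P) {\<phi>} \<Longrightarrow> models (pair_struct \<CC> N Q) {\<phi>}"
    "\<And>A. A \<subseteq> N \<Longrightarrow> |A| \<le>o \<theta> \<Longrightarrow> realizes_types N Q A"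
proof -
  let ?S = "pair_struct \<CC> M P" and ?L = "lang2 L"
  define K where "K = Field \<theta>"
  have infK: "infinite K" using \<theta>(1) by (simp add: K_def cinfinite_def)
  have K\<theta>: "|K| =o \<theta>" using \<theta>(1) by (simp add: K_def card_of_Field_ordIso)
  have M_struct: "is_struct L (substruct \<CC> M)" using M by (simp add: elementary_substruct_def)
  then have ne: "univ ?S \<noteq> {}" by (simp add: is_struct_def)
  obtain \<Gamma> :: "(('f, 'r option) fm \<times> (nat \<Rightarrow> ('f, 'r option, 'k) con)) set" where desc: "description ?S ?L K \<Gamma>"
    by (rule ex_description[OF ne infK])
  interpret description ?S ?L K \<Gamma> by (rule desc)
  have TK: "|T| \<le>o |K|" using \<theta>(3) K\<theta> ordIso_symmetric ordLeq_ordIso_trans by blast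
  have "|W| \<le>o |Pow K|"
    by (rule card_of_consts_over[OF infK card_of_types_over_lang2[OF complete_theory infK TK]])
  moreover have "|Pow K| =o ctwo ^c \<theta>"
    unfolding cexp_def ctwo_def Field_card_of K_def by (rule card_of_Pow_Func)
  ultimately have W_mu: "|W| <o \<mu>" using \<theta>(2) by (meson ordLeq_ordIso_trans ordLeq_ordLess_trans)
  obtain h where h: "\<And>w. w \<in> W \<Longrightarrow> h w \<in> U"
    "\<And>\<phi> e. wf_fm L \<phi> \<Longrightarrow> e ` fv \<phi> \<subseteq> W \<Longrightarrow> (map_fm id Some \<phi>, e) \<in> \<Gamma> \<Longrightarrow> sat \<CC> (h \<circ> e) \<phi>"
  proof (rule ex_interpretation[OF M W_mu, of \<Gamma> P])
    show "(\<psi>, e) \<in> \<Gamma>" if "\<Gamma>0 \<subseteq> \<Gamma>" "finite \<Gamma>0" "wf_fm ?L \<psi>"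
      "\<And>a. range a \<subseteq> M \<Longrightarrow> (\<And>x. x \<in> \<Gamma>0 \<Longrightarrow> holds ?S a x) \<Longrightarrow> sat ?S (a \<circ> e) \<psi>" for \<Gamma>0 \<psi> e
      by (rule consequence[OF that(1-3)]) (use that(4) in simp)
  qed (use Falsum_notin in blast)+
  have h_iff: "sat \<CC> (h \<circ> e) \<phi> \<longleftrightarrow> (map_fm id Some \<phi>, e) \<in> \<Gamma>" if "wf_fm L \<phi>" "e ` fv \<phi> \<subseteq> W" for \<phi> e
  proof
    assume s: "sat \<CC> (h \<circ> e) \<phi>"
    show "(map_fm id Some \<phi>, e) \<in> \<Gamma>"
    proof (rule ccontr)
      assume "(map_fm id Some \<phi>, e) \<notin> \<Gamma>"
      then have "(map_fm id Some (Neg \<phi>), e) \<in> \<Gamma>" using complete[of "map_fm id Some \<phi>" e] that(1) by (simp add: wf_map_fm)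
      then have "sat \<CC> (h \<circ> e) (Neg \<phi>)" by (rule h(2)[rotated 2]) (use that in auto)
      then show False using s by (simp only: sat.simps) simp
    qed
  qed (rule h(2)[OF that])
  define N where "N = h ` W"
  define pm :: "('f, 'r option) fm" where "pm = Atom None [Var 0]"
  define Q where "Q = h ` {w \<in> W. (pm, \<lambda>_. w) \<in> \<Gamma>}"
  let ?N = "pair_struct \<CC> N Q"
  have h_eq: "h w = h w' \<longleftrightarrow> (Equ (Var 0) (Var 1), \<lambda>i. if i = 0 then w else w') \<in> \<Gamma>" if "w \<in> W" "w' \<in> W" for w w'
    using h_iff[of "Equ (Var 0) (Var 1)" "\<lambda>i. if i = 0 then w else w'"] that by (simp add: image_subset_iff)
  \<comment> \<open>Different constants may receive the same value. The corresponding equation then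
    lies in \<Gamma>, and with it membership in the predicate carries over.\<close>
  have P_iff: "(pm, \<lambda>_. w) \<in> \<Gamma> \<longleftrightarrow> h w \<in> Q" if w: "w \<in> W" for w
  proof
    assume "h w \<in> Q"
    then obtain w' where w': "w' \<in> W" "(pm, \<lambda>_. w') \<in> \<Gamma>" "h w = h w'" by (auto simp: Q_def)
    then have "(Equ (Var 0) (Var 1), \<lambda>i. if i = 0 then w else w') \<in> \<Gamma>" using h_eq w by blast
    then show "(pm, \<lambda>_. w) \<in> \<Gamma>"
      by (rule consequence2[OF w'(2)]) (auto simp: pm_def)
  qed (use w in \<open>auto simp: Q_def\<close>)
  \<comment> \<open>That some \<open>x\<close> equals \<open>t\<close> is valid, so the Henkin
    property provides a constant for the value of each term. This is needed for predicate atoms and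
    for closure of \<open>N\<close> under functions.\<close>
  have term_value: "\<exists>w\<in>W. (Equ (Var x) t, e(x := w)) \<in> \<Gamma> \<and> h w = val \<CC> (h \<circ> e) t"
    if t: "wf_trm L t" "e ` vars t \<subseteq> W" "x \<notin> vars t" for x t e
  proof -
    let ?\<phi> = "Neg (Equ (Var x) t) :: ('f, 'r option) fm"
    have "(Neg (All x ?\<phi>), e) \<in> \<Gamma>"
    proof (rule consequence[of "{}"])
      fix a :: "('f, 'r option, 'k) con \<Rightarrow> 'a" assume a: "range a \<subseteq> univ ?S"
      let ?b = "val ?S (a \<circ> e) t"
      have mem: "?b \<in> univ ?S"
        by (rule val_in_univ[OF is_struct_pair[OF M_struct]]) (use t(1) a in auto)
      have "val ?S ((a \<circ> e)(x := ?b)) t = ?b" by (rule val_cong) (use t(3) in auto)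
      then have eq: "sat ?S ((a \<circ> e)(x := ?b)) (Equ (Var x) t)" by (simp only: sat.simps val.simps fun_upd_same)
      have "\<not> sat ?S (a \<circ> e) (All x ?\<phi>)"
      proof
        assume "sat ?S (a \<circ> e) (All x ?\<phi>)"
        from bspec[OF this[unfolded sat.simps(5)] mem] eq show False by (simp only: sat.simps(1,4)) simp
      qed
      then show "sat ?S (a \<circ> e) (Neg (All x ?\<phi>))" by (simp only: sat.simps(1,4)) simp
    qed (use t(1) in auto)
    then have "(All x ?\<phi>, e) \<notin> \<Gamma>" using Neg_iff[of "All x ?\<phi>" e] t(1) by simp
    moreover have "e ` fv (All x ?\<phi>) \<subseteq> W" using t(2) by auto
    ultimately obtain w where w: "w \<in> W" "(?\<phi>, e(x := w)) \<notin> \<Gamma>"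
      using All_iff[of ?\<phi> e x] t(1) by auto
    then have eq: "(Equ (Var x) t, e(x := w)) \<in> \<Gamma>" using Neg_iff[of "Equ (Var x) t"] t(1) by auto
    have "sat \<CC> (h \<circ> e(x := w)) (Equ (Var x) t :: ('f, 'r) fm)"
    proof (subst h_iff)
      show "(map_fm id Some (Equ (Var x) t), e(x := w)) \<in> \<Gamma>" using eq by (simp add: trm.map_ident trm.map_id)
    qed (use t w in auto)
    moreover have "val \<CC> (h \<circ> e(x := w)) t = val \<CC> (h \<circ> e) t" by (rule val_cong) (use t(3) in auto)
    ultimately show ?thesis using w(1) eq by auto
  qed
  have fresh: "\<exists>x. x \<notin> vars t" for t :: "'f trm"
    using ex_new_if_finite[OF infinite_UNIV_nat finite_vars] by blast
  have truth: "sat ?N (h \<circ> e) \<phi> \<longleftrightarrow> (\<phi>, e) \<in> \<Gamma>" if "wf_fm ?L \<phi>" "e ` fv \<phi> \<subseteq> W" for \<phi> e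
    using that
  proof (induction \<phi> arbitrary: e)
    case Falsum
    then show ?case using Falsum_notin by simp
  next
    case (Equ s t)
    then have "sat \<CC> (h \<circ> e) (Equ s t :: ('f, 'r) fm) \<longleftrightarrow> (map_fm id Some (Equ s t :: ('f, 'r) fm), e) \<in> \<Gamma>"
      by (intro h_iff) auto
    then show ?case unfolding sat.simps val_pair_struct fm.map trm.map_id .
  next
    case (Atom R ts)
    show ?case
    proof (cases R)
      case None
      then obtain t where t: "ts = [t]" using Atom by (auto simp: length_Suc_conv)
      obtain x where x: "x \<notin> vars t" using fresh by blast
      have "wf_trm L t" "e ` vars t \<subseteq> W" using Atom t by auto
      then obtain w where w: "w \<in> W" "(Equ (Var x) t, e(x := w)) \<in> \<Gamma>" "h w = val \<CC> (h \<circ> e) t"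
        using term_value[OF _ _ x] by blast
      have upd: "val ?S (a \<circ> e(x := w)) t = val ?S (a \<circ> e) t" for a :: "('f, 'r option, 'k) con \<Rightarrow> 'a"
        by (rule val_cong) (use x in auto)
      have "(pm, \<lambda>_. w) \<in> \<Gamma> \<longleftrightarrow> (Atom None [t], e) \<in> \<Gamma>"
      proof
        assume "(pm, \<lambda>_. w) \<in> \<Gamma>"
        then show "(Atom None [t], e) \<in> \<Gamma>"
        proof (rule consequence2[OF w(2)])
          fix a :: "('f, 'r option, 'k) con \<Rightarrow> 'a" assume "sat ?S (a \<circ> e(x := w)) (Equ (Var x) t)" "sat ?S (a \<circ> (\<lambda>_. w)) pm"
          then show "sat ?S (a \<circ> e) (Atom None [t])" unfolding sat.simps upd pm_def by simp
        qed (use Atom t None in auto)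
      next
        assume "(Atom None [t], e) \<in> \<Gamma>"
        then show "(pm, \<lambda>_. w) \<in> \<Gamma>"
        proof (rule consequence2[OF w(2)])
          fix a :: "('f, 'r option, 'k) con \<Rightarrow> 'a" assume "sat ?S (a \<circ> e(x := w)) (Equ (Var x) t)" "sat ?S (a \<circ> e) (Atom None [t])"
          then show "sat ?S (a \<circ> (\<lambda>_. w)) pm" unfolding sat.simps upd pm_def by simp
        qed (simp add: pm_def)
      qed
      moreover have "sat ?N (h \<circ> e) (Atom None [t]) \<longleftrightarrow> h w \<in> Q"
        unfolding sat.simps list.map val_pair_struct w(3) by (simp add: pair_struct_def)
      ultimately show ?thesis using P_iff[OF w(1)] unfolding None t by blast
    next
      case (Some R')
      have "sat \<CC> (h \<circ> e) (Atom R' ts) \<longleftrightarrow> (map_fm id Some (Atom R' ts), e) \<in> \<Gamma>"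
        by (rule h_iff) (use Atom Some in \<open>auto simp: list_all_iff\<close>)
      moreover have "map (val ?N (h \<circ> e)) ts = map (val \<CC> (h \<circ> e)) ts" by simp
      moreover have "rel_int ?N (Some R') = rel_int \<CC> R'" by (simp add: pair_struct_def)
      moreover have "map_fm id Some (Atom R' ts) = Atom (Some R') ts" by (simp add: trm.map_id0)
      ultimately show ?thesis unfolding Some sat.simps by metis
    qed
  next
    case (Imp \<phi> \<psi>)
    have "sat ?N (h \<circ> e) \<phi> \<longleftrightarrow> (\<phi>, e) \<in> \<Gamma>" by (rule Imp.IH(1)) (use Imp.prems in auto)
    moreover have "sat ?N (h \<circ> e) \<psi> \<longleftrightarrow> (\<psi>, e) \<in> \<Gamma>" by (rule Imp.IH(2)) (use Imp.prems in auto)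
    moreover have "wf_fm ?L \<phi>" "wf_fm ?L \<psi>" using Imp.prems by auto
    ultimately show ?case using Imp_iff[of \<phi> \<psi> e] by (simp only: sat.simps)
  next
    case (All x \<phi>)
    have "sat ?N ((h \<circ> e)(x := h w)) \<phi> \<longleftrightarrow> (\<phi>, e(x := w)) \<in> \<Gamma>" if w: "w \<in> W" for w
    proof -
      have "sat ?N (h \<circ> e(x := w)) \<phi> \<longleftrightarrow> (\<phi>, e(x := w)) \<in> \<Gamma>"
        by (rule All.IH) (use All.prems w in auto)
      moreover have "h \<circ> e(x := w) = (h \<circ> e)(x := h w)" by auto
      ultimately show ?thesis by simp
    qed
    moreover have "(All x \<phi>, e) \<in> \<Gamma> \<longleftrightarrow> (\<forall>w\<in>W. (\<phi>, e(x := w)) \<in> \<Gamma>)"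
      by (rule All_iff) (use All.prems in auto)
    ultimately show ?case unfolding sat.simps univ_simps N_def by simp
  qed
  have lift: "\<exists>e'. range e' \<subseteq> W \<and> e = h \<circ> e'" if "range e \<subseteq> N" for e :: "nat \<Rightarrow> 'a"
  proof -
    have "\<forall>i. \<exists>w. w \<in> W \<and> e i = h w" using that by (auto simp: N_def)
    from choice[OF this] show ?thesis by (auto simp: fun_eq_iff)
  qed
  have W_ne: "Base \<in> W" by (rule consts_over.intros(1))
  have NU: "N \<subseteq> U" using h(1) by (auto simp: N_def)
  have N_struct: "is_struct L (substruct \<CC> N)" unfolding is_struct_def univ_simps
  proof (intro conjI ballI)
    show "N \<noteq> {}" using W_ne by (auto simp: N_def)
    fix g xs assume g: "g \<in> funs L" and xs: "xs \<in> tuples (fun_ar L g) N"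
    let ?t = "App g (map Var [0..<length xs])"
    obtain n0 where n0: "n0 \<in> N" using W_ne by (auto simp: N_def)
    define e where "e = (\<lambda>i. if i < length xs then xs ! i else n0)"
    have "range e \<subseteq> N" using xs n0 by (auto simp: e_def tuples_def)
    then obtain e' where e': "range e' \<subseteq> W" "e = h \<circ> e'" using lift by blast
    obtain x where x: "x \<notin> vars ?t" using fresh by blast
    have "wf_trm L ?t" using g xs by (auto simp: tuples_def list_all_iff)
    moreover have "e' ` vars ?t \<subseteq> W" using e'(1) by auto
    ultimately obtain w where "w \<in> W" "h w = val \<CC> (h \<circ> e') ?t" using term_value[OF _ _ x] by blast
    moreover have "map (val \<CC> e) (map Var [0..<length xs]) = xs"
      by (rule nth_equalityI) (auto simp: e_def)
    then have "val \<CC> e ?t = fun_int \<CC> g xs" by (simp only: val.simps)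
    ultimately have "w \<in> W" "fun_int \<CC> g xs = h w" unfolding e'(2) by (simp_all only:)
    then have "fun_int \<CC> g xs \<in> N" unfolding N_def by (metis image_eqI)
    then show "fun_int (substruct \<CC> N) g xs \<in> N" by (simp add: substruct_def)
  qed
  have N_elem: "elementary_substruct L \<CC> N" unfolding elementary_substruct_def
  proof (intro conjI allI impI NU N_struct)
    fix \<phi> and e :: "nat \<Rightarrow> 'a" assume *: "wf_fm L \<phi> \<and> range e \<subseteq> N"
    then obtain e' where e': "range e' \<subseteq> W" "e = h \<circ> e'" using lift by blast
    have "sat (substruct \<CC> N) e \<phi> \<longleftrightarrow> sat ?N (h \<circ> e') (map_fm id Some \<phi>)" unfolding sat_map_fm e'(2) ..
    also have "\<dots> \<longleftrightarrow> (map_fm id Some \<phi>, e') \<in> \<Gamma>" by (rule truth) (use * e' in \<open>auto simp: wf_map_fm\<close>)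
    also have "\<dots> \<longleftrightarrow> sat \<CC> e \<phi>" unfolding e'(2) by (rule h_iff[symmetric]) (use * e' in auto)
    finally show "sat (substruct \<CC> N) e \<phi> \<longleftrightarrow> sat \<CC> e \<phi>" .
  qed
  show ?thesis
  proof (rule that)
    have "|N| <o \<mu>" unfolding N_def using W_mu by (meson card_of_image ordLeq_ordLess_trans)
    then show "sm N" using NU by (simp add: small_def)
    show "elementary_substruct L \<CC> N" by (rule N_elem)
    show "Q \<subseteq> N" by (auto simp: Q_def N_def)
  next
    fix \<phi> assume \<phi>: "\<phi> \<in> sentences ?L" "models ?S {\<phi>}"
    have "sat ?N e \<phi>" if e: "range e \<subseteq> N" for e
    proof -
      obtain e' where e': "range e' \<subseteq> W" "e = h \<circ> e'" using lift[OF e] by blast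
      have "(\<phi>, e') \<in> \<Gamma>"
      proof (rule consequence[of "{}"])
        fix a :: "('f, 'r option, 'k) con \<Rightarrow> 'a" assume "range a \<subseteq> univ ?S"
        then have "range (a \<circ> e') \<subseteq> univ ?S" by auto
        then show "sat ?S (a \<circ> e') \<phi>" using \<phi>(2) unfolding models_def by blast
      qed (use \<phi>(1) in \<open>auto simp: sentences_def\<close>)
      then show ?thesis using truth[of \<phi> e'] \<phi>(1) e' unfolding sentences_def by auto
    qed
    then show "models ?N {\<phi>}" by (simp add: models_def)
  next
    fix A assume A: "A \<subseteq> N" "|A| \<le>o \<theta>"
    show "realizes_types N Q A" unfolding realizes_types_def
    proof (intro allI impI)
      fix p assume p: "\<forall>x\<in>p. wf_fm ?L (fst x) \<and> set (snd x) \<subseteq> A"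
        and fin: "\<forall>p0\<subseteq>p. finite p0 \<longrightarrow> (\<exists>g. range g \<subseteq> N \<and> (\<forall>x\<in>p0. sat ?N (frame (snd x) g) (fst x)))"
      have "|A| \<le>o |K|" using A(2) K\<theta> ordIso_symmetric ordLeq_ordIso_trans by blast
      then obtain k where k: "inj_on k A" "k ` A \<subseteq> K" using card_of_ordLeq[of A K] by auto
      have "\<forall>x\<in>A. \<exists>w. w \<in> W \<and> h w = x" using A(1) by (auto simp: N_def)
      from bchoice[OF this] obtain hi where hi: "\<forall>x\<in>A. hi x \<in> W \<and> h (hi x) = x" by (elim exE)
      \<comment> \<open>The indexing: every element of \<open>A\<close> receives an index through
        \<open>k\<close>, and that index is sent to a constant naming the element.\<close>
      define f where "f = (\<lambda>i. if i \<in> k ` A then hi (inv_into A k i) else Base)"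
      have fk: "f (k x) = hi x" if "x \<in> A" for x using that k(1) by (simp add: f_def)
      have f_W: "f i \<in> W" for i
        using hi W_ne by (auto simp: f_def inv_into_into)
      have ind: "indexing (types_over ?L K) K f" using f_W k(2) by (auto simp: indexing_def f_def)
      define tr where "tr = (\<lambda>x :: ('f, 'r option) fm \<times> 'a list. (fst x, map k (snd x)))"
      have q: "tr ` p \<subseteq> types_over ?L K" using p k(2) by (fastforce simp: types_over_def tr_def)
      have fr: "h \<circ> frame (map f (snd (tr x))) g = frame (snd x) (h \<circ> g)" if x: "x \<in> p" for x g
      proof -
        have "h (f (k y)) = y" if "y \<in> set (snd x)" for y
        proof -
          have "y \<in> A" using p x that by blast
          then show ?thesis using fk hi by simp
        qed
        then have "map h (map f (snd (tr x))) = snd x" by (simp add: tr_def map_idI)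
        then show ?thesis unfolding frame_comp by simp
      qed
      have fr_W: "range (frame (map f ks) g) \<subseteq> W" if "range g \<subseteq> W" for ks g
        using that f_W by (auto simp: frame_def)
      have real: "(fst x, frame (map f (snd x)) (Wit (tr ` p) f)) \<in> \<Gamma>" if "x \<in> tr ` p" for x
      proof (rule realized[OF q ind _ that])
        fix \<Gamma>0 q0 assume \<Gamma>0: "\<Gamma>0 \<subseteq> \<Gamma>" "finite \<Gamma>0" and q0: "q0 \<subseteq> tr ` p" "finite q0"
        obtain p0 where p0: "p0 \<subseteq> p" "finite p0" "q0 = tr ` p0" using finite_subset_image[OF q0(2,1)] by blast
        obtain g where g: "range g \<subseteq> N" "\<forall>x\<in>p0. sat ?N (frame (snd x) g) (fst x)" using fin p0(1,2) by metis
        obtain g' where g': "range g' \<subseteq> W" "g = h \<circ> g'" using lift[OF g(1)] by blast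
        \<comment> \<open>Constants naming a realization in \<open>N\<close> of the finite part
          satisfy it according to \<Gamma>. Any assignment satisfying these conditions along with
          \<open>\<Gamma>0\<close> therefore shows that the type is not refuted.\<close>
        let ?\<Delta> = "(\<lambda>x. (fst x, frame (map f (snd (tr x))) g')) ` p0"
        have "(fst x, frame (map f (snd (tr x))) g') \<in> \<Gamma>" if x: "x \<in> p0" for x
        proof -
          have "sat ?N (h \<circ> frame (map f (snd (tr x))) g') (fst x)"
          proof -
            have "h \<circ> frame (map f (snd (tr x))) g' = frame (snd x) g"
              unfolding g'(2) by (rule fr) (use p0(1) x in blast)
            then show ?thesis using bspec[OF g(2) x] by (simp only:)
          qed
          moreover have "wf_fm ?L (fst x)" using p p0(1) x by blast
          moreover have "frame (map f (snd (tr x))) g' ` fv (fst x) \<subseteq> W" using fr_W[OF g'(1)] by blast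
          ultimately show ?thesis using truth by blast
        qed
        then have sub: "\<Gamma>0 \<union> ?\<Delta> \<subseteq> \<Gamma>" using \<Gamma>0(1) by auto
        have "finite (\<Gamma>0 \<union> ?\<Delta>)" using \<Gamma>0(2) p0(2) by simp
        from finsat[unfolded finsat_def, rule_format, OF sub this]
        obtain a where a: "range a \<subseteq> univ ?S" "\<forall>x\<in>\<Gamma>0 \<union> ?\<Delta>. holds ?S a x" by blast
        show "\<exists>a g. range a \<subseteq> univ ?S \<and> range g \<subseteq> univ ?S \<and> (\<forall>x\<in>\<Gamma>0. holds ?S a x) \<and>
          (\<forall>x\<in>q0. sat ?S (frame (map (a \<circ> f) (snd x)) g) (fst x))"
        proof (intro exI[of _ a] exI[of _ "a \<circ> g'"] conjI ballI)
          show "range (a \<circ> g') \<subseteq> univ ?S" using a(1) by auto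
          show "holds ?S a x" if "x \<in> \<Gamma>0" for x using a(2) that by blast
          fix y assume "y \<in> q0"
          then obtain x where x: "x \<in> p0" "y = tr x" using p0(3) by blast
          have "holds ?S a (fst x, frame (map f (snd (tr x))) g')" using a(2) x(1) by blast
          then have "sat ?S (frame (map a (map f (snd (tr x)))) (a \<circ> g')) (fst x)"
            unfolding holds_def fst_conv snd_conv frame_comp .
          moreover have "fst y = fst x" by (simp add: x(2) tr_def)
          ultimately show "sat ?S (frame (map (a \<circ> f) (snd y)) (a \<circ> g')) (fst y)"
            unfolding x(2) map_map by simp
        qed (rule a(1))
      qed
      let ?g = "h \<circ> Wit (tr ` p) f"
      have Wit_W: "range (Wit (tr ` p) f) \<subseteq> W" using Wit_in_W[OF q ind] by blast
      have "sat ?N (frame (snd x) ?g) (fst x)" if x: "x \<in> p" for x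
      proof -
        have "(fst x, frame (map f (snd (tr x))) (Wit (tr ` p) f)) \<in> \<Gamma>"
          using real[of "tr x"] x by (simp add: tr_def)
        moreover have "wf_fm ?L (fst x)" using p x by blast
        moreover have "frame (map f (snd (tr x))) (Wit (tr ` p) f) ` fv (fst x) \<subseteq> W"
          using fr_W[OF Wit_W] by blast
        ultimately have "sat ?N (h \<circ> frame (map f (snd (tr x))) (Wit (tr ` p) f)) (fst x)"
          using truth by blast
        then show ?thesis unfolding fr[OF x] .
      qed
      moreover have "range ?g \<subseteq> N" using Wit_W by (auto simp: N_def)
      ultimately show "\<exists>g. range g \<subseteq> N \<and> (\<forall>x\<in>p. sat ?N (frame (snd x) g) (fst x))" by blast
    qed
  qed
qed

end

subsection \<open>Definable extensions\<close>

text \<open>\<open>D\<close> is any family of relations closed under implication and containing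
  falsity, later those definable over the parameters. Splitting \<open>Z\<close> along one relation
  removes it from the determining set.\<close>

lemma boolean_combination:
  assumes D: "D (\<lambda>_. False)" "\<And>R S. D R \<Longrightarrow> D S \<Longrightarrow> D (\<lambda>z. R z \<longrightarrow> S z)"
    and X: "finite X" "\<And>R. R \<in> X \<Longrightarrow> D R"
    and det: "\<And>z z'. z \<in> Z \<Longrightarrow> z' \<in> Z \<Longrightarrow> (\<And>R. R \<in> X \<Longrightarrow> R z \<longleftrightarrow> R z') \<Longrightarrow> F z \<Longrightarrow> F z'"
  shows "\<exists>R. D R \<and> (\<forall>z\<in>Z. R z \<longleftrightarrow> F z)"
  using X det
proof (induction X arbitrary: Z rule: finite_induct)
  case empty
  show ?case
  proof (cases "\<exists>z\<in>Z. F z")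
    case True
    then have "\<forall>z\<in>Z. F z" using empty.prems(2) by blast
    then show ?thesis using D(2)[OF D(1) D(1)] by (intro exI[of _ "\<lambda>_. False \<longrightarrow> False"]) auto
  next
    case False
    then show ?thesis using D(1) by blast
  qed
next
  case (insert R0 X)
  have "\<exists>R. D R \<and> (\<forall>z\<in>{z \<in> Z. R0 z}. R z \<longleftrightarrow> F z)"
  proof (rule insert.IH)
    fix z z' assume "z \<in> {z \<in> Z. R0 z}" "z' \<in> {z \<in> Z. R0 z}" "\<And>R. R \<in> X \<Longrightarrow> R z \<longleftrightarrow> R z'" "F z"
    then show "F z'" by (intro insert.prems(2)[of z z']) auto
  qed (use insert.prems in auto)
  then obtain R1 where R1: "D R1" "\<forall>z\<in>{z \<in> Z. R0 z}. R1 z \<longleftrightarrow> F z" by blast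
  have "\<exists>R. D R \<and> (\<forall>z\<in>{z \<in> Z. \<not> R0 z}. R z \<longleftrightarrow> F z)"
  proof (rule insert.IH)
    fix z z' assume "z \<in> {z \<in> Z. \<not> R0 z}" "z' \<in> {z \<in> Z. \<not> R0 z}" "\<And>R. R \<in> X \<Longrightarrow> R z \<longleftrightarrow> R z'" "F z"
    then show "F z'" by (intro insert.prems(2)[of z z']) auto
  qed (use insert.prems in auto)
  then obtain R2 where R2: "D R2" "\<forall>z\<in>{z \<in> Z. \<not> R0 z}. R2 z \<longleftrightarrow> F z" by blast
  have D0: "D R0" using insert.prems(1) by simp
  \<comment> \<open>The case distinction "\<open>R1\<close> if \<open>R0\<close>, otherwise
    \<open>R2\<close>", written with implication and falsity only.\<close>
  let ?R = "\<lambda>z. (((R0 z \<longrightarrow> R1 z) \<longrightarrow> (((R0 z \<longrightarrow> False) \<longrightarrow> R2 z) \<longrightarrow> False)) \<longrightarrow> False)"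
  have "D ?R" by (intro D D0 R1(1) R2(1))
  moreover have "\<forall>z\<in>Z. ?R z \<longleftrightarrow> F z" using R1(2) R2(2) by blast
  ultimately show ?case by (intro exI[of _ ?R] conjI)
qed

definition put :: "nat \<Rightarrow> 'a list \<Rightarrow> (nat \<Rightarrow> 'a) \<Rightarrow> nat \<Rightarrow> 'a" where
  "put a y e = (\<lambda>i. if a \<le> i \<and> i < a + length y then y ! (i - a) else e i)"

lemma sat_All_block:
  "sat S e (foldr All [a..<a + k] \<phi>) \<longleftrightarrow> (\<forall>y\<in>tuples k (univ S). sat S (put a y e) \<phi>)"
proof (induction k arbitrary: a e)
  case 0
  have "put a [] e = e" unfolding put_def by (rule ext) auto
  then show ?case by (simp add: tuples_def)
next
  case (Suc k)
  have put: "put (Suc a) y (e(a := c)) = put a (c # y) e" for c y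
    by (auto simp: put_def fun_eq_iff nth_Cons' not_less_eq_eq)
  have "[a..<a + Suc k] = a # [Suc a..<Suc a + k]" by (simp add: upt_conv_Cons del: upt_Suc)
  then have "sat S e (foldr All [a..<a + Suc k] \<phi>) \<longleftrightarrow>
      (\<forall>c\<in>univ S. sat S (e(a := c)) (foldr All [Suc a..<Suc a + k] \<phi>))" by (simp del: upt_Suc)
  also have "\<dots> \<longleftrightarrow> (\<forall>c\<in>univ S. \<forall>y\<in>tuples k (univ S). sat S (put a (c # y) e) \<phi>)"
    by (simp only: Suc.IH put)
  also have "\<dots> \<longleftrightarrow> (\<forall>y\<in>tuples (Suc k) (univ S). sat S (put a y e) \<phi>)"
    by (auto simp: tuples_def length_Suc_conv)
  finally show ?case .
qed

lemma foldr_All_simps: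
  "wf_fm L (foldr All xs \<phi>) = wf_fm L \<phi>" "fv (foldr All xs \<phi>) = fv \<phi> - set xs"
  by (induction xs) auto

lemma equiv_class_in_tuples:
  assumes "s \<in> sorts L S" "u \<in> tuples (fst s) (univ S)"
  shows "{y \<in> tuples (fst s) (univ S). (u, y) \<in> sort_rel S s} \<in> tuples (fst s) (univ S) // sort_rel S s"
proof -
  have "{y \<in> tuples (fst s) (univ S). (u, y) \<in> sort_rel S s} = sort_rel S s `` {u}"
    by (auto simp: sort_rel_def)
  then show ?thesis using assms(2) by (auto intro: quotientI)
qed

text \<open>Outside the set where \<open>\<psi>\<close> defines an equivalence class, the class of the constant tuple
  \<open>(x\<^sub>0, \<dots>, x\<^sub>0)\<close> serves as a default value.\<close>

lemma definable_extension:
  fixes S :: "('a, 'f, 'r) struct" and f :: "'a list \<Rightarrow> ('a, 'f, 'r) imag"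
  assumes s: "s \<in> sorts L S" and D: "D \<subseteq> tuples n (univ S)" "n = 0 \<Longrightarrow> [] \<in> D"
    and \<psi>: "wf_fm (lang_params L A) \<psi>" "fv \<psi> \<subseteq> {..<n + fst s}"
    and f: "\<And>x. x \<in> D \<Longrightarrow> f x \<in> Meq L S" "\<And>x. x \<in> D \<Longrightarrow> fst (f x) = s"
      "\<And>x y. x \<in> D \<Longrightarrow> y \<in> tuples (fst s) (univ S) \<Longrightarrow>
        y \<in> snd (f x) \<longleftrightarrow> sat (struct_params S) (nth (x @ y)) \<psi>"
  shows "\<exists>g. definable_map L S L S A n (tuples n (univ S)) g \<and> (\<forall>x\<in>D. f x = g x)"
proof -
  obtain k \<epsilon> where s_eq: "s = (k, \<epsilon>)" by (cases s)
  let ?U = "univ S" and ?S = "struct_params S"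
  have \<epsilon>: "wf_fm L \<epsilon>" "fv \<epsilon> \<subseteq> {..<2 * k}" using s by (auto simp: sorts_def s_eq)
  have \<psi>_fv: "fv \<psi> \<subseteq> {..<n + k}" using \<psi>(2) by (simp add: s_eq)
  \<comment> \<open>Variables are arranged as arguments \<open>x\<close> (the first
    \<open>n\<close>), value \<open>y\<close> (the next \<open>k\<close>) and a further tuple
    \<open>u\<close> (the last \<open>k\<close>). With \<open>r1\<close> the sort formula relates
    \<open>u\<close> to \<open>y\<close>; with \<open>r2\<close> it relates the constant tuple made
    from the first argument to \<open>y\<close>.\<close>
  define r1 where "r1 = (\<lambda>i. if i < k then n + k + i else n + (i - k))"
  define r2 where "r2 = (\<lambda>i. if i < k then 0 else n + (i - k))"
  have inst: "\<exists>\<epsilon>'. wf_fm (lang_params L A) \<epsilon>' \<and> fv \<epsilon>' \<subseteq> r ` fv \<epsilon> \<and> (\<forall>g. sat ?S g \<epsilon>' = sat S (g \<circ> r) \<epsilon>)" for r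
  proof (rule ex_instance[OF \<epsilon>(1), of UNIV undefined A r])
    fix \<phi>' assume *: "wf_fm (lang_params L A) \<phi>'" "fv \<phi>' \<subseteq> r ` (fv \<epsilon> \<inter> UNIV)"
      "\<And>S g. sat (struct_params S) g \<phi>' = sat S (\<lambda>i. if i \<in> UNIV then g (r i) else undefined i) \<epsilon>"
    have "sat ?S g \<phi>' = sat S (g \<circ> r) \<epsilon>" for g unfolding *(3) by (rule sat_cong) simp
    then show ?thesis using *(1,2) by (intro exI[of _ \<phi>']) auto
  qed simp
  obtain \<epsilon>1 where \<epsilon>1: "wf_fm (lang_params L A) \<epsilon>1" "fv \<epsilon>1 \<subseteq> r1 ` fv \<epsilon>" "\<And>g. sat ?S g \<epsilon>1 = sat S (g \<circ> r1) \<epsilon>"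
    using inst[of r1] by (elim exE conjE) simp
  obtain \<epsilon>2 where \<epsilon>2: "wf_fm (lang_params L A) \<epsilon>2" "fv \<epsilon>2 \<subseteq> r2 ` fv \<epsilon>" "\<And>g. sat ?S g \<epsilon>2 = sat S (g \<circ> r2) \<epsilon>"
    using inst[of r2] by (elim exE conjE) simp
  \<comment> \<open>\<open>\<chi>0\<close> says that \<psi> defines the class of \<open>u\<close>,
    \<open>\<chi>\<close> that it defines the class of some \<open>u\<close>, and
    \<open>\<psi>'\<close> chooses between \<psi> and the default class accordingly.\<close>
  define \<chi>0 where "\<chi>0 = foldr All [n..<n + k] (Conj (Imp \<psi> \<epsilon>1) (Imp \<epsilon>1 \<psi>))"
  define \<chi> where "\<chi> = Neg (foldr All [n + k..<n + k + k] (Neg \<chi>0))"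
  define \<psi>' where "\<psi>' = Conj (Imp \<chi> \<psi>) (Imp (Neg \<chi>) \<epsilon>2)"
  have fv\<epsilon>1: "fv \<epsilon>1 \<subseteq> {n..<n + k + k}" using \<epsilon>1(2) \<epsilon>(2) by (fastforce simp: r1_def)
  have fv\<epsilon>2: "fv \<epsilon>2 \<subseteq> {..<n + k}" using \<epsilon>2(2) \<epsilon>(2) by (fastforce simp: r2_def)
  have wf: "wf_fm (lang_params L A) \<psi>'"
    using \<psi>(1) \<epsilon>1(1) \<epsilon>2(1) by (simp add: \<psi>'_def \<chi>_def \<chi>0_def foldr_All_simps)
  have "fv \<chi> \<subseteq> {..<n}"
    using \<psi>_fv fv\<epsilon>1 by (fastforce simp: \<chi>_def \<chi>0_def foldr_All_simps)
  then have fv': "fv \<psi>' \<subseteq> {..<n + k}" using \<psi>_fv fv\<epsilon>2 by (auto simp: \<psi>'_def)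
  have tup: "length x = n" if "x \<in> tuples n ?U" for x using that by (simp add: tuples_def)
  have e1: "sat ?S (put n y (put (n + k) u e)) \<epsilon>1 \<longleftrightarrow> (u, y) \<in> sort_rel S s"
    if u: "u \<in> tuples k ?U" and y: "y \<in> tuples k ?U" for u y e
  proof -
    have "sat S (put n y (put (n + k) u e) \<circ> r1) \<epsilon> = sat S (nth (u @ y)) \<epsilon>"
    proof (rule sat_cong)
      fix i assume "i \<in> fv \<epsilon>"
      then show "(put n y (put (n + k) u e) \<circ> r1) i = (u @ y) ! i"
        using u y \<epsilon>(2) by (auto simp: put_def r1_def tuples_def nth_append)
    qed
    then show ?thesis using u y unfolding \<epsilon>1(3) by (simp add: sort_rel_def s_eq)
  qed
  have p1: "sat ?S (put n y (put (n + k) u (nth (x @ y0)))) \<psi> \<longleftrightarrow> sat ?S (nth (x @ y)) \<psi>"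
    if x: "x \<in> tuples n ?U" and u: "u \<in> tuples k ?U" and y: "y \<in> tuples k ?U" for x u y y0
  proof (rule sat_cong)
    fix i assume "i \<in> fv \<psi>"
    then have "i < n + k" using \<psi>_fv by auto
    then show "put n y (put (n + k) u (nth (x @ y0))) i = (x @ y) ! i"
      using x u y by (auto simp: put_def tuples_def nth_append)
  qed
  have \<chi>_iff: "sat ?S (nth (x @ y0)) \<chi> \<longleftrightarrow> (\<exists>u\<in>tuples k ?U. \<forall>y\<in>tuples k ?U.
      sat ?S (nth (x @ y)) \<psi> \<longleftrightarrow> (u, y) \<in> sort_rel S s)" if x: "x \<in> tuples n ?U" for x y0
  proof -
    have "sat ?S (put (n + k) u (nth (x @ y0))) \<chi>0 \<longleftrightarrow> (\<forall>y\<in>tuples k ?U.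
        sat ?S (nth (x @ y)) \<psi> \<longleftrightarrow> (u, y) \<in> sort_rel S s)" if u: "u \<in> tuples k ?U" for u
      unfolding \<chi>0_def sat_All_block univ_simps Conj_simps sat.simps
      using p1[OF x u] e1[OF u] by blast
    then show ?thesis unfolding \<chi>_def sat.simps sat_All_block univ_simps by blast
  qed
  have e2: "sat ?S (nth (x @ y)) \<epsilon>2 \<longleftrightarrow> (replicate k (x ! 0), y) \<in> sort_rel S s"
    if x: "x \<in> tuples n ?U" and y: "y \<in> tuples k ?U" and n: "n \<noteq> 0" for x y
  proof -
    have "x ! 0 \<in> ?U" using x n by (auto simp: tuples_def)
    then have rep: "replicate k (x ! 0) \<in> tuples k ?U" by (auto simp: tuples_def)
    have "sat S (nth (x @ y) \<circ> r2) \<epsilon> = sat S (nth (replicate k (x ! 0) @ y)) \<epsilon>"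
    proof (rule sat_cong)
      fix i assume "i \<in> fv \<epsilon>"
      then show "(nth (x @ y) \<circ> r2) i = (replicate k (x ! 0) @ y) ! i"
        using x y n \<epsilon>(2) by (auto simp: r2_def tuples_def nth_append)
    qed
    then show ?thesis using rep y unfolding \<epsilon>2(3) by (simp add: sort_rel_def s_eq)
  qed
  define g where "g = (\<lambda>x. (s, {y \<in> tuples k ?U. sat ?S (nth (x @ y)) \<psi>'}))"
  have f_class: "\<exists>u\<in>tuples k ?U. \<forall>y\<in>tuples k ?U. sat ?S (nth (x @ y)) \<psi> \<longleftrightarrow> (u, y) \<in> sort_rel S s"
    if x: "x \<in> D" for x
  proof -
    have "snd (f x) \<in> tuples k ?U // sort_rel S s"
      using f(1,2)[OF x] by (auto simp: Meq_def s_eq)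
    then obtain u where "u \<in> tuples k ?U" "snd (f x) = sort_rel S s `` {u}" by (rule quotientE)
    then show ?thesis using f(3)[OF x] by (intro bexI[of _ u]) (auto simp: s_eq)
  qed
  have g_Meq: "g x \<in> Meq L S" if x: "x \<in> tuples n ?U" for x
  proof -
    have "\<exists>u\<in>tuples k ?U. {y \<in> tuples k ?U. sat ?S (nth (x @ y)) \<psi>'} = {y \<in> tuples k ?U. (u, y) \<in> sort_rel S s}"
    proof (cases "\<exists>u\<in>tuples k ?U. \<forall>y\<in>tuples k ?U. sat ?S (nth (x @ y)) \<psi> \<longleftrightarrow> (u, y) \<in> sort_rel S s")
      case True
      then obtain u where "u \<in> tuples k ?U" "\<forall>y\<in>tuples k ?U. sat ?S (nth (x @ y)) \<psi> \<longleftrightarrow> (u, y) \<in> sort_rel S s" by blast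
      moreover have "sat ?S (nth (x @ y)) \<psi>' \<longleftrightarrow> sat ?S (nth (x @ y)) \<psi>" for y
        unfolding \<psi>'_def Conj_simps sat.simps \<chi>_iff[OF x] using True by blast
      ultimately show ?thesis by blast
    next
      case False
      \<comment> \<open>The default value reads the first argument, so there must be one. For
        \<open>n = 0\<close> the only argument tuple lies in \<open>D\<close>, where \<psi> already
        defines a class.\<close>
      have n: "n \<noteq> 0"
      proof
        assume "n = 0"
        then have "x = []" "[] \<in> D" using x D(2) by (auto simp: tuples_def)
        then show False using False f_class by blast
      qed
      have "sat ?S (nth (x @ y)) \<psi>' \<longleftrightarrow> (replicate k (x ! 0), y) \<in> sort_rel S s" if "y \<in> tuples k ?U" for y
        unfolding \<psi>'_def Conj_simps sat.simps \<chi>_iff[OF x] e2[OF x that n] using False by blast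
      moreover have "replicate k (x ! 0) \<in> tuples k ?U" using x n by (auto simp: tuples_def)
      ultimately show ?thesis by (intro bexI[of _ "replicate k (x ! 0)"]) auto
    qed
    then obtain u where "u \<in> tuples k ?U" "snd (g x) = {y \<in> tuples k ?U. (u, y) \<in> sort_rel S s}"
      unfolding g_def snd_conv by blast
    then show ?thesis using equiv_class_in_tuples[OF s, of u] s by (simp add: g_def Meq_def s_eq)
  qed
  have "f x = g x" if x: "x \<in> D" for x
  proof -
    have xU: "x \<in> tuples n ?U" using D(1) x by blast
    have "sat ?S (nth (x @ y)) \<psi>' \<longleftrightarrow> sat ?S (nth (x @ y)) \<psi>" for y
      unfolding \<psi>'_def Conj_simps sat.simps \<chi>_iff[OF xU] using f_class[OF x] by blast
    then have "y \<in> snd (f x) \<longleftrightarrow> y \<in> snd (g x)" if "y \<in> tuples k ?U" for y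
      using f(3)[OF x, of y] that by (simp add: g_def s_eq)
    moreover have "snd (f x) \<subseteq> tuples k ?U"
    proof -
      have "snd (f x) \<in> tuples k ?U // sort_rel S s" using f(1,2)[OF x] by (auto simp: Meq_def s_eq)
      then show ?thesis by (auto simp: quotient_def sort_rel_def s_eq)
    qed
    moreover have "snd (g x) \<subseteq> tuples k ?U" by (auto simp: g_def)
    ultimately have "snd (f x) = snd (g x)" by blast
    moreover have "fst (f x) = fst (g x)" using f(2)[OF x] by (simp add: g_def)
    ultimately show ?thesis by (rule prod_eqI[rotated])
  qed
  moreover have "definable_map L S L S A n (tuples n ?U) g" unfolding definable_map_def
  proof (intro conjI ballI)
    show "\<exists>s\<in>sorts L S. \<exists>\<phi>. wf_fm (lang_params L A) \<phi> \<and> fv \<phi> \<subseteq> {..<n + fst s} \<and>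
      (\<forall>x\<in>tuples n ?U. fst (g x) = s \<and> (\<forall>y\<in>tuples (fst s) ?U. y \<in> snd (g x) \<longleftrightarrow> sat ?S (nth (x @ y)) \<phi>))"
      by (intro bexI[OF _ s] exI[of _ \<psi>'] conjI wf) (use fv' in \<open>auto simp: g_def s_eq\<close>)
  qed (rule g_Meq)
  ultimately show ?thesis by blast
qed

section \<open>Imaginary sorts in the monster model, and copying parameters between lovely
  pairs\<close>

context monster begin

text \<open>Evaluated in \<CC> rather than in a model, since conjugates of a value may leave the
  model.\<close>

definition eqv :: "('f, 'r) fm \<Rightarrow> 'a list \<Rightarrow> 'a list \<Rightarrow> bool" where
  "eqv \<epsilon> u v \<longleftrightarrow> sat \<CC> (nth (u @ v)) \<epsilon>"

lemma eqv_erel: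
  assumes "erel L \<CC> \<CC> G" "wf_fm L \<epsilon>" "fv \<epsilon> \<subseteq> {..<2 * k}" "length u = k" "length v = k"
    and "\<And>x. x \<in> set u \<union> set v \<Longrightarrow> (x, \<sigma> x) \<in> G"
  shows "eqv \<epsilon> (map \<sigma> u) (map \<sigma> v) \<longleftrightarrow> eqv \<epsilon> u v"
proof -
  let ?e = "\<lambda>i. ((u @ v) ! i, (map \<sigma> u @ map \<sigma> v) ! i)"
  have "?e i \<in> G" if "i \<in> fv \<epsilon>" for i
  proof -
    have i: "i < length (u @ v)" using that assms(3-5) by auto
    then have "(u @ v) ! i \<in> set (u @ v)" by (rule nth_mem)
    moreover have "(map \<sigma> u @ map \<sigma> v) ! i = \<sigma> ((u @ v) ! i)" using i by (simp flip: map_append)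
    ultimately show ?thesis using assms(6) by simp
  qed
  then have "?e ` fv \<epsilon> \<subseteq> G" by blast
  from erelD[OF assms(1,2) this] show ?thesis by (simp add: eqv_def comp_def)
qed

lemma eqv_Aut:
  assumes "Aut \<sigma>" "wf_fm L \<epsilon>" "fv \<epsilon> \<subseteq> {..<2 * k}" "u \<in> tuples k U" "v \<in> tuples k U"
  shows "eqv \<epsilon> (map \<sigma> u) (map \<sigma> v) \<longleftrightarrow> eqv \<epsilon> u v"
proof (rule eqv_erel[OF _ assms(2,3)])
  show "erel L \<CC> \<CC> {(x, \<sigma> x) |x. x \<in> U}"
    by (rule erel_automorphism[OF assms(1) struct order_refl]) auto
qed (use assms(4,5) in \<open>auto simp: tuples_def\<close>)

lemma eqv_sort_rel:
  assumes "elementary_substruct L \<CC> M" "wf_fm L \<epsilon>" "fv \<epsilon> \<subseteq> {..<2 * k}" "u \<in> tuples k M" "v \<in> tuples k M"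
  shows "(u, v) \<in> sort_rel (substruct \<CC> M) (k, \<epsilon>) \<longleftrightarrow> eqv \<epsilon> u v"
proof -
  have "(u @ v) ! i \<in> M" if "i \<in> fv \<epsilon>" for i
  proof -
    have "i < length (u @ v)" using that assms(3-5) by (auto simp: tuples_def)
    then have "(u @ v) ! i \<in> set (u @ v)" by (rule nth_mem)
    then show ?thesis using assms(4,5) by (auto simp: tuples_def)
  qed
  then have "nth (u @ v) ` fv \<epsilon> \<subseteq> M" by blast
  then have "sat (substruct \<CC> M) (nth (u @ v)) \<epsilon> \<longleftrightarrow> sat \<CC> (nth (u @ v)) \<epsilon>"
    by (rule sat_elementary[OF assms(1,2)])
  then show ?thesis using assms(4,5) by (simp add: sort_rel_def eqv_def)
qed

text \<open>The sort is known to be an equivalence relation only on \<open>M\<close>. The extension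
  property over the empty set moves any three tuples of \<CC> into \<open>M\<close> by one
  automorphism.\<close>

lemma eqv_sym_trans:
  assumes lp: "lp M P" and s: "(k, \<epsilon>) \<in> sorts L (substruct \<CC> M)"
    and u: "u \<in> tuples k U" and v: "v \<in> tuples k U" and w: "w \<in> tuples k U"
  shows "eqv \<epsilon> u v \<Longrightarrow> eqv \<epsilon> v u" "eqv \<epsilon> u v \<Longrightarrow> eqv \<epsilon> v w \<Longrightarrow> eqv \<epsilon> u w"
proof -
  note M = lpD[OF lp]
  have \<epsilon>: "wf_fm L \<epsilon>" "fv \<epsilon> \<subseteq> {..<2 * k}" "equiv (tuples k M) (sort_rel (substruct \<CC> M) (k, \<epsilon>))"
    using s by (auto simp: sorts_def)
  have "set u \<union> set v \<union> set w \<subseteq> U" "finite (set u \<union> set v \<union> set w)" using u v w by (auto simp: tuples_def)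
  then obtain \<sigma> where \<sigma>: "Aut \<sigma>" "\<sigma> ` (set u \<union> set v \<union> set w) \<subseteq> M"
    using extension[OF lp empty_subsetI finite_less_kappa[OF finite.emptyI]] by metis
  have t: "map \<sigma> u \<in> tuples k M" "map \<sigma> v \<in> tuples k M" "map \<sigma> w \<in> tuples k M"
    using u v w \<sigma>(2) by (auto simp: tuples_def)
  have iff: "eqv \<epsilon> a b \<longleftrightarrow> (map \<sigma> a, map \<sigma> b) \<in> sort_rel (substruct \<CC> M) (k, \<epsilon>)"
    if "a \<in> tuples k U" "b \<in> tuples k U" "map \<sigma> a \<in> tuples k M" "map \<sigma> b \<in> tuples k M" for a b
    unfolding eqv_sort_rel[OF M(6) \<epsilon>(1,2) that(3,4)] eqv_Aut[OF \<sigma>(1) \<epsilon>(1,2) that(1,2)] ..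
  show "eqv \<epsilon> v u" if "eqv \<epsilon> u v"
    using equivE[OF \<epsilon>(3)] that unfolding iff[OF u v t(1,2)] iff[OF v u t(2,1)] by (metis symD)
  show "eqv \<epsilon> u w" if "eqv \<epsilon> u v" "eqv \<epsilon> v w"
    using equivE[OF \<epsilon>(3)] that unfolding iff[OF u v t(1,2)] iff[OF v w t(2,3)] iff[OF u w t(1,3)] by (metis transD)
qed

lemma imaginary_valuedI:
  assumes lp: "lp M P" and s: "(k, \<epsilon>) \<in> sorts L (substruct \<CC> M)" and "lp N Q" "wf_fm (lang2 L) \<phi>"
  shows "imaginary_valued L T \<CC> indep \<mu> \<kappa>\<^sub>0 \<kappa> N Q \<phi> k (eqv \<epsilon>)"
proof unfold_locales
  have \<epsilon>: "wf_fm L \<epsilon>" "fv \<epsilon> \<subseteq> {..<2 * k}" using s by (auto simp: sorts_def)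
  show "eqv \<epsilon> (map \<sigma> u) (map \<sigma> v) \<longleftrightarrow> eqv \<epsilon> u v"
    if "Aut \<sigma>" "u \<in> tuples k U" "v \<in> tuples k U" for \<sigma> u v
    by (rule eqv_Aut[OF that(1) \<epsilon> that(2,3)])
  show "eqv \<epsilon> v u" if "u \<in> tuples k U" "v \<in> tuples k U" "eqv \<epsilon> u v" for u v
    using eqv_sym_trans(1)[OF lp s that(1,2,2,3)] .
  show "eqv \<epsilon> u w" if "u \<in> tuples k U" "v \<in> tuples k U" "w \<in> tuples k U" "eqv \<epsilon> u v" "eqv \<epsilon> v w" for u v w
    using eqv_sym_trans(2)[OF lp s that(1-3)] that(4,5) by blast
qed (use assms(3,4) in auto)

lemma good_empty:
  assumes lp: "lp M P" "lp N Q" shows "good M P N Q {}"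
proof -
  have ind: "indep {} {} R" if "sm R" for R
  proof -
    have e: "sm {}" by (rule finite_sm) auto
    show ?thesis by (rule ind_sym[OF ind_self_base[OF \<open>sm R\<close> e] \<open>sm R\<close> e e])
  qed
  have "erel L \<CC> \<CC> ({} :: ('a \<times> 'a) set)"
    by (rule erel_automorphism[OF automorphism_id struct order_refl]) auto
  then show ?thesis unfolding good_def P_independent_def
    using ind lpD(4)[OF lp(1)] lpD(4)[OF lp(2)] finite_less_kappa[of "{}"] by simp
qed

text \<open>Starting from the empty map, \<open>C\<close> is copied by density and then
  \<open>A0\<close> by extension. This transports the parameters to another lovely pair.\<close>

lemma ex_good_on:
  assumes lp: "lp M P" "lp N Q" and A: "finite A0" "A0 \<subseteq> M" and C: "C \<subseteq> P" "|C| <o \<kappa>" "indep A0 C P"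
  obtains G where "good M P N Q G" "fst ` G = C \<union> A0"
proof -
  note M = lpD[OF lp(1)] and N = lpD[OF lp(2)]
  obtain G1 where G1: "good M P N Q G1" "fst ` G1 = {} \<union> C"
    using good_add_P[OF lp good_empty[OF lp] C(1,2)] by (metis image_empty)
  obtain \<sigma> where \<sigma>: "Aut \<sigma>" "\<And>a b. (a, b) \<in> G1 \<Longrightarrow> \<sigma> a = b"
    using good_Aut[OF lp G1(1)] by metis
  have "\<sigma> ` A0 \<subseteq> U" using Aut_in_U[OF \<sigma>(1)] A(2) M(2) by blast
  then obtain \<pi> where \<pi>: "Aut \<pi>" "\<And>a. a \<in> snd ` G1 \<Longrightarrow> \<pi> a = a" "\<pi> ` \<sigma> ` A0 \<subseteq> N"
    "indep (\<pi> ` \<sigma> ` A0) (snd ` G1) Q"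
    using extension[OF lp(2) goodD(8,10)[OF G1(1)] finite_imageI[OF A(1)]] by metis
  have eq: "(\<pi> \<circ> \<sigma>) a = b" if "(a, b) \<in> G1" for a b using that \<sigma>(2) \<pi>(2) by force
  have "good M P N Q (G1 \<union> (\<lambda>x. (x, (\<pi> \<circ> \<sigma>) x)) ` A0)"
  proof (rule good_extend[OF lp G1(1) automorphism_comp[OF \<pi>(1) \<sigma>(1)] eq])
    show "indep A0 (fst ` G1) P" using C(3) G1(2) by simp
    show "(\<pi> \<circ> \<sigma>) ` A0 \<subseteq> N" "indep ((\<pi> \<circ> \<sigma>) ` A0) (snd ` G1) Q"
      using \<pi>(3,4) by (simp_all add: image_comp)
  qed (use A in \<open>auto intro: finite_less_kappa\<close>)
  moreover have "fst ` (G1 \<union> (\<lambda>x. (x, (\<pi> \<circ> \<sigma>) x)) ` A0) = C \<union> A0"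
    using G1(2) by (simp add: image_Un image_image)
  ultimately show ?thesis by (rule that)
qed

end

section \<open>The compactness argument\<close>

context monster begin

text \<open>Only finitely many values of \<open>g\<close> occur in a finite part of a type, so the
  back and forth copies them; the other values are arbitrary.\<close>

lemma transfer_finite:
  assumes lp: "lp M P" "lp N Q" and G: "good M P N Q G" and \<tau>: "\<And>a. a \<in> fst ` G \<Longrightarrow> (a, \<tau> a) \<in> G"
    and p: "finite p" "\<And>x. x \<in> p \<Longrightarrow> wf_fm (lang2 L) (fst x) \<and> set (snd x) \<subseteq> fst ` G"
    and g: "range g \<subseteq> M" "\<And>x. x \<in> p \<Longrightarrow> sat (pair_struct \<CC> M P) (frame (snd x) g) (fst x)"
  obtains g' where "range g' \<subseteq> N" "\<And>x. x \<in> p \<Longrightarrow> sat (pair_struct \<CC> N Q) (frame (map \<tau> (snd x)) g') (fst x)"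
proof -
  have "finite (\<Union>x\<in>p. fv (fst x))" using p(1) by simp
  then obtain m where m: "\<And>i. i \<in> (\<Union>x\<in>p. fv (fst x)) \<Longrightarrow> i < m"
    using finite_nat_bound_ex[of _ "\<lambda>i. i"] by blast
  have "finite (g ` {..<m})" "g ` {..<m} \<subseteq> M" using g(1) by auto
  then obtain G' where G': "G \<subseteq> G'" "good M P N Q G'" "g ` {..<m} \<subseteq> fst ` G'"
    using forth[OF lp G] by blast
  obtain n0 where n0: "n0 \<in> N" using lpD(6)[OF lp(2)] by (auto simp: elementary_substruct_def is_struct_def)
  have "\<forall>i. \<exists>b. b \<in> N \<and> (i < m \<longrightarrow> (g i, b) \<in> G')"
  proof
    fix i
    show "\<exists>b. b \<in> N \<and> (i < m \<longrightarrow> (g i, b) \<in> G')"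
    proof (cases "i < m")
      case True
      then have "g i \<in> fst ` G'" using G'(3) by blast
      then obtain b where "(g i, b) \<in> G'" by auto
      then show ?thesis using goodD(1)[OF G'(2)] by auto
    qed (use n0 in auto)
  qed
  from choice[OF this] obtain g' where g': "\<forall>i. g' i \<in> N \<and> (i < m \<longrightarrow> (g i, g' i) \<in> G')" by (elim exE)
  show ?thesis
  proof (rule that)
    show "range g' \<subseteq> N" using g' by auto
    fix x assume x: "x \<in> p"
    let ?e = "\<lambda>i. (frame (snd x) g i, frame (map \<tau> (snd x)) g' i)"
    have "?e i \<in> G'" if i: "i \<in> fv (fst x)" for i
    proof (cases "i < length (snd x)")
      case True
      then have "snd x ! i \<in> fst ` G" using p(2)[OF x] nth_mem by blast
      then show ?thesis using True \<tau> G'(1) by (auto simp: frame_def)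
    next
      case False
      have "i < m" using m x i by blast
      then show ?thesis using False g' by (simp add: frame_def)
    qed
    then have "?e ` fv (fst x) \<subseteq> G'" by blast
    from erelD[OF good_elementary[OF lp G'(2)] _ this] show "sat (pair_struct \<CC> N Q) (frame (map \<tau> (snd x)) g') (fst x)"
      using p(2)[OF x] g(2)[OF x] by (simp add: comp_def)
  qed
qed

lemma ex_shift:
  assumes "wf_fm K \<psi>"
  obtains \<psi>' where "wf_fm K \<psi>'"
    "\<And>(S :: ('b, 'c, 'd) struct) ps g. length ps = l \<Longrightarrow> sat S (frame ps g) \<psi>' = sat S (frame ps (\<lambda>i. g (i + m))) \<psi>"
proof -
  let ?r = "\<lambda>i. if i < l then i else i + m"
  obtain \<psi>' where \<psi>': "wf_fm K \<psi>'" "\<And>(S :: ('b, 'c, 'd) struct) e. sat S e \<psi>' = sat S (e \<circ> ?r) \<psi>"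
    by (rule ex_renaming[OF assms, of ?r]) blast
  have "frame ps g \<circ> ?r = frame ps (\<lambda>i. g (i + m))" if "length ps = l" for ps and g :: "nat \<Rightarrow> 'b"
    using that by (auto simp: frame_def fun_eq_iff)
  then show ?thesis using that[OF \<psi>'(1)] \<psi>'(2) by simp
qed

text \<open>The bound on free variables confines a formula to the listed parameters and the first
  \<open>m\<close> values. In this way it speaks about one of two consecutive blocks of length
  \<open>m\<close>.\<close>

definition param_formulas :: "nat \<Rightarrow> 'a set \<Rightarrow> (('f, 'r) fm \<times> 'a list) set" where
  "param_formulas m A = {x. wf_fm L (fst x) \<and> set (snd x) \<subseteq> A \<and> fv (fst x) \<subseteq> {..<length (snd x) + m}}"

text \<open>Any formula evaluated on pairs of the relation uses finitely many diagonal pairs, which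
  become listed parameters, and pairs from the two blocks, which become variables.\<close>

lemma erel_of_agreement:
  assumes N: "elementary_substruct L \<CC> N" and A: "A \<subseteq> N" and g: "range g \<subseteq> N"
    and agree: "\<And>x. x \<in> param_formulas m A \<Longrightarrow> sat (substruct \<CC> N) (frame (snd x) g) (fst x) \<longleftrightarrow>
      sat (substruct \<CC> N) (frame (snd x) (\<lambda>i. g (i + m))) (fst x)"
  shows "erel L \<CC> \<CC> (Id_on A \<union> (\<lambda>i. (g i, g (i + m))) ` {..<m})"
  unfolding erel_def
proof (intro allI impI)
  fix \<chi> e assume \<chi>: "wf_fm L \<chi>" and e: "e ` fv \<chi> \<subseteq> Id_on A \<union> (\<lambda>i. (g i, g (i + m))) ` {..<m}"
  define V where "V = {i \<in> fv \<chi>. e i \<in> Id_on A}"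
  have "finite V" by (simp add: V_def)
  then obtain ys where ys: "set ys = V" using finite_list by blast
  have "\<forall>i. \<exists>j. i \<in> fv \<chi> - V \<longrightarrow> j < m \<and> e i = (g j, g (j + m))"
    using e by (auto simp: V_def)
  from choice[OF this] obtain j where j: "\<forall>i. i \<in> fv \<chi> - V \<longrightarrow> j i < m \<and> e i = (g (j i), g (j i + m))" by (elim exE)
  define r where "r = (\<lambda>i. if i \<in> set ys then (SOME l. l < length ys \<and> ys ! l = i) else length ys + j i)"
  have r: "r i < length ys \<and> ys ! r i = i" if i: "i \<in> set ys" for i
  proof -
    have "(SOME l. l < length ys \<and> ys ! l = i) < length ys \<and> ys ! (SOME l. l < length ys \<and> ys ! l = i) = i"
      by (rule someI_ex) (use i in \<open>auto simp: in_set_conv_nth\<close>)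
    then show ?thesis using i by (simp add: r_def)
  qed
  obtain \<chi>' where \<chi>': "wf_fm L \<chi>'" "fv \<chi>' \<subseteq> r ` fv \<chi>"
    "\<And>(S :: ('a, 'f, 'r) struct) e. sat S e \<chi>' = sat S (e \<circ> r) \<chi>"
    by (rule ex_renaming[OF \<chi>, of r]) blast
  let ?ps = "map (fst \<circ> e) ys"
  have diag: "fst (e i) \<in> A \<and> snd (e i) = fst (e i)" if "i \<in> V" for i using that by (auto simp: V_def)
  have "r i < length ys + m" if "i \<in> fv \<chi>" for i
  proof (cases "i \<in> set ys")
    case True
    then show ?thesis using r[OF True] by simp
  next
    case False
    then show ?thesis using j that ys by (simp add: r_def)
  qed
  then have "(\<chi>', ?ps) \<in> param_formulas m A"
    using \<chi>'(1,2) diag ys by (fastforce simp: param_formulas_def)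
  from agree[OF this] have ag: "sat (substruct \<CC> N) (frame ?ps g \<circ> r) \<chi> \<longleftrightarrow>
      sat (substruct \<CC> N) (frame ?ps (\<lambda>i. g (i + m)) \<circ> r) \<chi>" by (simp only: \<chi>'(3) fst_conv snd_conv)
  have 1: "(frame ?ps g \<circ> r) i = (fst \<circ> e) i" "(frame ?ps (\<lambda>i. g (i + m)) \<circ> r) i = (snd \<circ> e) i"
    if i: "i \<in> fv \<chi>" for i
  proof -
    have "(frame ?ps g \<circ> r) i = (fst \<circ> e) i \<and> (frame ?ps (\<lambda>i. g (i + m)) \<circ> r) i = (snd \<circ> e) i"
    proof (cases "i \<in> set ys")
      case True
      then show ?thesis using r[OF True] diag ys by (simp add: frame_def)
    next
      case False
      then show ?thesis using j i ys by (simp add: frame_def r_def)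
    qed
    then show "(frame ?ps g \<circ> r) i = (fst \<circ> e) i" "(frame ?ps (\<lambda>i. g (i + m)) \<circ> r) i = (snd \<circ> e) i" by auto
  qed
  have "sat (substruct \<CC> N) (fst \<circ> e) \<chi> \<longleftrightarrow> sat (substruct \<CC> N) (snd \<circ> e) \<chi>"
    using ag sat_cong[of \<chi> "frame ?ps g \<circ> r" "fst \<circ> e"] sat_cong[of \<chi> "frame ?ps (\<lambda>i. g (i + m)) \<circ> r" "snd \<circ> e"] 1
    by blast
  moreover have eN: "e i \<in> N \<times> N" if "i \<in> fv \<chi>" for i
  proof -
    have "e i \<in> Id_on A \<union> (\<lambda>i. (g i, g (i + m))) ` {..<m}" using e that by blast
    moreover have "g i \<in> N" for i using g by blast
    ultimately show ?thesis using A by auto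
  qed
  have "(fst \<circ> e) ` fv \<chi> \<subseteq> N" "(snd \<circ> e) ` fv \<chi> \<subseteq> N" using eN by (fastforce simp: mem_Times_iff)+
  ultimately show "sat \<CC> (fst \<circ> e) \<chi> \<longleftrightarrow> sat \<CC> (snd \<circ> e) \<chi>"
    using sat_elementary[OF N \<chi>] by blast
qed

context
  fixes M P A0 C as n k \<epsilon> \<phi>
  assumes lp: "lp M P" and s: "(k, \<epsilon>) \<in> sorts L (substruct \<CC> M)"
    and A0: "finite A0" "A0 \<subseteq> M" and C: "C \<subseteq> P" "|C| <o \<kappa>" "indep A0 C P"
    and as: "set as \<subseteq> C \<union> A0"
    and \<phi>: "wf_fm (lang2 L) \<phi>" "fv \<phi> \<subseteq> {..<length as + (n + k)}"
    and sv: "\<And>x y y'. x \<in> tuples n P \<Longrightarrow> y \<in> tuples k M \<Longrightarrow> y' \<in> tuples k M \<Longrightarrow>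
      sat (pair_struct \<CC> M P) (frame as (nth (x @ y))) \<phi> \<Longrightarrow>
      sat (pair_struct \<CC> M P) (frame as (nth (x @ y'))) \<phi> \<longleftrightarrow> eqv \<epsilon> y y'"
begin

private lemma \<epsilon>: "wf_fm L \<epsilon>" "fv \<epsilon> \<subseteq> {..<2 * k}"
  using s by (auto simp: sorts_def)

private lemma single_valued_transfer:
  assumes lpN: "lp N Q" and G: "good M P N Q G" "fst ` G = C \<union> A0" and \<tau>: "\<And>a. a \<in> fst ` G \<Longrightarrow> (a, \<tau> a) \<in> G"
    and x: "x \<in> tuples n Q" and y: "y \<in> tuples k N" "y' \<in> tuples k N"
    and sat: "sat (pair_struct \<CC> N Q) (frame (map \<tau> as) (nth (x @ y))) \<phi>"
  shows "sat (pair_struct \<CC> N Q) (frame (map \<tau> as) (nth (x @ y'))) \<phi> \<longleftrightarrow> eqv \<epsilon> y y'"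
proof -
  have "set x \<union> set y \<union> set y' \<subseteq> N" "finite (set x \<union> set y \<union> set y')"
    using x y lpD(3)[OF lpN] by (auto simp: tuples_def)
  then obtain G' where G': "G \<subseteq> G'" "good M P N Q G'" "set x \<union> set y \<union> set y' \<subseteq> snd ` G'"
    using forth_back[OF lp lpN G(1)] by metis
  define \<rho> where "\<rho> = (\<lambda>b. SOME a. (a, b) \<in> G')"
  have \<rho>: "(\<rho> b, b) \<in> G'" if b: "b \<in> set x \<union> set y \<union> set y'" for b
  proof -
    have "b \<in> snd ` G'" using G'(3) b by blast
    then have "\<exists>a. (a, b) \<in> G'" by auto
    then show ?thesis unfolding \<rho>_def by (rule someI_ex)
  qed
  have xM: "map \<rho> x \<in> tuples n P"
  proof -
    have "\<rho> b \<in> P" if "b \<in> set x" for b using goodD(6)[OF G'(2) \<rho>[of b]] that x by (auto simp: tuples_def)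
    then show ?thesis using x by (auto simp: tuples_def)
  qed
  have yM: "map \<rho> z \<in> tuples k M" if z: "z = y \<or> z = y'" for z
  proof -
    have "\<rho> b \<in> M" if "b \<in> set z" for b using goodD(1)[OF G'(2)] \<rho>[of b] that z by auto
    then show ?thesis using y z by (auto simp: tuples_def)
  qed
  have tr: "sat (pair_struct \<CC> M P) (frame as (nth (map \<rho> x @ map \<rho> z))) \<phi> \<longleftrightarrow>
      sat (pair_struct \<CC> N Q) (frame (map \<tau> as) (nth (x @ z))) \<phi>" if z: "z = y \<or> z = y'" for z
  proof -
    let ?e = "\<lambda>i. (frame as (nth (map \<rho> x @ map \<rho> z)) i, frame (map \<tau> as) (nth (x @ z)) i)"
    have "?e i \<in> G'" if i: "i \<in> fv \<phi>" for i
    proof (cases "i < length as")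
      case True
      then have "as ! i \<in> fst ` G" using as G(2) nth_mem[OF True] by blast
      then show ?thesis using True \<tau> G'(1) by (auto simp: frame_def)
    next
      case False
      have len: "i - length as < length (x @ z)" using i \<phi>(2) False x y z by (auto simp: tuples_def)
      then have "(x @ z) ! (i - length as) \<in> set (x @ z)" by (rule nth_mem)
      then have "(\<rho> ((x @ z) ! (i - length as)), (x @ z) ! (i - length as)) \<in> G'" using \<rho> z by auto
      moreover have "(map \<rho> x @ map \<rho> z) ! (i - length as) = \<rho> ((x @ z) ! (i - length as))"
        using len by (simp flip: map_append)
      ultimately show ?thesis using False by (simp add: frame_def)
    qed
    then have "?e ` fv \<phi> \<subseteq> G'" by blast
    from erelD[OF good_elementary[OF lp lpN G'(2)] \<phi>(1) this] show ?thesis by (simp add: comp_def)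
  qed
  have "eqv \<epsilon> (map \<rho> y) (map \<rho> y') \<longleftrightarrow> eqv \<epsilon> y y'"
    by (rule eqv_erel[OF erel_converse[OF goodD(2)[OF G'(2)]] \<epsilon>]) (use y \<rho> in \<open>auto simp: tuples_def\<close>)
  then show ?thesis using sv[OF xM yM yM] tr sat by blast
qed

lemma type_determines_value:
  assumes lpN: "lp N Q" and G: "good M P N Q G" "fst ` G = C \<union> A0" and \<tau>: "\<And>a. a \<in> fst ` G \<Longrightarrow> (a, \<tau> a) \<in> G"
    and g: "range g \<subseteq> N" "\<And>i. i < n \<Longrightarrow> g i \<in> Q" "\<And>i. i < n \<Longrightarrow> g (i + (n + k)) \<in> Q"
    and er: "erel L \<CC> \<CC> (Id_on (snd ` G) \<union> (\<lambda>i. (g i, g (i + (n + k)))) ` {..<n + k})"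
    and sat: "sat (pair_struct \<CC> N Q) (frame (map \<tau> as) g) \<phi>"
  shows "sat (pair_struct \<CC> N Q) (frame (map \<tau> as) (\<lambda>i. g (i + (n + k)))) \<phi>"
proof -
  \<comment> \<open>Changes the order parameters, arguments, value into value, arguments,
    parameters, as required by \<open>imaginary_valued\<close>.\<close>
  define r where "r = (\<lambda>i. if i < length as then k + n + i else
    if i - length as < n then k + (i - length as) else i - length as - n)"
  obtain \<phi>2 where \<phi>2: "wf_fm (lang2 L) \<phi>2" "fv \<phi>2 \<subseteq> r ` fv \<phi>"
    "\<And>(S :: ('a, 'f, 'r option) struct) e. sat S e \<phi>2 = sat S (e \<circ> r) \<phi>"
    by (rule ex_renaming[OF \<phi>(1), of r]) blast
  interpret V: imaginary_valued L T \<CC> indep \<mu> \<kappa>\<^sub>0 \<kappa> N Q \<phi>2 k "eqv \<epsilon>"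
    by (rule imaginary_valuedI[OF lp s lpN \<phi>2(1)])
  let ?as = "map \<tau> as"
  have Phi: "V.Phi (frame x (nth ?as)) y \<longleftrightarrow> sat (pair_struct \<CC> N Q) (frame ?as h) \<phi>"
    if len: "length x = n" "length y = k" and h: "\<And>i. i < n + k \<Longrightarrow> h i = (x @ y) ! i" for x y h
    unfolding V.Phi_def \<phi>2(3)
  proof (rule sat_cong)
    fix i assume "i \<in> fv \<phi>"
    then have "i < length as + (n + k)" using \<phi>(2) by auto
    then show "(frame y (frame x (nth ?as)) \<circ> r) i = frame ?as h i"
      using len h[of "i - length as"] by (auto simp: frame_def r_def nth_append)
  qed
  have J: "j < n + length as" if j: "j \<in> V.J" for j
  proof -
    obtain i where "i \<in> fv \<phi>" "j + k = r i" using j \<phi>2(2) by (auto simp: V.J_def)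
    moreover from this(1) have "i < length as + (n + k)" using \<phi>(2) by auto
    ultimately show ?thesis by (auto simp: r_def split: if_splits)
  qed
  let ?b = "\<lambda>x. frame x (nth ?as)"
  have svN: "V.single_valued_at (?b x)" if x: "x \<in> tuples n Q" for x
    unfolding V.single_valued_at_def
  proof (intro ballI impI)
    fix y y' assume y: "y \<in> tuples k N" "y' \<in> tuples k N" and P: "V.Phi (?b x) y"
    have "V.Phi (?b x) z \<longleftrightarrow> sat (pair_struct \<CC> N Q) (frame ?as (nth (x @ z))) \<phi>" if "z \<in> tuples k N" for z
      by (rule Phi) (use x that in \<open>auto simp: tuples_def\<close>)
    then show "V.Phi (?b x) y' \<longleftrightarrow> eqv \<epsilon> y y'"
      using single_valued_transfer[OF lpN G \<tau> x y] P y by blast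
  qed
  let ?x = "map g [0..<n]" and ?y = "map (\<lambda>i. g (n + i)) [0..<k]"
  let ?x' = "map (\<lambda>i. g (i + (n + k))) [0..<n]" and ?y' = "map (\<lambda>i. g (n + i + (n + k))) [0..<k]"
  have x: "?x \<in> tuples n Q" "?x' \<in> tuples n Q" using g(2,3) by (auto simp: tuples_def)
  have y: "?y \<in> tuples k N" "?y' \<in> tuples k N" using g(1) by (auto simp: tuples_def)
  have bJ: "j < n \<and> ?b ?x j = g j \<and> ?b ?x' j = g (j + (n + k)) \<or>
      ?b ?x j \<in> snd ` G \<and> ?b ?x' j = ?b ?x j" if j: "j \<in> V.J" for j
  proof (cases "j < n")
    case False
    then have l: "j - n < length as" using J[OF j] by auto
    then have "as ! (j - n) \<in> fst ` G" using as G(2) nth_mem[OF l] by blast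
    then have "(as ! (j - n), \<tau> (as ! (j - n))) \<in> G" by (rule \<tau>)
    then have "\<tau> (as ! (j - n)) \<in> snd ` G" by (metis image_eqI snd_conv)
    then show ?thesis using False l by (simp add: frame_def)
  qed (simp add: frame_def)
  have "V.Phi (?b ?x') ?y'"
  proof (rule V.type_determines[OF goodD(8,10,5)[OF G(1)]])
    show "?b ?x j \<in> Q \<and> ?b ?x' j \<in> Q \<or> ?b ?x j \<in> snd ` G \<and> ?b ?x' j = ?b ?x j" if "j \<in> V.J" for j
      using bJ[OF that] g(2,3) by auto
    have "(?b ?x j, ?b ?x' j) \<in> Id_on (snd ` G) \<union> (\<lambda>i. (g i, g (i + (n + k)))) ` {..<n + k}" if "j \<in> V.J" for j
      using bJ[OF that]
    proof
      assume "j < n \<and> ?b ?x j = g j \<and> ?b ?x' j = g (j + (n + k))"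
      then show ?thesis by (intro UnI2 image_eqI[of _ _ j]) auto
    next
      assume "?b ?x j \<in> snd ` G \<and> ?b ?x' j = ?b ?x j"
      then show ?thesis by (simp only: Id_on_iff Un_iff simp_thms)
    qed
    moreover have "(?y ! i, ?y' ! i) \<in> (\<lambda>i. (g i, g (i + (n + k)))) ` {..<n + k}" if "i < k" for i
      using that by (intro image_eqI[of _ _ "n + i"]) auto
    ultimately show "erel L \<CC> \<CC> (Id_on (snd ` G) \<union> (\<lambda>j. (?b ?x j, ?b ?x' j)) ` V.J \<union> (\<lambda>i. (?y ! i, ?y' ! i)) ` {..<k})"
      by (intro erel_mono[OF er]) blast
    have "V.Phi (?b ?x) ?y \<longleftrightarrow> sat (pair_struct \<CC> N Q) (frame ?as g) \<phi>"
      by (rule Phi) (auto simp: nth_append)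
    then show "V.Phi (?b ?x) ?y" using sat by blast
  qed (use svN x y in auto)
  moreover have "V.Phi (?b ?x') ?y' \<longleftrightarrow> sat (pair_struct \<CC> N Q) (frame ?as (\<lambda>i. g (i + (n + k)))) \<phi>"
    by (rule Phi) (auto simp: nth_append)
  ultimately show ?thesis by blast
qed

text \<open>If no finite set of \<L>-formulas over the parameters decided \<phi>, a saturated pair
  would contain two argument-value tuples with arguments in the predicate and equal \<L>-types over
  the copied parameters, satisfying \<phi> and its negation. This contradicts
  \<open>type_determines_value\<close>.\<close>

lemma ex_uniform_formulas:
  assumes T: "|T| <o \<kappa>" and fo: "loveliness_first_order L \<mu> \<CC> indep \<kappa>"
  shows "\<exists>X. finite X \<and> X \<subseteq> param_formulas (n + k) (C \<union> A0) \<and>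
    (\<forall>x\<in>tuples n P. \<forall>y\<in>tuples k M. \<forall>x'\<in>tuples n P. \<forall>y'\<in>tuples k M.
      (\<forall>c\<in>X. sat (substruct \<CC> M) (frame (snd c) (nth (x @ y))) (fst c) \<longleftrightarrow>
        sat (substruct \<CC> M) (frame (snd c) (nth (x' @ y'))) (fst c)) \<longrightarrow>
      sat (pair_struct \<CC> M P) (frame as (nth (x @ y))) \<phi> \<longrightarrow>
      sat (pair_struct \<CC> M P) (frame as (nth (x' @ y'))) \<phi>)"
proof (rule ccontr)
  assume no: "\<not> ?thesis"
  let ?S = "pair_struct \<CC> M P" and ?m = "n + k"
  define separating where "separating = (\<lambda>X. \<forall>x\<in>tuples n P. \<forall>y\<in>tuples k M. \<forall>x'\<in>tuples n P. \<forall>y'\<in>tuples k M.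
      (\<forall>c\<in>X. sat (substruct \<CC> M) (frame (snd c) (nth (x @ y))) (fst c) \<longleftrightarrow>
        sat (substruct \<CC> M) (frame (snd c) (nth (x' @ y'))) (fst c)) \<longrightarrow>
      sat ?S (frame as (nth (x @ y))) \<phi> \<longrightarrow> sat ?S (frame as (nth (x' @ y'))) \<phi>)"
  have no_sep: "\<not> separating X" if "finite X" "X \<subseteq> param_formulas ?m (C \<union> A0)" for X
  proof
    assume "separating X"
    then have "finite X \<and> X \<subseteq> param_formulas ?m (C \<union> A0) \<and> separating X" using that by (intro conjI)
    then show False using no unfolding separating_def by (rule notE[rotated, OF exI])
  qed
  note M = lpD[OF lp]
  obtain \<theta> :: "'k rel" where \<theta>: "Card_order \<theta>" "\<kappa> \<le>o \<theta>" "ctwo ^c \<theta> <o \<mu>"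
    "\<And>N Q. sm N \<Longrightarrow> elementary_substruct L \<CC> N \<Longrightarrow> Q \<subseteq> N \<Longrightarrow> models (pair_struct \<CC> N Q) (Td L \<mu> \<CC> indep \<kappa>) \<Longrightarrow>
      saturated (lang2 L) (pair_struct \<CC> N Q) \<theta> \<Longrightarrow> lp N Q"
    using fo unfolding loveliness_first_order_def by blast
  have "Cinfinite \<theta>" using \<theta>(1) cinfinite_mono[OF \<theta>(2)] Cinfinite_kappa by blast
  moreover have "|T| \<le>o \<theta>" using T \<theta>(2) ordLess_imp_ordLeq ordLeq_transitive by blast
  ultimately obtain N Q where N: "sm N" "elementary_substruct L \<CC> N" "Q \<subseteq> N"
    "\<And>\<phi>. \<phi> \<in> sentences (lang2 L) \<Longrightarrow> models ?S {\<phi>} \<Longrightarrow> models (pair_struct \<CC> N Q) {\<phi>}"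
    "\<And>A. A \<subseteq> N \<Longrightarrow> |A| \<le>o \<theta> \<Longrightarrow> realizes_types N Q A"
    using ex_realizing_pair[OF M(6) _ \<theta>(3), of P] by blast
  let ?N = "pair_struct \<CC> N Q"
  have "models ?N {\<psi>}" if "\<psi> \<in> Td L \<mu> \<CC> indep \<kappa>" for \<psi>
    using that lp by (intro N(4)) (auto simp: Td_def)
  then have "models ?N (Td L \<mu> \<CC> indep \<kappa>)" by (simp add: models_def)
  moreover have "saturated (lang2 L) ?N \<theta>"
    by (rule saturated_if_realizes_types) (rule N(5)[OF _ ordLess_imp_ordLeq])
  ultimately have lpN: "lp N Q" by (rule \<theta>(4)[OF N(1-3)])
  obtain G where G: "good M P N Q G" "fst ` G = C \<union> A0"
    using ex_good_on[OF lp lpN A0 C] .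
  obtain \<tau> where \<tau>: "\<And>a b. (a, b) \<in> G \<Longrightarrow> \<tau> a = b" "\<tau> ` fst ` G = snd ` G" using good_Aut[OF lp lpN G(1)] by metis
  have \<tau>G: "(a, \<tau> a) \<in> G" if a: "a \<in> fst ` G" for a
  proof -
    obtain b where "(a, b) \<in> G" using a by auto
    then show ?thesis using \<tau>(1) by auto
  qed
  \<comment> \<open>\<open>sh\<close> shifts the variables behind the parameters by one block, so
    that a formula about the first tuple becomes the same formula about the second.\<close>
  define sh where "sh = (\<lambda>(\<psi> :: ('f, 'r option) fm) l. SOME \<psi>'. wf_fm (lang2 L) \<psi>' \<and>
    (\<forall>(S :: ('a, 'f, 'r option) struct) ps g. length ps = l \<longrightarrow> sat S (frame ps g) \<psi>' = sat S (frame ps (\<lambda>i. g (i + ?m))) \<psi>))"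
  have sh: "wf_fm (lang2 L) (sh \<psi> l) \<and>
    (\<forall>(S :: ('a, 'f, 'r option) struct) ps g. length ps = l \<longrightarrow> sat S (frame ps g) (sh \<psi> l) = sat S (frame ps (\<lambda>i. g (i + ?m))) \<psi>)"
    if \<psi>: "wf_fm (lang2 L) \<psi>" for \<psi> l
    unfolding sh_def
  proof (rule someI_ex)
    show "\<exists>\<psi>'. wf_fm (lang2 L) \<psi>' \<and>
      (\<forall>(S :: ('a, 'f, 'r option) struct) ps g. length ps = l \<longrightarrow> sat S (frame ps g) \<psi>' = sat S (frame ps (\<lambda>i. g (i + ?m))) \<psi>)"
      by (rule ex_shift[OF \<psi>, of l ?m]) blast
  qed
  define Chi where "Chi = param_formulas ?m (C \<union> A0)"
  define iff where "iff = (\<lambda>c :: ('f, 'r) fm \<times> 'a list. let \<psi> = map_fm id Some (fst c); \<psi>' = sh \<psi> (length (snd c)) in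
    (Conj (Imp \<psi> \<psi>') (Imp \<psi>' \<psi>), snd c))"
  \<comment> \<open>\<open>pa\<close> puts both argument tuples into the predicate;
    \<open>pb\<close> makes \<phi> true on the first block and false on the second; the formulas
    \<open>iff c\<close> demand equal \<L>-types of the two blocks over
    \<open>C \<union> A0\<close>.\<close>
  define pa where "pa = (\<lambda>i. (Atom None [Var i] :: ('f, 'r option) fm, [] :: 'a list)) ` ({..<n} \<union> {?m..<?m + n})"
  define pb where "pb = {(\<phi>, as), (Neg (sh \<phi> (length as)), as)}"
  define p where "p = pa \<union> pb \<union> iff ` Chi"
  have sat_iff: "sat (pair_struct \<CC> N' Q') (frame ps g) (fst (iff c)) \<longleftrightarrow>
      (sat (substruct \<CC> N') (frame ps g) (fst c) \<longleftrightarrow> sat (substruct \<CC> N') (frame ps (\<lambda>i. g (i + ?m))) (fst c))"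
    if c: "wf_fm L (fst c)" "length ps = length (snd c)" for N' Q' ps g c
  proof -
    have wf: "wf_fm (lang2 L) (map_fm id Some (fst c))" using c(1) by (simp add: wf_map_fm)
    show ?thesis using sh[OF wf, of "length (snd c)"] c(2)
      by (auto simp: iff_def Let_def sat_map_fm)
  qed
  have snd_iff: "snd (iff c) = snd c" for c by (simp add: iff_def Let_def)
  have p_wf: "wf_fm (lang2 L) (fst x) \<and> set (snd x) \<subseteq> C \<union> A0" if x: "x \<in> p" for x
  proof -
    consider "x \<in> pa" | "x \<in> pb" | c where "c \<in> Chi" "x = iff c" using x by (auto simp: p_def)
    then show ?thesis
    proof cases
      case 1
      then show ?thesis by (auto simp: pa_def)
    next
      case 2
      then show ?thesis using \<phi>(1) sh[OF \<phi>(1)] as by (auto simp: pb_def)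
    next
      case 3
      then have "wf_fm (lang2 L) (map_fm id Some (fst c))" by (simp add: wf_map_fm Chi_def param_formulas_def)
      then show ?thesis using 3 sh by (auto simp: iff_def Let_def Chi_def param_formulas_def)
    qed
  qed
  have finsat_M: "\<exists>g. range g \<subseteq> M \<and> (\<forall>x\<in>p0. sat ?S (frame (snd x) g) (fst x))" if p0: "p0 \<subseteq> p" "finite p0" for p0
  proof -
    have sub: "p0 \<inter> iff ` Chi \<subseteq> iff ` Chi" by blast
    have fin: "finite (p0 \<inter> iff ` Chi)" using p0(2) by simp
    obtain X where X: "X \<subseteq> Chi" "finite X" "p0 \<inter> iff ` Chi = iff ` X"
      using finite_subset_image[OF fin sub] by blast
    obtain x y x' y' where xy: "x \<in> tuples n P" "y \<in> tuples k M" "x' \<in> tuples n P" "y' \<in> tuples k M"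
      "\<forall>c\<in>X. sat (substruct \<CC> M) (frame (snd c) (nth (x @ y))) (fst c) \<longleftrightarrow>
        sat (substruct \<CC> M) (frame (snd c) (nth (x' @ y'))) (fst c)"
      "sat ?S (frame as (nth (x @ y))) \<phi>" "\<not> sat ?S (frame as (nth (x' @ y'))) \<phi>"
      using no_sep[OF X(2) X(1)[unfolded Chi_def]] unfolding separating_def by blast
    obtain m0 where m0: "m0 \<in> M" using M(6) by (auto simp: elementary_substruct_def is_struct_def)
    \<comment> \<open>The two tuples that a finite set fails to separate are written one after the
      other; \<open>m0\<close> only fills the remaining places.\<close>
    define g where "g = (\<lambda>i. if i < ?m then (x @ y) ! i else if i < ?m + ?m then (x' @ y') ! (i - ?m) else m0)"
    have len: "length (x @ y) = ?m" "length (x' @ y') = ?m" using xy by (auto simp: tuples_def)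
    have inM: "set (x @ y) \<subseteq> M" "set (x' @ y') \<subseteq> M" using xy M(3) by (auto simp: tuples_def)
    have "g i \<in> M" for i
    proof -
      have "(x @ y) ! i \<in> M" if "i < ?m" using nth_mem[of i "x @ y"] inM(1) len that by auto
      moreover have "(x' @ y') ! (i - ?m) \<in> M" if "i < ?m + ?m" "\<not> i < ?m"
      proof -
        have "i - ?m < length (x' @ y')" using that unfolding len(2) by linarith
        then show ?thesis using nth_mem inM(2) by blast
      qed
      ultimately show ?thesis using m0 by (simp add: g_def)
    qed
    then have gM: "range g \<subseteq> M" by blast
    have g1: "sat S (frame ps g) \<chi> = sat S (frame ps (nth (x @ y))) \<chi>"
      "sat S (frame ps (\<lambda>i. g (i + ?m))) \<chi> = sat S (frame ps (nth (x' @ y'))) \<chi>"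
      if "fv \<chi> \<subseteq> {..<length ps + ?m}" for S :: "('a, 'f, 'q) struct" and ps \<chi>
    proof -
      have b: "i < length ps + ?m" if "i \<in> fv \<chi>" for i using \<open>fv \<chi> \<subseteq> {..<length ps + ?m}\<close> that by auto
      show "sat S (frame ps g) \<chi> = sat S (frame ps (nth (x @ y))) \<chi>"
      proof (rule sat_cong)
        fix i assume "i \<in> fv \<chi>"
        then have "i < length ps + ?m" by (rule b)
        then show "(frame ps g) i = (frame ps (nth (x @ y))) i" by (auto simp: frame_def g_def)
      qed
      show "sat S (frame ps (\<lambda>i. g (i + ?m))) \<chi> = sat S (frame ps (nth (x' @ y'))) \<chi>"
      proof (rule sat_cong)
        fix i assume "i \<in> fv \<chi>"
        then have "i < length ps + ?m" by (rule b)
        then show "(frame ps (\<lambda>i. g (i + ?m))) i = (frame ps (nth (x' @ y'))) i" by (auto simp: frame_def g_def)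
      qed
    qed
    have "sat ?S (frame (snd c) g) (fst c)" if c: "c \<in> p0" for c
    proof -
      have "c \<in> pa \<or> c \<in> pb \<or> c \<in> p0 \<inter> iff ` Chi" using c p0(1) unfolding p_def by blast
      then consider "c \<in> pa" | "c \<in> pb" | "c \<in> iff ` X" unfolding X(3) by blast
      then show ?thesis
      proof cases
        case 1
        then obtain i where i: "i \<in> {..<n} \<union> {?m..<?m + n}" "c = (Atom None [Var i], [])" by (auto simp: pa_def)
        have "g i \<in> P"
        proof (cases "i < n")
          case True
          then have "g i = x ! i" "i < length x" using xy(1) by (auto simp: g_def tuples_def nth_append)
          then show ?thesis using xy(1) nth_mem[of i x] by (auto simp: tuples_def)
        next
          case False
          then have "g i = x' ! (i - ?m)" "i - ?m < length x'" using i(1) xy(3) by (auto simp: g_def tuples_def nth_append)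
          then show ?thesis using xy(3) nth_mem[of "i - ?m" x'] by (auto simp: tuples_def)
        qed
        then show ?thesis using i(2) by (simp add: pair_struct_def frame_def)
      next
        case 2
        have "\<not> sat ?S (frame as (\<lambda>i. g (i + ?m))) \<phi>" unfolding g1(2)[OF \<phi>(2)] by (rule xy(7))
        then have "sat ?S (frame as g) (Neg (sh \<phi> (length as)))"
          using sh[OF \<phi>(1), of "length as"] by simp
        moreover have "sat ?S (frame as g) \<phi>" unfolding g1(1)[OF \<phi>(2)] by (rule xy(6))
        ultimately show ?thesis using 2 by (auto simp: pb_def)
      next
        case 3
        then obtain d where d: "d \<in> X" "c = iff d" by blast
        then have d': "wf_fm L (fst d)" "fv (fst d) \<subseteq> {..<length (snd d) + ?m}"
          using X(1) by (auto simp: Chi_def param_formulas_def)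
        show ?thesis unfolding d(2) snd_iff sat_iff[OF d'(1) refl] g1[OF d'(2)] using xy(5) d(1) by blast
      qed
    qed
    then show ?thesis using gM by blast
  qed
  \<comment> \<open>The type is finitely satisfiable in \<open>M\<close>, but saturation is
    available in \<open>N\<close>; so it is rewritten over the copied parameters.\<close>
  define q where "q = (\<lambda>x. (fst x, map \<tau> (snd x))) ` p"
  have rt: "realizes_types N Q (snd ` G)"
    using N(5)[OF goodD(8)[OF G(1)]] goodD(10)[OF G(1)] \<theta>(2) ordLess_ordLeq_trans ordLess_imp_ordLeq by blast
  have 1: "\<forall>x\<in>q. wf_fm (lang2 L) (fst x) \<and> set (snd x) \<subseteq> snd ` G"
  proof
    fix x assume "x \<in> q"
    then obtain z where z: "z \<in> p" "x = (fst z, map \<tau> (snd z))" by (auto simp: q_def)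
    have "\<tau> ` set (snd z) \<subseteq> \<tau> ` fst ` G" by (rule image_mono) (use p_wf[OF z(1)] G(2) in simp)
    then show "wf_fm (lang2 L) (fst x) \<and> set (snd x) \<subseteq> snd ` G" using p_wf[OF z(1)] z(2) \<tau>(2) by simp
  qed
  have 2: "\<forall>q0\<subseteq>q. finite q0 \<longrightarrow> (\<exists>g. range g \<subseteq> N \<and> (\<forall>x\<in>q0. sat ?N (frame (snd x) g) (fst x)))"
  proof (intro allI impI)
    fix q0 assume q0: "q0 \<subseteq> q" "finite q0"
    obtain p0 where p0: "p0 \<subseteq> p" "finite p0" "q0 = (\<lambda>x. (fst x, map \<tau> (snd x))) ` p0"
      using finite_subset_image[OF q0(2) q0(1)[unfolded q_def]] by blast
    obtain g where g: "range g \<subseteq> M" "\<And>x. x \<in> p0 \<Longrightarrow> sat ?S (frame (snd x) g) (fst x)"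
      using finsat_M[OF p0(1,2)] by blast
    obtain g' where "range g' \<subseteq> N" "\<And>x. x \<in> p0 \<Longrightarrow> sat ?N (frame (map \<tau> (snd x)) g') (fst x)"
    proof (rule transfer_finite[OF lp lpN G(1) \<tau>G p0(2) _ g])
      show "wf_fm (lang2 L) (fst x) \<and> set (snd x) \<subseteq> fst ` G" if "x \<in> p0" for x
        using p_wf[of x] p0(1) that G(2) by auto
    qed blast+
    then show "\<exists>g. range g \<subseteq> N \<and> (\<forall>x\<in>q0. sat ?N (frame (snd x) g) (fst x))"
      unfolding p0(3) by (intro exI[of _ g']) auto
  qed
  obtain g where g: "range g \<subseteq> N" "\<forall>x\<in>q. sat ?N (frame (snd x) g) (fst x)"
    using rt[unfolded realizes_types_def, THEN spec, THEN mp, OF 1, THEN mp, OF 2] by blast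
  have gp: "sat ?N (frame (map \<tau> (snd x)) g) (fst x)" if "x \<in> p" for x
    using g(2) that unfolding q_def by auto
  have gQ: "g i \<in> Q" if i: "i \<in> {..<n} \<union> {?m..<?m + n}" for i
  proof -
    have "(Atom None [Var i], []) \<in> p" using i by (auto simp: p_def pa_def)
    from gp[OF this] show ?thesis by (simp add: pair_struct_def frame_def)
  qed
  have er: "erel L \<CC> \<CC> (Id_on (snd ` G) \<union> (\<lambda>i. (g i, g (i + ?m))) ` {..<?m})"
  proof (rule erel_of_agreement[OF N(2) goodD(8)[OF G(1)] g(1)])
    fix x assume x: "x \<in> param_formulas ?m (snd ` G)"
    \<comment> \<open>Formulas over the copied parameters are brought back to formulas over the
      original ones, since the agreement was imposed on those.\<close>
    define pre where "pre = (\<lambda>b. SOME a. a \<in> fst ` G \<and> \<tau> a = b)"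
    have pre: "pre b \<in> fst ` G \<and> \<tau> (pre b) = b" if b: "b \<in> snd ` G" for b
    proof -
      have "b \<in> \<tau> ` fst ` G" using b \<tau>(2) by simp
      then have "\<exists>a. a \<in> fst ` G \<and> \<tau> a = b" by blast
      then show ?thesis unfolding pre_def by (rule someI_ex)
    qed
    have set: "set (snd x) \<subseteq> snd ` G" using x by (simp add: param_formulas_def)
    let ?c = "(fst x, map pre (snd x))"
    have "?c \<in> Chi"
    proof -
      have "pre b \<in> C \<union> A0" if b: "b \<in> set (snd x)" for b
        using pre[OF subsetD[OF set b]] unfolding G(2) by (rule conjunct1)
      then show ?thesis using x by (auto simp: Chi_def param_formulas_def)
    qed
    then have "iff ?c \<in> p" by (simp add: p_def)
    moreover have "map \<tau> (snd (iff ?c)) = snd x"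
    proof -
      have "\<tau> (pre b) = b" if b: "b \<in> set (snd x)" for b
        using pre[OF subsetD[OF set b]] by (rule conjunct2)
      then show ?thesis by (simp add: snd_iff map_idI)
    qed
    ultimately have "sat ?N (frame (snd x) g) (fst (iff ?c))" using gp by metis
    moreover have "wf_fm L (fst ?c)" using x by (simp add: param_formulas_def)
    moreover have "length (snd x) = length (snd ?c)" by simp
    ultimately show "sat (substruct \<CC> N) (frame (snd x) g) (fst x) \<longleftrightarrow>
        sat (substruct \<CC> N) (frame (snd x) (\<lambda>i. g (i + ?m))) (fst x)"
      using sat_iff[of ?c "snd x" N Q g] by simp
  qed
  have "(\<phi>, as) \<in> p" "(Neg (sh \<phi> (length as)), as) \<in> p" by (auto simp: p_def pb_def)
  from gp[OF this(1)] gp[OF this(2)] have s: "sat ?N (frame (map \<tau> as) g) \<phi>"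
    "\<not> sat ?N (frame (map \<tau> as) g) (sh \<phi> (length as))" by simp_all
  have "sat ?N (frame (map \<tau> as) (\<lambda>i. g (i + ?m))) \<phi>"
    by (rule type_determines_value[OF lpN G \<tau>G g(1) _ _ er s(1)]) (auto intro!: gQ)
  then show False using s(2) sh[OF \<phi>(1), of "length as"] by simp
qed

end

end

section \<open>Reduction to very small parameters and construction of the extension\<close>

theorem proposition4p6:
  fixes L :: "('f, 'r) lang"
    and T :: "('f, 'r) fm set"
    and \<CC> :: "('a, 'f, 'r) struct"
    and indep :: "'a set \<Rightarrow> 'a set \<Rightarrow> 'a set \<Rightarrow> bool"
    and \<mu> \<kappa>\<^sub>0 \<kappa> :: "'k rel"
    and M P A :: "'a set"
    and n :: nat
    and f :: "'a list \<Rightarrow> ('a, 'f, 'r) imag"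
  assumes "complete_theory L T"
    and "monster_model L T \<mu> \<CC>"
    and "independence_relation L \<mu> \<CC> indep"
    and "is_kappa0 \<mu> \<CC> indep \<kappa>\<^sub>0"
    and "Card_order \<kappa>" and "\<kappa> <o \<mu>" and "\<kappa>\<^sub>0 <o \<kappa>" and "|T| <o \<kappa>"
    and "loveliness_first_order L \<mu> \<CC> indep \<kappa>"
    and "lovely_pair L \<mu> \<CC> indep \<kappa> M P"
    and "A \<subseteq> M" and "P_independent indep P A"
    and "definable_map L (substruct \<CC> M) (lang2 L) (pair_struct \<CC> M P) A n (tuples n P) f"
  shows "\<exists>g. definable_map L (substruct \<CC> M) L (substruct \<CC> M) A n (tuples n M) g \<and>
             (\<forall>x\<in>tuples n P. f x = g x)"
proof -
  interpret monster L T \<CC> indep \<mu> \<kappa>\<^sub>0 \<kappa>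
    using assms(1-7) by unfold_locales
  note lp = assms(10)
  note M = lpD[OF lp]
  let ?M = "substruct \<CC> M" and ?S = "pair_struct \<CC> M P"
  obtain s \<phi> where s: "s \<in> sorts L ?M" and \<phi>: "wf_fm (lang_params (lang2 L) A) \<phi>" "fv \<phi> \<subseteq> {..<n + fst s}"
    and f: "\<And>x. x \<in> tuples n P \<Longrightarrow> fst (f x) = s"
      "\<And>x y. x \<in> tuples n P \<Longrightarrow> y \<in> tuples (fst s) M \<Longrightarrow>
        y \<in> snd (f x) \<longleftrightarrow> sat (struct_params ?S) (nth (x @ y)) \<phi>"
    and f_Meq: "\<And>x. x \<in> tuples n P \<Longrightarrow> f x \<in> Meq L ?M"
    using assms(13) unfolding definable_map_def univ_simps by blast
  obtain k \<epsilon> where s_eq: "s = (k, \<epsilon>)" by (cases s)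
  have \<epsilon>: "wf_fm L \<epsilon>" "fv \<epsilon> \<subseteq> {..<2 * k}" "equiv (tuples k M) (sort_rel ?M s)"
    using s by (auto simp: sorts_def s_eq)
  obtain \<phi>' as where d: "set as \<subseteq> A" "wf_fm (lang2 L) \<phi>'"
    "fv \<phi>' \<subseteq> {..<length as} \<union> (\<lambda>y. y + length as) ` fv \<phi>"
    "\<And>S e. sat (struct_params S) e \<phi> = sat S (\<lambda>i. if i < length as then as ! i else e (i - length as)) \<phi>'"
    by (rule ex_deparametrized[OF \<phi>(1)]) blast
  \<comment> \<open>The layout is now parameters, arguments, value, the one used in the compactness
    argument.\<close>
  have \<phi>'_fv: "fv \<phi>' \<subseteq> {..<length as + (n + k)}" using d(3) \<phi>(2) by (fastforce simp: s_eq)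
  let ?F = "\<lambda>x y. sat ?S (frame as (nth (x @ y))) \<phi>'"
  have F: "?F x y \<longleftrightarrow> y \<in> snd (f x)" if "x \<in> tuples n P" "y \<in> tuples k M" for x y
    using f(2)[OF that(1), of y] that(2) unfolding d(4) by (simp add: s_eq frame_def[abs_def])
  have sv: "?F x y' \<longleftrightarrow> eqv \<epsilon> y y'"
    if x: "x \<in> tuples n P" and y: "y \<in> tuples k M" "y' \<in> tuples k M" and "?F x y" for x y y'
  proof -
    have "snd (f x) \<in> tuples k M // sort_rel ?M s"
      using f_Meq[OF x] f(1)[OF x] by (auto simp: Meq_def s_eq)
    then obtain u where u: "u \<in> tuples k M" "snd (f x) = sort_rel ?M s `` {u}" by (rule quotientE)
    have "(u, y) \<in> sort_rel ?M s" using F[OF x y(1)] \<open>?F x y\<close> u(2) by auto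
    then have "(u, y') \<in> sort_rel ?M s \<longleftrightarrow> (y, y') \<in> sort_rel ?M s"
      using equivE[OF \<epsilon>(3)] by (metis symD transD)
    then show ?thesis
      using F[OF x y(2)] u(2) eqv_sort_rel[OF M(6) \<epsilon>(1,2) y] by (auto simp: s_eq)
  qed
  have AU: "A \<subseteq> U" using assms(11) M(2) by blast
  have smA: "sm A" by (rule sm_subset[OF M(1) assms(11)])
  have smPA: "sm (P \<inter> A)" by (rule sm_subset[OF smA]) auto
  have sm_as: "sm (set as)" by (rule sm_subset[OF smA d(1)])
  \<comment> \<open>A very small base for the occurring parameters is chosen inside
    \<open>P \<inter> A\<close>. Since \<open>A\<close> is P-independent, transitivity makes it a
    base over all of \<open>P\<close>; and as \<open>C\<close> lies in \<open>A\<close>, the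
    formulas found later still have parameters in \<open>A\<close>.\<close>
  obtain C where C: "C \<subseteq> P \<inter> A" "|C| <o \<kappa>" "indep (set as) C (P \<inter> A)"
    using local_character[OF finite_set _ smPA, of as] d(1) AU by blast
  have "indep A (P \<inter> A) P" using assms(12) by (simp add: P_independent_def)
  then have "indep (set as) (P \<inter> A) P" by (rule ind_mono_left[OF _ d(1) smA smPA M(4)])
  then have C': "indep (set as) C P"
    using ind_trans[OF C(1) _ sm_as M(4)] C(3) by blast
  have CP: "C \<subseteq> P" and as_M: "set as \<subseteq> M" using C(1) d(1) assms(11) by auto
  have s': "(k, \<epsilon>) \<in> sorts L ?M" using s by (simp add: s_eq)
  have "\<exists>X. finite X \<and> X \<subseteq> param_formulas (n + k) (C \<union> set as) \<and>
    (\<forall>x\<in>tuples n P. \<forall>y\<in>tuples k M. \<forall>x'\<in>tuples n P. \<forall>y'\<in>tuples k M.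
      (\<forall>c\<in>X. sat ?M (frame (snd c) (nth (x @ y))) (fst c) \<longleftrightarrow> sat ?M (frame (snd c) (nth (x' @ y'))) (fst c)) \<longrightarrow>
      ?F x y \<longrightarrow> ?F x' y')"
    by (rule ex_uniform_formulas[OF lp s' finite_set as_M CP C(2) C' Un_upper2 d(2) \<phi>'_fv sv assms(8,9)])
  then obtain X where X: "finite X" "X \<subseteq> param_formulas (n + k) (C \<union> set as)"
    "\<forall>x\<in>tuples n P. \<forall>y\<in>tuples k M. \<forall>x'\<in>tuples n P. \<forall>y'\<in>tuples k M.
      (\<forall>c\<in>X. sat ?M (frame (snd c) (nth (x @ y))) (fst c) \<longleftrightarrow> sat ?M (frame (snd c) (nth (x' @ y'))) (fst c)) \<longrightarrow>
      ?F x y \<longrightarrow> ?F x' y'"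
    by (elim exE conjE)
  \<comment> \<open>Relations between argument and value that are \<L>-definable over
    \<open>A\<close>; the finitely many formulas in \<open>X\<close> determine the graph of
    \<open>f\<close>, so the graph is a Boolean combination of them.\<close>
  define D where "D = (\<lambda>R :: 'a list \<times> 'a list \<Rightarrow> bool. \<exists>\<psi>. wf_fm (lang_params L A) \<psi> \<and> fv \<psi> \<subseteq> {..<n + k} \<and>
    (\<forall>z. R z \<longleftrightarrow> sat (struct_params ?M) (nth (fst z @ snd z)) \<psi>))"
  let ?R = "\<lambda>c z. sat ?M (frame (snd c) (nth (fst z @ snd z))) (fst c)"
  have "\<exists>R. D R \<and> (\<forall>z\<in>tuples n P \<times> tuples k M. R z \<longleftrightarrow> ?F (fst z) (snd z))"
  proof (rule boolean_combination[of D "?R ` X"])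
    show "D (\<lambda>_. False)" unfolding D_def by (intro exI[of _ Falsum]) auto
    show "D (\<lambda>z. R z \<longrightarrow> R' z)" if R: "D R" "D R'" for R R'
    proof -
      from R obtain \<psi> \<psi>' where "wf_fm (lang_params L A) \<psi>" "fv \<psi> \<subseteq> {..<n + k}"
        "wf_fm (lang_params L A) \<psi>'" "fv \<psi>' \<subseteq> {..<n + k}"
        "\<forall>z. R z \<longleftrightarrow> sat (struct_params ?M) (nth (fst z @ snd z)) \<psi>"
        "\<forall>z. R' z \<longleftrightarrow> sat (struct_params ?M) (nth (fst z @ snd z)) \<psi>'" unfolding D_def by blast
      then show ?thesis unfolding D_def by (intro exI[of _ "Imp \<psi> \<psi>'"]) auto
    qed
    show "finite (?R ` X)" using X(1) by simp
    show "D R" if R: "R \<in> ?R ` X" for R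
    proof -
      obtain c where c: "c \<in> X" "R = ?R c" using R by blast
      let ?l = "length (snd c)"
      have c': "wf_fm L (fst c)" "set (snd c) \<subseteq> A" "fv (fst c) \<subseteq> {..<?l + (n + k)}"
        using subsetD[OF X(2) c(1)] C(1) d(1) by (auto simp: param_formulas_def)
      obtain \<psi> where \<psi>: "wf_fm (lang_params L A) \<psi>" "fv \<psi> \<subseteq> (\<lambda>i. i - ?l) ` (fv (fst c) \<inter> {?l..})"
        "\<And>S g. sat (struct_params S) g \<psi> = sat S (\<lambda>i. if i \<in> {?l..} then g (i - ?l) else snd c ! i) (fst c)"
      proof (rule ex_instance[OF c'(1), of "{?l..}" "nth (snd c)" A "\<lambda>i. i - ?l"])
        show "snd c ! i \<in> A" if "i \<notin> {?l..}" for i using c'(2) nth_mem[of i "snd c"] that by auto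
      qed blast
      have "(\<lambda>i. if i \<in> {?l..} then g (i - ?l) else snd c ! i) = frame (snd c) g" for g :: "nat \<Rightarrow> 'a"
        by (auto simp: frame_def fun_eq_iff)
      then have "\<forall>z. R z \<longleftrightarrow> sat (struct_params ?M) (nth (fst z @ snd z)) \<psi>" by (simp only: c(2) \<psi>(3)) simp
      moreover have "fv \<psi> \<subseteq> {..<n + k}" using \<psi>(2) c'(3) by fastforce
      ultimately show ?thesis unfolding D_def using \<psi>(1) by blast
    qed
    fix z z' assume z: "z \<in> tuples n P \<times> tuples k M" "z' \<in> tuples n P \<times> tuples k M"
      and ag: "\<And>R. R \<in> ?R ` X \<Longrightarrow> R z \<longleftrightarrow> R z'" and F: "?F (fst z) (snd z)"
    have "\<forall>c\<in>X. ?R c z \<longleftrightarrow> ?R c z'" using ag by blast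
    moreover have "fst z \<in> tuples n P" "snd z \<in> tuples k M" "fst z' \<in> tuples n P" "snd z' \<in> tuples k M"
      using z by auto
    ultimately show "?F (fst z') (snd z')" using X(3) F by blast
  qed
  then obtain \<psi> where \<psi>: "wf_fm (lang_params L A) \<psi>" "fv \<psi> \<subseteq> {..<n + k}"
    "\<forall>z\<in>tuples n P \<times> tuples k M. sat (struct_params ?M) (nth (fst z @ snd z)) \<psi> \<longleftrightarrow> ?F (fst z) (snd z)"
    unfolding D_def by (elim exE conjE) simp
  have "\<exists>g. definable_map L ?M L ?M A n (tuples n (univ ?M)) g \<and> (\<forall>x\<in>tuples n P. f x = g x)"
  proof (rule definable_extension[OF s])
    show "tuples n P \<subseteq> tuples n (univ ?M)" using M(3) by (auto simp: tuples_def)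
    show "[] \<in> tuples n P" if "n = 0" using that by (simp add: tuples_def)
    show "fv \<psi> \<subseteq> {..<n + fst s}" using \<psi>(2) by (simp add: s_eq)
    show "y \<in> snd (f x) \<longleftrightarrow> sat (struct_params ?M) (nth (x @ y)) \<psi>"
      if "x \<in> tuples n P" "y \<in> tuples (fst s) (univ ?M)" for x y
    proof -
      have y: "y \<in> tuples k M" using that(2) by (simp add: s_eq)
      have "(x, y) \<in> tuples n P \<times> tuples k M" using that(1) y by simp
      from bspec[OF \<psi>(3) this] show ?thesis using F[OF that(1) y] by simp
    qed
  qed (use \<psi>(1) f(1) f_Meq in auto)
  then show ?thesis by simp
qed

end
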